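(* Let $q=0$ if $\pm=-$ and $q=1$ if $\pm=+$. Let $\widehat\psi_2:X(\mathfrak{so}_3)\to Y(2)$ be the algebra isomorphism $T(u)\mapsto\frac12R^\circ(-1)\,T^\circ_1(2u-\tfrac12)\,T^\circ_2(2u+\tfrac12)$. Then: (1) The restriction of $\widehat\psi_2$ to $X(\mathfrak{so}_3,\mathfrak{so}_{3-q})^{tw}$ yields an isomorphism with $Y^\pm(2)$ given by $$\widehat\psi_2(S(u))=\tfrac12R^\circ(-1)\,S^\circ_1(2u-1)\,R^\circ(-4u+1)^{t_\pm}\,S^\circ_2(2u)\,(K_1K_2)^q.$$ (2) The map $\widehat\psi_2$ descends to an isomorphism between $Y(\mathfrak{so}_3,\mathfrak{so}_{3-q})^{tw}$, viewed as the quotient of $X(\mathfrak{so}_3,\mathfrak{so}_{3-q})^{tw}$ by the ideal generated by the coefficients of the unitarity relation (i.e. by the coefficients of $w(u)-1$), and $SY^\pm(2)$. (3) The restriction of $\widehat\psi_2$ to $Y(\mathfrak{so}_3,\mathfrak{so}_{3-q})^{tw}$, viewed this time as a subalgebra of $X(\mathfrak{so}_3,\mathfrak{so}_{3-q})^{tw}$, also yields an isomorphism with $SY^\pm(2)$.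
   Context: All algebras are unital associative over $\mathbb C$. $2\times 2$ notation: indices in $\{-1,1\}$, $K=E_{11}-E_{-1,-1}$, $P=\sum E_{ij}\otimes E_{ji}$, $(E_{ij})^{t_+}=E_{-j,-i}$, $(E_{ij})^{t_-}=\mathrm{sign}(i)\,\mathrm{sign}(j)E_{-j,-i}$, $Q^\pm$ the partial transpose of $P$ under $t_\pm$, $R^\circ(u)=I-\frac Pu$, $R^\circ(u)^{t_\pm}=I-\frac{Q^\pm}u$. Subscripts $1,2$ denote the tensor factor of $\mathbb C^2\otimes\mathbb C^2$. $Y(2)$ is generated by the coefficients of $T^\circ(u)=I+O(u^{-1})$ with relation $R^\circ(u-v)T^\circ_1(u)T^\circ_2(v)=T^\circ_2(v)T^\circ_1(u)R^\circ(u-v)$. $Y^\pm(2)\subset Y(2)$ is the subalgebra generated by the coefficients of $S^\circ(u)=T^\circ(u)T^\circ(-u)^{t_\pm}$. $SY^\pm(2)$ is realized either as the quotient $Y^\pm(2)/(\mathrm{sdet}\,S^\circ(u)-\gamma_2(u))$, where $\gamma_2(u)=1$ for $+$, $\gamma_2(u)=\frac{2u+1}{2u-1}$ for $-$, $\mathrm{sdet}\,S^\circ(u)=\gamma_2(u)\,\mathrm{qdet}\,T^\circ(u)\,\mathrm{qdet}\,T^\circ(1-u)$ and $\mathrm{qdet}\,T^\circ(u)=t^\circ_{-1,-1}(u-1)t^\circ_{11}(u)-t^\circ_{-1,1}(u-1)t^\circ_{1,-1}(u)$; or as the subalgebra of $Y^\pm(2)$ of elements fixed by all automorphisms $S^\circ(u)\mapsto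 g(u)S^\circ(u)$ with $g(u)\in1+u^{-2}\mathbb C[[u^{-2}]]$. $\mathfrak{so}_3$ algebras: $3\times3$ matrices are indexed by $\{-1,0,1\}$, $(E_{ij})^{t}=E_{-j,-i}$, $P=\sum E_{ij}\otimes E_{ji}$, $Q=\sum E_{ij}\otimes E_{-i,-j}$, $\kappa=\frac12$, $R(u)=I-\frac Pu+\frac Q{u-1/2}$. $X(\mathfrak{so}_3)$ is generated by the coefficients of the $3\times 3$ matrix $T(u)=I+O(u^{-1})$ with relation $R(u-v)T_1(u)T_2(v)=T_2(v)T_1(u)R(u-v)$. For $q=0$ put $K(u)=I$; for $q=1$ put $K(u)=\mathrm{diag}\big(1,\frac{1+4u}{1-4u},1\big)$ (that is, $K(u)=\frac{I-4u\,\mathcal G'}{1-4u}$ with $\mathcal G'=\mathrm{diag}(1,-1,1)$). $X(\mathfrak{so}_3,\mathfrak{so}_{3-q})^{tw}\subset X(\mathfrak{so}_3)$ is the subalgebra generated by the coefficients of $S(u)=T(u-\frac14)K(u)T(-u+\frac14)^t$. It satisfies $S(u)S(-u)=w(u)I$ with $w(u)$ an even series with central coefficients. $Y(\mathfrak{so}_3,\mathfrak{so}_{3-q})^{tw}$ is realized either as the quotient $X(\mathfrak{so}_3,\mathfrak{so}_{3-q})^{tw}/(w(u)-1)$, or as the subalgebra of $X(\mathfrak{so}_3,\mathfrak{so}_{3-q})^{tw}$ of elements fixed by all automorphisms $S(u)\mapsto g(u-\frac14)S(u)$ with $g(u)\in1+u^{-2}\mathbb C[[u^{-2}]]$. Identification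 of $3\times3$ matrices with operators on $\mathbb C^2\otimes\mathbb C^2$: let $e_{-1},e_1$ be the standard basis of $\mathbb C^2$ and $V\subset\mathbb C^2\otimes\mathbb C^2$ be spanned by $v_{-1}=e_{-1}\otimes e_{-1}$, $v_0=\frac1{\sqrt2}(e_{-1}\otimes e_1+e_1\otimes e_{-1})$, $v_1=-e_1\otimes e_1$; $\frac12R^\circ(-1)=\frac12(I+P)$ is the projector onto $V$. With $\langle e_a\otimes e_b\,|\,e_c\otimes e_d\rangle=\delta_{ac}\delta_{bd}$, a formula $M(u)\mapsto A^\circ(u)$, where $M$ is a $3\times3$ matrix and $A^\circ(u)\in\mathrm{End}(\mathbb C^2\otimes\mathbb C^2)\otimes Y(2)[[u^{-1}]]$, means that the entry $M_{ij}(u)$ is sent to $\langle v_i\,|\,A^\circ(u)v_j\rangle$. *)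

theory Defs
  imports
    "HOL-Analysis.Analysis"
    "HOL-Computational_Algebra.Formal_Power_Series"
    "HOL-Library.Poly_Mapping"
    "HOL-Algebra.Module"
    "HOL-Algebra.QuotRing"
begin

section \<open>Unital associative algebras over the complex numbers\<close>

class complex_algebra_1 = ring_1 +
  fixes scaleC :: "complex \<Rightarrow> 'a \<Rightarrow> 'a"  (infixr \<open>*\<^sub>C\<close> 75)
  assumes scaleC_add_right: "c *\<^sub>C (x + y) = c *\<^sub>C x + c *\<^sub>C y"
    and scaleC_add_left: "(c + d) *\<^sub>C x = c *\<^sub>C x + d *\<^sub>C x"
    and scaleC_scaleC: "c *\<^sub>C d *\<^sub>C x = (c * d) *\<^sub>C x"
    and scaleC_one: "1 *\<^sub>C x = x"
    and mult_scaleC_left: "(c *\<^sub>C x) * y = c *\<^sub>C (x * y)"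
    and mult_scaleC_right: "x * (c *\<^sub>C y) = c *\<^sub>C (x * y)"
begin

lemma scaleC_zero_right [simp]: "c *\<^sub>C 0 = 0"
  using scaleC_add_right[of c 0 0] by simp

end

instantiation complex :: complex_algebra_1
begin

definition scaleC_complex :: "complex \<Rightarrow> complex \<Rightarrow> complex"
  where "scaleC_complex c x = c * x"

instance
  by standard (simp_all add: scaleC_complex_def algebra_simps)

end

text \<open>
  A subset of an algebra that is closed under the operations is turned into a
  HOL-Algebra record, so that ideals, quotients and isomorphisms of HOL-Algebra apply.
\<close>

definition alg_of :: "'a::complex_algebra_1 set \<Rightarrow> (complex, 'a) module"
  where "alg_of A = \<lparr>carrier = A, monoid.mult = (*), one = 1, ring.zero = 0, add = (+), smult = (*\<^sub>C)\<rparr>"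

definition subalgebra :: "'a::complex_algebra_1 set \<Rightarrow> bool"
  where "subalgebra A \<longleftrightarrow> 1 \<in> A \<and> (\<forall>x\<in>A. \<forall>y\<in>A. x + y \<in> A \<and> x * y \<in> A) \<and> (\<forall>c. \<forall>x\<in>A. c *\<^sub>C x \<in> A)"

definition subalg_gen :: "'a::complex_algebra_1 set \<Rightarrow> 'a set"
  where "subalg_gen G = subalgebra hull G"

definition quot_alg :: "(complex, 'a) module \<Rightarrow> 'a set \<Rightarrow> (complex, 'a set) module"
  where "quot_alg A I =
    \<lparr>carrier = carrier (A Quot I), monoid.mult = monoid.mult (A Quot I), one = one (A Quot I),
     ring.zero = ring.zero (A Quot I), add = add (A Quot I),
     smult = (\<lambda>c C. \<Union>x\<in>C. I +>\<^bsub>A\<^esub> (c \<odot>\<^bsub>A\<^esub> x))\<rparr>"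

definition alg_iso :: "(complex, 'a) module \<Rightarrow> (complex, 'b) module \<Rightarrow> ('a \<Rightarrow> 'b) set"
  where "alg_iso A B =
    {h \<in> ring_iso A B. \<forall>c. \<forall>x\<in>carrier A. h (c \<odot>\<^bsub>A\<^esub> x) = c \<odot>\<^bsub>B\<^esub> h x}"

section \<open>Free algebras\<close>

datatype 'g free_monoid = Word (letters: "'g list")

instantiation free_monoid :: (type) monoid_add
begin

definition zero_free_monoid :: "'a free_monoid"
  where "zero_free_monoid = Word []"

definition plus_free_monoid :: "'a free_monoid \<Rightarrow> 'a free_monoid \<Rightarrow> 'a free_monoid"
  where "plus_free_monoid v w = Word (letters v @ letters w)"

instance
  by standard (simp_all add: zero_free_monoid_def plus_free_monoid_def)

end

lemma free_monoid_add_eq_0_iff: "0 = v + w \<longleftrightarrow> v = 0 \<and> w = (0 :: 'g free_monoid)"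
  by (cases v; cases w) (auto simp: zero_free_monoid_def plus_free_monoid_def)

lemma single_0_times:
  fixes p :: "'m::monoid_add \<Rightarrow>\<^sub>0 'a::semiring_1"
  shows "Poly_Mapping.lookup (Poly_Mapping.single 0 d * p) k = d * Poly_Mapping.lookup p k"
    and "Poly_Mapping.lookup (p * Poly_Mapping.single 0 d) k = Poly_Mapping.lookup p k * d"
proof -
  show "Poly_Mapping.lookup (Poly_Mapping.single 0 d * p) k = d * Poly_Mapping.lookup p k"
    by (simp add: lookup_mult lookup_single when_mult)
  have "(\<Sum>q. d when 0 = q when k = l + q) = (d when k = l)" for l
  proof -
    have "(d when 0 = q when k = l + q) = ((d when k = l) when q = 0)" for q
      by (auto simp: when_def)
    then show ?thesis by simp
  qed
  then show "Poly_Mapping.lookup (p * Poly_Mapping.single 0 d) k = Poly_Mapping.lookup p k * d"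
    by (simp add: lookup_mult lookup_single mult_when)
qed

instantiation poly_mapping :: (monoid_add, complex_algebra_1) complex_algebra_1
begin

definition scaleC_poly_mapping :: "complex \<Rightarrow> ('a \<Rightarrow>\<^sub>0 'b) \<Rightarrow> ('a \<Rightarrow>\<^sub>0 'b)"
  where "scaleC_poly_mapping c p = Poly_Mapping.map ((*\<^sub>C) c) p"

lemma lookup_scaleC: "Poly_Mapping.lookup (c *\<^sub>C p) k = c *\<^sub>C Poly_Mapping.lookup p k"
  for p :: "'a \<Rightarrow>\<^sub>0 'b"
  by (simp add: scaleC_poly_mapping_def Poly_Mapping.map.rep_eq when_def)

lemma scaleC_conv_single:
  fixes p :: "'a \<Rightarrow>\<^sub>0 'b"
  shows "c *\<^sub>C p = Poly_Mapping.single 0 (c *\<^sub>C 1) * p"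
    and "c *\<^sub>C p = p * Poly_Mapping.single 0 (c *\<^sub>C 1)"
  by (rule poly_mapping_eqI; simp add: lookup_scaleC single_0_times mult_scaleC_left mult_scaleC_right)+

instance
proof
  fix c d :: complex and x y :: "'a \<Rightarrow>\<^sub>0 'b"
  show "c *\<^sub>C (x + y) = c *\<^sub>C x + c *\<^sub>C y"
    by (rule poly_mapping_eqI) (simp add: lookup_scaleC lookup_add scaleC_add_right)
  show "(c + d) *\<^sub>C x = c *\<^sub>C x + d *\<^sub>C x"
    by (rule poly_mapping_eqI) (simp add: lookup_scaleC lookup_add scaleC_add_left)
  show "c *\<^sub>C d *\<^sub>C x = (c * d) *\<^sub>C x"
    by (rule poly_mapping_eqI) (simp add: lookup_scaleC scaleC_scaleC)
  show "1 *\<^sub>C x = x"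
    by (rule poly_mapping_eqI) (simp add: lookup_scaleC scaleC_one)
  show "(c *\<^sub>C x) * y = c *\<^sub>C (x * y)"
    by (simp add: scaleC_conv_single(1) mult.assoc)
  show "x * (c *\<^sub>C y) = c *\<^sub>C (x * y)"
    by (simp add: scaleC_conv_single(2) mult.assoc)
qed

end

section \<open>Series in $u^{-1}$ and matrices of series\<close>

text \<open>
  A series $f(u) = \sum_r f_r u^{-r}$ with coefficients in an algebra is the \<^typ>\<open>'a fps\<close> with
  coefficients $f_r$; thus \<^const>\<open>fps_X\<close> stands for $u^{-1}$.
\<close>

definition fps_map :: "('a \<Rightarrow> 'b) \<Rightarrow> 'a fps \<Rightarrow> 'b fps"
  where "fps_map h f = Abs_fps (\<lambda>r. h (fps_nth f r))"

definition cfps :: "complex fps \<Rightarrow> 'a::complex_algebra_1 fps"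
  where "cfps f = fps_map (\<lambda>c. c *\<^sub>C 1) f"

text \<open>The expansion of $1/(au+b)$, for $a \neq 0$.\<close>

definition inv_lin :: "complex \<Rightarrow> complex \<Rightarrow> complex fps"
  where "inv_lin a b = fps_X / (fps_const a + fps_const b * fps_X)"

text \<open>
  \<open>subst a b f\<close> is $f(au+b) = \sum_r f_r (au+b)^{-r}$; since $(au+b)^{-r} = O(u^{-r})$, the
  coefficient of $u^{-n}$ is a finite sum over $r \le n$.
\<close>

definition subst :: "complex \<Rightarrow> complex \<Rightarrow> 'a::complex_algebra_1 fps \<Rightarrow> 'a fps"
  where "subst a b f = Abs_fps (\<lambda>n. \<Sum>r\<le>n. fps_nth (inv_lin a b ^ r) n *\<^sub>C fps_nth f r)"

definition map_mat :: "('a \<Rightarrow> 'b) \<Rightarrow> 'a^'n^'m \<Rightarrow> 'b^'n^'m"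
  where "map_mat h A = (\<chi> i j. h (A $ i $ j))"

definition mscale :: "'a::times \<Rightarrow> 'a^'n^'m \<Rightarrow> 'a^'n^'m"  (infixr \<open>*\<^sub>m\<close> 75)
  where "c *\<^sub>m A = map_mat ((*) c) A"

definition kron :: "'a::times^'n^'n \<Rightarrow> 'a^'k^'k \<Rightarrow> 'a^('n \<times> 'k)^('n \<times> 'k)"
  where "kron A B = (\<chi> p q. A $ fst p $ fst q * B $ snd p $ snd q)"

definition tens1 :: "'a::semiring_1^'n^'n \<Rightarrow> 'a^('n \<times> 'n)^('n \<times> 'n)"
  where "tens1 A = kron A (mat 1)"

definition tens2 :: "'a::semiring_1^'n^'n \<Rightarrow> 'a^('n \<times> 'n)^('n \<times> 'n)"
  where "tens2 A = kron (mat 1) A"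

definition munit :: "'n \<Rightarrow> 'n \<Rightarrow> 'a::semiring_1^'n^'n"
  where "munit i j = (\<chi> a b. of_bool (a = i \<and> b = j))"

definition Pmat :: "'a::semiring_1^('n::finite \<times> 'n)^('n \<times> 'n)"
  where "Pmat = (\<Sum>i\<in>UNIV. \<Sum>j\<in>UNIV. kron (munit i j) (munit j i))"

definition entry_coeffs :: "'a fps^'n^'m \<Rightarrow> 'a set"
  where "entry_coeffs A = {fps_nth (A $ i $ j) r | i j r. True}"

section \<open>Algebras defined by an RTT relation\<close>

text \<open>
  A series in $u^{-1}$ and $v^{-1}$ is an \<^typ>\<open>'a fps fps\<close>, the outer variable being $v^{-1}$ and the
  inner one $u^{-1}$.
\<close>

definition in_u :: "'a::zero fps \<Rightarrow> 'a fps fps"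
  where "in_u f = fps_const f"

definition in_v :: "'a::zero fps \<Rightarrow> 'a fps fps"
  where "in_v f = fps_map fps_const f"

abbreviation inv_u :: "complex fps fps"
  where "inv_u \<equiv> in_u fps_X"

abbreviation inv_v :: "complex fps fps"
  where "inv_v \<equiv> in_v fps_X"

text \<open>
  The $R$-matrix attached to a set of matrix indices. As $R(u-v)$ is rational in $u-v$, the
  relation $R(u-v)T_1(u)T_2(v) = T_2(v)T_1(u)R(u-v)$ is read, as usual, after multiplication by the
  common denominator; multiplying further by a power of $u^{-1}v^{-1}$ makes the entries of the
  $R$-matrix polynomials in $u^{-1}$ and $v^{-1}$. \<open>cleared_R\<close> is the result; note that
  $u^{-1}v^{-1}(u-v) = v^{-1} - u^{-1}$.
\<close>

class rtt_index = finite +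
  fixes cleared_R :: "complex fps fps^('a \<times> 'a)^('a \<times> 'a)"

text \<open>\<open>Gen i j k\<close> is the coefficient of $u^{-(k+1)}$ in the series $t_{ij}(u)$.\<close>

datatype 'i rtt_gen = Gen 'i 'i nat

type_synonym 'i rtt_free = "'i rtt_gen free_monoid \<Rightarrow>\<^sub>0 complex"

definition free_T :: "'i::finite rtt_free fps^'i^'i"
  where "free_T = (\<chi> i j. Abs_fps (\<lambda>r. case r of
      0 \<Rightarrow> of_bool (i = j)
    | Suc k \<Rightarrow> Poly_Mapping.single (Word [Gen i j k]) 1))"

definition rtt_defect :: "'i::rtt_index rtt_free fps fps^('i \<times> 'i)^('i \<times> 'i)"
  where "rtt_defect =
    (let R = map_mat (fps_map cfps) cleared_R;
         T1 = tens1 (map_mat in_u free_T);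
         T2 = tens2 (map_mat in_v free_T)
     in R ** T1 ** T2 - T2 ** T1 ** R)"

definition rtt_relators :: "'i::rtt_index rtt_free set"
  where "rtt_relators = {fps_nth (fps_nth (rtt_defect $ p $ q) n) m | p q n m. True}"

definition rtt_ideal :: "'i::rtt_index rtt_free set"
  where "rtt_ideal = genideal (alg_of UNIV) rtt_relators"

subsection \<open>The quotient algebra\<close>

lemma ring_alg_of_UNIV: "Ring.ring (alg_of (UNIV :: 'a::complex_algebra_1 set))"
proof (rule ringI)
  show "abelian_group (alg_of (UNIV :: 'a set))"
    by (rule abelian_groupI) (auto simp: alg_of_def algebra_simps intro: exI[of _ "- x" for x])
  show "Group.monoid (alg_of (UNIV :: 'a set))"
    by (rule monoidI) (auto simp: alg_of_def mult.assoc)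
qed (auto simp: alg_of_def distrib_left distrib_right)

lemma minus_alg_of_UNIV: "a_inv (alg_of UNIV) x = - (x :: 'a::complex_algebra_1)"
proof -
  interpret R: Ring.ring "alg_of (UNIV :: 'a set)" by (rule ring_alg_of_UNIV)
  have "add (alg_of UNIV) (- x) x = ring.zero (alg_of UNIV)" by (simp add: alg_of_def)
  then show ?thesis by (intro R.minus_equality) (auto simp: alg_of_def)
qed

lemma ideal_alg_of_UNIV_iff:
  "ideal I (alg_of (UNIV :: 'a::complex_algebra_1 set)) \<longleftrightarrow>
    0 \<in> I \<and> (\<forall>x\<in>I. \<forall>y\<in>I. x + y \<in> I) \<and> (\<forall>x\<in>I. \<forall>a. a * x \<in> I \<and> x * a \<in> I)"
    (is "?L \<longleftrightarrow> ?R")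
proof
  assume ?L
  then interpret ideal I "alg_of (UNIV :: 'a set)" .
  show ?R
    using additive_subgroup.zero_closed[OF is_additive_subgroup]
      additive_subgroup.a_closed[OF is_additive_subgroup] I_l_closed I_r_closed
    by (auto simp: alg_of_def)
next
  assume R: ?R
  have "- x \<in> I" if "x \<in> I" for x
    using R that by (metis mult_minus1)
  with R minus_alg_of_UNIV[where 'a = 'a] show ?L
    by (intro idealI ring_alg_of_UNIV Group.subgroup.intro)
       (auto simp: alg_of_def a_inv_def)
qed

lemma ideal_rtt_ideal: "ideal rtt_ideal (alg_of UNIV)"
proof -
  interpret R: Ring.ring "alg_of (UNIV :: 'i::rtt_index rtt_free set)" by (rule ring_alg_of_UNIV)
  show "ideal (rtt_ideal :: 'i rtt_free set) (alg_of UNIV)"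
    unfolding rtt_ideal_def by (rule R.genideal_ideal) (simp add: alg_of_def)
qed

lemma rtt_ideal_closed:
  "0 \<in> rtt_ideal"
  "x \<in> rtt_ideal \<Longrightarrow> y \<in> rtt_ideal \<Longrightarrow> x + y \<in> rtt_ideal"
  "x \<in> rtt_ideal \<Longrightarrow> a * x \<in> rtt_ideal"
  "x \<in> rtt_ideal \<Longrightarrow> x * a \<in> rtt_ideal"
  "x \<in> rtt_ideal \<Longrightarrow> - x \<in> rtt_ideal"
  "x \<in> rtt_ideal \<Longrightarrow> c *\<^sub>C x \<in> rtt_ideal"
proof -
  note * = ideal_rtt_ideal[unfolded ideal_alg_of_UNIV_iff]
  show "0 \<in> rtt_ideal" "x \<in> rtt_ideal \<Longrightarrow> y \<in> rtt_ideal \<Longrightarrow> x + y \<in> rtt_ideal"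
    using * by blast+
  show l: "x \<in> rtt_ideal \<Longrightarrow> a * x \<in> rtt_ideal" for a
    using * by blast
  show "x \<in> rtt_ideal \<Longrightarrow> x * a \<in> rtt_ideal"
    using * by blast
  show "x \<in> rtt_ideal \<Longrightarrow> - x \<in> rtt_ideal"
    using l[of "- 1"] by simp
  show "x \<in> rtt_ideal \<Longrightarrow> c *\<^sub>C x \<in> rtt_ideal"
    using l[of "c *\<^sub>C 1"] by (simp add: mult_scaleC_left)
qed

text \<open>
  The counit $T(u) \mapsto I$, i.e. the constant coefficient, annihilates the ideal of relations;
  hence $1 \neq 0$ in the quotient.
\<close>

locale series_hom =
  fixes h :: "'a::ring_1 \<Rightarrow> 'b::ring_1"
  assumes add: "h (x + y) = h x + h y" and mult: "h (x * y) = h x * h y" and one: "h 1 = 1"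
begin

lemma zero [simp]: "h 0 = 0"
  using add[of 0 0] by simp

lemma diff: "h (x - y) = h x - h y"
  using add[of "x - y" y] by simp

lemma sum: "h (\<Sum>x\<in>A. f x) = (\<Sum>x\<in>A. h (f x))"
  by (induction A rule: infinite_finite_induct) (simp_all add: add)

lemma of_bool: "h (of_bool b) = of_bool b"
  by (cases b) (simp_all add: one)

lemma fps_map: "series_hom (fps_map h)"
  by unfold_locales (auto simp: fps_eq_iff fps_map_def add fps_mult_nth sum mult one)

lemma map_mat_mult: "map_mat h (A ** B) = map_mat h A ** map_mat h B"
  by (simp add: map_mat_def matrix_matrix_mult_def vec_eq_iff sum mult)

end

lemma series_hom_counit: "series_hom (\<lambda>p :: 'g free_monoid \<Rightarrow>\<^sub>0 complex. Poly_Mapping.lookup p 0)"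
proof
  fix x y :: "'g free_monoid \<Rightarrow>\<^sub>0 complex"
  show "Poly_Mapping.lookup (x * y) 0 = Poly_Mapping.lookup x 0 * Poly_Mapping.lookup y 0"
  proof -
    have "(\<Sum>q. Poly_Mapping.lookup y q when 0 = l + q) = (Poly_Mapping.lookup y 0 when l = 0)"
      for l :: "'g free_monoid"
      by (cases "l = 0") (simp_all add: free_monoid_add_eq_0_iff)
    then show ?thesis by (simp add: lookup_mult mult_when)
  qed
qed (simp_all add: lookup_add lookup_one)

lemma one_notin_rtt_ideal: "(1 :: 'i::rtt_index rtt_free) \<notin> rtt_ideal"
proof -
  define e where "e = (\<lambda>p :: 'i rtt_free. Poly_Mapping.lookup p 0)"
  interpret e: series_hom e unfolding e_def by (rule series_hom_counit)
  interpret e1: series_hom "fps_map e" by (rule e.fps_map)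
  interpret e2: series_hom "fps_map (fps_map e)" by (rule e1.fps_map)
  have T: "fps_map e (free_T $ i $ j) = of_bool (i = j)" for i j
    by (auto simp: fps_eq_iff fps_map_def free_T_def e_def lookup_one lookup_single
          zero_free_monoid_def when_def split: nat.split)
  have u: "fps_map (fps_map e) (in_u f) = in_u (fps_map e f)" for f
    by (auto simp: fps_eq_iff fps_map_def in_u_def e_def)
  have v: "fps_map (fps_map e) (in_v f) = in_v (fps_map e f)" for f
    by (auto simp: fps_eq_iff fps_map_def in_v_def e_def)
  have ob: "in_u (of_bool b) = of_bool b" "in_v (of_bool b) = (of_bool b :: complex fps fps)" for b
    by (cases b; auto simp: fps_eq_iff fps_map_def in_u_def in_v_def)+
  let ?E = "map_mat (fps_map (fps_map e))"
  have T1: "?E (tens1 (map_mat in_u free_T)) = mat 1"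
    by (auto simp: vec_eq_iff map_mat_def tens1_def kron_def mat_def e2.mult e2.one u ob T)
  have T2: "?E (tens2 (map_mat in_v free_T)) = mat 1"
    by (auto simp: vec_eq_iff map_mat_def tens2_def kron_def mat_def e2.mult e2.one v ob T)
  have D: "?E (rtt_defect :: 'i rtt_free fps fps^('i \<times> 'i)^('i \<times> 'i)) = 0"
  proof -
    let ?R = "map_mat (fps_map cfps) cleared_R :: 'i rtt_free fps fps^('i \<times> 'i)^('i \<times> 'i)"
    have "?E (A - B) = ?E A - ?E B" for A B :: "'i rtt_free fps fps^('i \<times> 'i)^('i \<times> 'i)"
      by (simp add: map_mat_def vec_eq_iff e2.diff)
    then show ?thesis
      unfolding rtt_defect_def Let_def by (simp add: e2.map_mat_mult T1 T2)
  qed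
  have rel: "rtt_relators \<subseteq> {x. e x = 0}"
  proof
    fix x :: "'i rtt_free" assume "x \<in> rtt_relators"
    then obtain p q n m where x: "x = fps_nth (fps_nth (rtt_defect $ p $ q) n) m"
      by (auto simp: rtt_relators_def)
    have "fps_nth (fps_nth (?E rtt_defect $ p $ q) n) m = 0" by (simp add: D)
    then show "x \<in> {x. e x = 0}" by (simp add: x map_mat_def fps_map_def)
  qed
  interpret R: Ring.ring "alg_of (UNIV :: 'i rtt_free set)" by (rule ring_alg_of_UNIV)
  have "rtt_ideal \<subseteq> {x. e x = 0}"
    unfolding rtt_ideal_def
    by (rule R.genideal_minimal) (use rel in \<open>auto simp: ideal_alg_of_UNIV_iff e.add e.mult\<close>)
  then show ?thesis using e.one by auto
qed

quotient_type (overloaded) 'i rtt = "'i::rtt_index rtt_free" / "\<lambda>x y. x - y \<in> rtt_ideal"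
proof (rule equivpI)
  show "reflp (\<lambda>x y :: 'i rtt_free. x - y \<in> rtt_ideal)"
    by (simp add: reflp_def rtt_ideal_closed(1))
  show "symp (\<lambda>x y :: 'i rtt_free. x - y \<in> rtt_ideal)"
    by (rule sympI) (use rtt_ideal_closed(5) in fastforce)
  show "transp (\<lambda>x y :: 'i rtt_free. x - y \<in> rtt_ideal)"
  proof (rule transpI)
    fix x y z :: "'i rtt_free"
    assume "x - y \<in> rtt_ideal" "y - z \<in> rtt_ideal"
    then have "(x - y) + (y - z) \<in> rtt_ideal" by (rule rtt_ideal_closed)
    then show "x - z \<in> rtt_ideal" by simp
  qed
qed

instantiation rtt :: (rtt_index) complex_algebra_1
begin

lift_definition zero_rtt :: "'a rtt" is 0 .
lift_definition one_rtt :: "'a rtt" is 1 .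
lift_definition plus_rtt :: "'a rtt \<Rightarrow> 'a rtt \<Rightarrow> 'a rtt" is "(+)"
proof -
  fix a b c d :: "'a rtt_free"
  assume "a - b \<in> rtt_ideal" "c - d \<in> rtt_ideal"
  then have "(a - b) + (c - d) \<in> rtt_ideal" by (rule rtt_ideal_closed)
  then show "(a + c) - (b + d) \<in> rtt_ideal" by (simp add: algebra_simps)
qed
lift_definition uminus_rtt :: "'a rtt \<Rightarrow> 'a rtt" is uminus
proof -
  fix a b :: "'a rtt_free"
  assume "a - b \<in> rtt_ideal"
  then have "- (a - b) \<in> rtt_ideal" by (rule rtt_ideal_closed)
  then show "- a - - b \<in> rtt_ideal" by simp
qed
lift_definition minus_rtt :: "'a rtt \<Rightarrow> 'a rtt \<Rightarrow> 'a rtt" is "(-)"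
proof -
  fix a b c d :: "'a rtt_free"
  assume "a - b \<in> rtt_ideal" "c - d \<in> rtt_ideal"
  then have "(a - b) + - (c - d) \<in> rtt_ideal" by (intro rtt_ideal_closed)
  then show "(a - c) - (b - d) \<in> rtt_ideal" by (simp add: algebra_simps)
qed
lift_definition times_rtt :: "'a rtt \<Rightarrow> 'a rtt \<Rightarrow> 'a rtt" is "(*)"
proof -
  fix a b c d :: "'a rtt_free"
  assume "a - b \<in> rtt_ideal" "c - d \<in> rtt_ideal"
  then have "(a - b) * c + b * (c - d) \<in> rtt_ideal" by (intro rtt_ideal_closed)
  then show "a * c - b * d \<in> rtt_ideal" by (simp add: algebra_simps)
qed
lift_definition scaleC_rtt :: "complex \<Rightarrow> 'a rtt \<Rightarrow> 'a rtt" is "(*\<^sub>C)"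
proof -
  fix c :: complex and a b :: "'a rtt_free"
  assume "a - b \<in> rtt_ideal"
  then have "(c *\<^sub>C 1) * (a - b) \<in> rtt_ideal" by (rule rtt_ideal_closed)
  then show "c *\<^sub>C a - c *\<^sub>C b \<in> rtt_ideal" by (simp add: right_diff_distrib mult_scaleC_left)
qed

instance
proof
  show "(0 :: 'a rtt) \<noteq> 1"
    by transfer (use one_notin_rtt_ideal rtt_ideal_closed(5) in force)
qed (transfer; simp add: algebra_simps rtt_ideal_closed(1) scaleC_add_right scaleC_add_left
       scaleC_scaleC scaleC_one mult_scaleC_left mult_scaleC_right)+

end

definition rtt_T :: "'i rtt fps^('i::rtt_index)^('i::rtt_index)"
  where "rtt_T = map_mat (fps_map abs_rtt) free_T"

section \<open>The Yangian of the general linear Lie algebra of rank two and its twisted Yangians\<close>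

text \<open>The indices $-1$ and $1$.\<close>

datatype ix2 = Neg2 | Pos2

instantiation ix2 :: "{finite, uminus}"
begin

fun uminus_ix2 :: "ix2 \<Rightarrow> ix2"
  where "- Neg2 = Pos2" | "- Pos2 = Neg2"

instance
proof
  have "UNIV = {Neg2, Pos2}" using ix2.exhaust by blast
  then show "finite (UNIV :: ix2 set)" by (metis finite.emptyI finite.insertI)
qed

end

instantiation ix2 :: rtt_index
begin

text \<open>$u^{-1}v^{-1}(u-v)R^\circ(u-v)$\<close>

definition cleared_R_ix2 :: "complex fps fps^(ix2 \<times> ix2)^(ix2 \<times> ix2)"
  where "cleared_R_ix2 = (inv_v - inv_u) *\<^sub>m mat 1 - (inv_u * inv_v) *\<^sub>m Pmat"

instance ..

end

type_synonym Y2 = "ix2 rtt"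

definition T_Y :: "Y2 fps^ix2^ix2"
  where "T_Y = rtt_T"

datatype pm = Plus | Minus

fun sign2 :: "ix2 \<Rightarrow> 'a::ring_1"
  where "sign2 Neg2 = - 1" | "sign2 Pos2 = 1"

text \<open>Entrywise form of the transpositions \<open>t\<^sub>+\<close> and \<open>t\<^sub>-\<close>.\<close>

definition transp2 :: "pm \<Rightarrow> 'a::ring_1^ix2^ix2 \<Rightarrow> 'a^ix2^ix2"
  where "transp2 s A =
    (\<chi> i j. (case s of Plus \<Rightarrow> 1 | Minus \<Rightarrow> sign2 i * sign2 j) * A $ (- j) $ (- i))"

definition Qmat2 :: "pm \<Rightarrow> 'a::ring_1^(ix2 \<times> ix2)^(ix2 \<times> ix2)"
  where "Qmat2 s = (\<Sum>i\<in>UNIV. \<Sum>j\<in>UNIV. kron (munit i j) (transp2 s (munit j i)))"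

text \<open>
  The argument of the following two functions is the inverse of the spectral parameter:
  \<open>R2 r\<close> is $R^\circ(w)$ and \<open>R2_transp s r\<close> is $R^\circ(w)^{t_\pm}$ for \<open>r\<close> $= 1/w$.
\<close>

definition R2 :: "'a::ring_1 \<Rightarrow> 'a^(ix2 \<times> ix2)^(ix2 \<times> ix2)"
  where "R2 r = mat 1 - r *\<^sub>m Pmat"

definition R2_transp :: "pm \<Rightarrow> 'a::ring_1 \<Rightarrow> 'a^(ix2 \<times> ix2)^(ix2 \<times> ix2)"
  where "R2_transp s r = mat 1 - r *\<^sub>m Qmat2 s"

definition K2 :: "'a::ring_1^ix2^ix2"
  where "K2 = munit Pos2 Pos2 - munit Neg2 Neg2"

definition S_Y :: "pm \<Rightarrow> Y2 fps^ix2^ix2"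
  where "S_Y s = T_Y ** transp2 s (map_mat (subst (- 1) 0) T_Y)"

definition Ytw2 :: "pm \<Rightarrow> Y2 set"
  where "Ytw2 s = subalg_gen (entry_coeffs (S_Y s))"

definition qdet :: "Y2 fps"
  where "qdet =
    subst 1 (- 1) (T_Y $ Neg2 $ Neg2) * (T_Y $ Pos2 $ Pos2)
    - subst 1 (- 1) (T_Y $ Neg2 $ Pos2) * (T_Y $ Pos2 $ Neg2)"

text \<open>$(2u+1)/(2u-1) = (2+u^{-1})/(2-u^{-1})$\<close>

definition gamma2 :: "pm \<Rightarrow> complex fps"
  where "gamma2 s = (case s of Plus \<Rightarrow> 1 | Minus \<Rightarrow> (2 + fps_X) / (2 - fps_X))"

definition sdet :: "pm \<Rightarrow> Y2 fps"
  where "sdet s = cfps (gamma2 s) * qdet * subst (- 1) 1 qdet"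

definition sdet_ideal :: "pm \<Rightarrow> Y2 set"
  where "sdet_ideal s = genideal (alg_of (Ytw2 s)) (range (fps_nth (sdet s - cfps (gamma2 s))))"

definition SY_quot :: "pm \<Rightarrow> (complex, Y2 set) module"
  where "SY_quot s = quot_alg (alg_of (Ytw2 s)) (sdet_ideal s)"

text \<open>
  The elements of \<open>A\<close> fixed by all automorphisms $S(u) \mapsto g(u+b)S(u)$ of \<open>A\<close>, where
  $g(u) \in 1 + u^{-2}\mathbb{C}[[u^{-2}]]$ and \<open>S\<close> is a matrix whose coefficients generate \<open>A\<close>.
\<close>

definition scaling_invariants ::
    "'a::complex_algebra_1 set \<Rightarrow> 'a fps^'n^'n \<Rightarrow> complex \<Rightarrow> 'a set"
  where "scaling_invariants A S b =
    {x \<in> A. \<forall>g \<alpha>. fps_nth g 0 = 1 \<and> (\<forall>r. odd r \<longrightarrow> fps_nth g r = 0)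
       \<and> \<alpha> \<in> alg_iso (alg_of A) (alg_of A)
       \<and> map_mat (fps_map \<alpha>) S = cfps (subst 1 b g) *\<^sub>m S
       \<longrightarrow> \<alpha> x = x}"

definition SY_sub :: "pm \<Rightarrow> Y2 set"
  where "SY_sub s = scaling_invariants (Ytw2 s) (S_Y s) 0"

section \<open>The extended Yangian of the orthogonal Lie algebra of rank one and its twisted Yangians\<close>

text \<open>The indices $-1$, $0$ and $1$.\<close>

datatype ix3 = Neg3 | Zero3 | Pos3

instantiation ix3 :: "{finite, uminus}"
begin

fun uminus_ix3 :: "ix3 \<Rightarrow> ix3"
  where "- Neg3 = Pos3" | "- Zero3 = Zero3" | "- Pos3 = Neg3"

instance
proof
  have "UNIV = {Neg3, Zero3, Pos3}" using ix3.exhaust by blast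
  then show "finite (UNIV :: ix3 set)" by (metis finite.emptyI finite.insertI)
qed

end

definition Qmat3 :: "'a::semiring_1^(ix3 \<times> ix3)^(ix3 \<times> ix3)"
  where "Qmat3 = (\<Sum>i\<in>UNIV. \<Sum>j\<in>UNIV. kron (munit i j) (munit (- i) (- j)))"

instantiation ix3 :: rtt_index
begin

text \<open>
  $u^{-2}v^{-2}(u-v)(u-v-\frac12)R(u-v)$; here \<open>d\<close> is $u^{-1}v^{-1}(u-v)$ and \<open>d'\<close> is
  $u^{-1}v^{-1}(u-v-\frac12)$.
\<close>

definition cleared_R_ix3 :: "complex fps fps^(ix3 \<times> ix3)^(ix3 \<times> ix3)"
  where "cleared_R_ix3 =
    (let d = inv_v - inv_u;
         d' = inv_v - inv_u - fps_const (fps_const (1/2)) * inv_u * inv_v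
     in (d * d') *\<^sub>m mat 1 - (inv_u * inv_v * d') *\<^sub>m Pmat + (inv_u * inv_v * d) *\<^sub>m Qmat3)"

instance ..

end

type_synonym X_so3 = "ix3 rtt"

definition T_X :: "X_so3 fps^ix3^ix3"
  where "T_X = rtt_T"

definition transp3 :: "'a^ix3^ix3 \<Rightarrow> 'a^ix3^ix3"
  where "transp3 A = (\<chi> i j. A $ (- j) $ (- i))"

text \<open>$(1+4u)/(1-4u) = (u^{-1}+4)/(u^{-1}-4)$\<close>

definition K3 :: "nat \<Rightarrow> X_so3 fps^ix3^ix3"
  where "K3 q = (if q = 0 then mat 1
    else munit Neg3 Neg3 + cfps ((fps_X + 4) / (fps_X - 4)) *\<^sub>m munit Zero3 Zero3 + munit Pos3 Pos3)"

definition S_X :: "nat \<Rightarrow> X_so3 fps^ix3^ix3"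
  where "S_X q = map_mat (subst 1 (- (1/4))) T_X ** K3 q ** transp3 (map_mat (subst (- 1) (1/4)) T_X)"

definition Xtw :: "nat \<Rightarrow> X_so3 set"
  where "Xtw q = subalg_gen (entry_coeffs (S_X q))"

definition w_X :: "nat \<Rightarrow> X_so3 fps"
  where "w_X q = (THE w. S_X q ** map_mat (subst (- 1) 0) (S_X q) = mat w)"

definition unitarity_ideal :: "nat \<Rightarrow> X_so3 set"
  where "unitarity_ideal q = genideal (alg_of (Xtw q)) (range (fps_nth (w_X q - 1)))"

definition Ytw_quot :: "nat \<Rightarrow> (complex, X_so3 set) module"
  where "Ytw_quot q = quot_alg (alg_of (Xtw q)) (unitarity_ideal q)"

definition Ytw_sub :: "nat \<Rightarrow> X_so3 set"
  where "Ytw_sub q = scaling_invariants (Xtw q) (S_X q) (- (1/4))"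

section \<open>Three by three matrices as operators on the symmetric square\<close>

fun vbasis :: "ix3 \<Rightarrow> complex^(ix2 \<times> ix2)"
  where
    "vbasis Neg3 = axis (Neg2, Neg2) 1"
  | "vbasis Zero3 = complex_of_real (1 / sqrt 2) *s (axis (Neg2, Pos2) 1 + axis (Pos2, Neg2) 1)"
  | "vbasis Pos3 = - axis (Pos2, Pos2) 1"

text \<open>
  The matrix of the entries $\langle v_i \mid A v_j\rangle$; no complex conjugation is needed, as the
  coordinates of the $v_i$ are real.
\<close>

definition compress ::
    "'a::complex_algebra_1 fps^(ix2 \<times> ix2)^(ix2 \<times> ix2) \<Rightarrow> 'a fps^ix3^ix3"
  where "compress A = (\<chi> i j. \<Sum>a\<in>UNIV. \<Sum>b\<in>UNIV.
    cfps (fps_const (vbasis i $ a * vbasis j $ b)) * A $ a $ b)"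

text \<open>$\frac12 R^\circ(-1)$\<close>

definition proj_V :: "'a::complex_algebra_1 fps^(ix2 \<times> ix2)^(ix2 \<times> ix2)"
  where "proj_V = cfps (fps_const (1/2)) *\<^sub>m R2 (- 1)"

end

(*
  Everything is computed in Y(2). The symmetrizer (I + P)/2 lets matrices over C^2 (x) C^2 that commute
  with it be multiplied after compression to V, so the RTT relation at the arguments differing by one
  (fusion) and its partial transpose turn the image of T(u - 1/4) K(u) T(-u + 1/4)^t into the stated
  product of two copies of the twisted S-matrix. The coefficient of u^(-n) in that product is, up to lower
  coefficients, the action of the n-th coefficient of the S-matrix on the symmetric square; this action is
  faithful, so the S-matrix can be recovered recursively, which gives the image in (1).

  For (2), the adjugate formula T(u - 1) T(u)^(t_-) = qdet T(u) shows that w(u) is sent to D(2u) D(2u + 1)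
  with D(u) = qdet T(u) qdet T(1 - u), and an induction on coefficients shows that D(u) D(u + 1) - 1 and
  D(u) - 1 generate the same ideal.

  For (3), an automorphism scales the S-matrix of Y(2) by h(u) if and only if its conjugate scales the
  S-matrix of X(so_3) by h(2u - 1) h(2u), and each g(u - 1/4) with g even is of this form with h even.
*)
theory Submission
  imports Defs
begin

section \<open>Series in $u^{-1}$\<close>

unbundle no vec_syntax
unbundle fps_syntax

text \<open>The relation of Y(2) has the denominator u - v and is needed at arguments x, y linear in
  u whose difference is sometimes constant (fusion, quantum determinant) and sometimes linear
  (crossing). No single expansion in 1/u serves both, so each specialised relation carries scalar
  series \<alpha>, \<beta> with \<alpha> = \<beta> (x - y). The matrix K(u) originates on V: there
  Q^- vanishes and Q^+ is twice the projection onto v_0, so R(1-4u)^t acts on v_0 by 1 - 2/(1-4u)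
  for t_+, and K_1 K_2 contributes the sign -1; the product is (1+4u)/(1-4u). The coefficient
  algebras are noncommutative and nothing is known about their zero divisors, so only nonzero scalar
  series are cancelled. As the isomorphism of the ambient algebras is given, facts about X(so_3),
  including which series w(u) is, are obtained by pulling back identities of Y(2).\<close>

lemma scaleC_zero_left [simp]: "0 *\<^sub>C (x :: 'a::complex_algebra_1) = 0"
  using scaleC_add_left[of 0 0 x] by simp

lemma scaleC_minus_left: "(- c) *\<^sub>C (x :: 'a::complex_algebra_1) = - (c *\<^sub>C x)"
  using scaleC_add_left[of c "- c" x] by (simp add: add_eq_0_iff)

lemma scaleC_minus_right: "c *\<^sub>C (- x :: 'a::complex_algebra_1) = - (c *\<^sub>C x)"
  using scaleC_add_right[of c x "- x"] by (simp add: add_eq_0_iff)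

lemma scaleC_diff_right: "c *\<^sub>C (x - y :: 'a::complex_algebra_1) = c *\<^sub>C x - c *\<^sub>C y"
  using scaleC_add_right[of c "x - y" y] by simp

lemma scaleC_sum_right: "c *\<^sub>C (\<Sum>i\<in>I. f i :: 'a::complex_algebra_1) = (\<Sum>i\<in>I. c *\<^sub>C f i)"
  by (induction I rule: infinite_finite_induct) (simp_all add: scaleC_add_right)

lemma scaleC_sum_left: "(\<Sum>i\<in>I. f i) *\<^sub>C (x :: 'a::complex_algebra_1) = (\<Sum>i\<in>I. f i *\<^sub>C x)"
  by (induction I rule: infinite_finite_induct) (simp_all add: scaleC_add_left)

lemma scaleC_cancel: "c \<noteq> 0 \<Longrightarrow> c *\<^sub>C x = c *\<^sub>C y \<longleftrightarrow> x = (y :: 'a::complex_algebra_1)"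
  by (metis left_inverse scaleC_one scaleC_scaleC)

section \<open>Complex series inside series over an algebra\<close>

lemma cfps_nth: "fps_nth (cfps f) n = fps_nth f n *\<^sub>C 1"
  by (simp add: cfps_def fps_map_def)

lemma cfps_mult_nth:
  "fps_nth (cfps f * g) n = (\<Sum>i\<le>n. fps_nth f i *\<^sub>C fps_nth g (n - i))"
  by (simp add: fps_mult_nth cfps_nth mult_scaleC_left atLeast0AtMost)

lemma mult_cfps_nth:
  "fps_nth (g * cfps f) n = (\<Sum>i\<le>n. fps_nth f i *\<^sub>C fps_nth g (n - i))"
proof -
  have "fps_nth (g * cfps f) n = (\<Sum>i\<le>n. fps_nth f (n - i) *\<^sub>C fps_nth g i)"
    by (simp add: fps_mult_nth cfps_nth mult_scaleC_right atLeast0AtMost)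
  also have "\<dots> = (\<Sum>i\<le>n. fps_nth f i *\<^sub>C fps_nth g (n - i))"
    by (rule sum.reindex_bij_witness[of _ "\<lambda>i. n - i" "\<lambda>i. n - i"]) auto
  finally show ?thesis .
qed

lemma cfps_commute: "cfps f * g = g * cfps f"
  by (simp add: fps_eq_iff cfps_mult_nth mult_cfps_nth)

lemma cfps_mult: "cfps (f * g) = cfps f * cfps g"
  by (simp add: fps_eq_iff cfps_mult_nth cfps_nth scaleC_scaleC scaleC_sum_left fps_mult_nth[of f]
      atLeast0AtMost)

lemma cfps_add: "cfps (f + g) = cfps f + cfps g"
  by (simp add: fps_eq_iff cfps_nth scaleC_add_left)

lemma cfps_minus: "cfps (- f) = - cfps f"
  by (simp add: fps_eq_iff cfps_nth scaleC_minus_left)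

lemma cfps_diff: "cfps (f - g) = cfps f - cfps g"
  by (simp only: diff_conv_add_uminus cfps_add cfps_minus)

lemma cfps_0 [simp]: "cfps 0 = 0"
  by (simp add: fps_eq_iff cfps_nth)

lemma cfps_1 [simp]: "cfps 1 = 1"
  by (simp add: fps_eq_iff cfps_nth scaleC_one)

lemma cfps_of_bool: "cfps (of_bool b) = of_bool b"
  by simp

lemma cfps_id [simp]: "cfps f = (f :: complex fps)"
  by (simp add: fps_eq_iff cfps_nth scaleC_complex_def)

lemma cfps_left_commute: "f * (cfps c * g) = cfps c * (f * g)"
  by (metis cfps_commute mult.assoc)

text \<open>A nonzero scalar series is a power of 1/u times an invertible series; multiplying by the
  inverse of the latter leaves a shift of the coefficients, which is injective over any
  algebra.\<close>

lemma cfps_mult_eq_0: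
  fixes g :: "'a::complex_algebra_1 fps"
  assumes "f \<noteq> 0" "cfps f * g = 0"
  shows "g = 0"
proof -
  define e where "e = inverse (fps_shift (subdegree f) f)"
  have "fps_shift (subdegree f) f $ 0 \<noteq> 0" using assms(1) by simp
  then have e: "e * fps_shift (subdegree f) f = 1"
    unfolding e_def by (rule inverse_mult_eq_1)
  have "e * f = e * (fps_shift (subdegree f) f * fps_X ^ subdegree f)"
    by (metis subdegree_decompose)
  then have "e * f = fps_X ^ subdegree f"
    by (simp add: e flip: mult.assoc)
  moreover have "cfps (e * f) * g = 0"
    by (simp add: cfps_mult assms(2) mult.assoc)
  ultimately have "cfps (fps_X ^ subdegree f) * g = 0" by simp
  then have *: "(if subdegree f \<le> n then g $ (n - subdegree f) else 0) = 0" for n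
    by (simp add: fps_eq_iff cfps_mult_nth fps_X_power_nth
        if_distrib[of "\<lambda>c. c *\<^sub>C _"] scaleC_one sum.delta cong: if_cong)
  show ?thesis
    using *[of "n + subdegree f" for n] by (simp add: fps_eq_iff)
qed

lemma cfps_cancel:
  fixes g h :: "'a::complex_algebra_1 fps"
  assumes "f \<noteq> 0" "cfps f * g = cfps f * h"
  shows "g = h"
  using cfps_mult_eq_0[OF assms(1), of "g - h"] assms(2) by (simp add: right_diff_distrib)

section \<open>Expansion of 1/(au+b) and substitution of au+b for u\<close>

lemma inv_lin_mult: "a \<noteq> 0 \<Longrightarrow> inv_lin a b * (fps_const a + fps_const b * fps_X) = fps_X"
  unfolding inv_lin_def by (subst fps_divide_unit) (simp_all add: mult.assoc inverse_mult_eq_1)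

lemma inv_lin_eqI:
  assumes "a \<noteq> 0" "f * (fps_const a + fps_const b * fps_X) = fps_X"
  shows "inv_lin a b = f"
proof -
  have "(fps_const a + fps_const b * fps_X :: complex fps) $ 0 \<noteq> 0" using assms(1) by simp
  then have "(fps_const a + fps_const b * fps_X :: complex fps) \<noteq> 0" by (metis fps_zero_nth)
  then show ?thesis using assms inv_lin_mult[OF assms(1), of b] by (metis mult_right_cancel)
qed

lemma inv_lin_nth_0: "a \<noteq> 0 \<Longrightarrow> inv_lin a b $ 0 = 0"
  using arg_cong[OF inv_lin_mult[of a b], of "\<lambda>f. f $ 0"] by simp

lemma inv_lin_nth_1: "a \<noteq> 0 \<Longrightarrow> inv_lin a b $ 1 = 1 / a"
  using arg_cong[OF inv_lin_mult[of a b], of "\<lambda>f. f $ 1"] inv_lin_nth_0[of a b]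
  by (simp add: fps_mult_nth_1 field_simps)

lemma inv_lin_1_0: "inv_lin 1 0 = fps_X"
  by (rule inv_lin_eqI) simp_all

lemma inv_lin_neq_0: "a \<noteq> 0 \<Longrightarrow> inv_lin a b \<noteq> 0"
  using inv_lin_nth_1[of a b] by auto

lemma inv_lin_power_nth: "a \<noteq> 0 \<Longrightarrow> n < r \<Longrightarrow> (inv_lin a b ^ r) $ n = 0"
  using startsby_zero_power_prefix[OF inv_lin_nth_0[of a b]] by blast

lemma inv_lin_power_nth_same: "a \<noteq> 0 \<Longrightarrow> (inv_lin a b ^ n) $ n = (1 / a) ^ n"
  using startsby_zero_power_nth_same[OF inv_lin_nth_0[of a b], of n] inv_lin_nth_1[of a b] by simp

text \<open>The bound of the sum may exceed n because (au+b)^(-r) = O(u^(-r)). A common range for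
  several coefficients lets the double sums below be exchanged.\<close>

lemma subst_nth:
  assumes "a \<noteq> 0" "n \<le> N"
  shows "fps_nth (subst a b f) n = (\<Sum>r\<le>N. ((inv_lin a b ^ r) $ n) *\<^sub>C f $ r)"
proof -
  have "(\<Sum>r\<le>N. ((inv_lin a b ^ r) $ n) *\<^sub>C f $ r) = (\<Sum>r\<le>n. ((inv_lin a b ^ r) $ n) *\<^sub>C f $ r)"
    using assms by (intro sum.mono_neutral_right) (auto simp: inv_lin_power_nth)
  then show ?thesis by (simp add: subst_def)
qed

lemma subst_add: "subst a b (f + g) = subst a b f + subst a b g"
  by (simp add: fps_eq_iff subst_def scaleC_add_right sum.distrib)

lemma subst_minus: "subst a b (- f) = - subst a b f"
  by (simp add: fps_eq_iff subst_def scaleC_minus_right sum_negf)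

lemma subst_diff: "subst a b (f - g) = subst a b f - subst a b g"
  by (simp only: diff_conv_add_uminus subst_add subst_minus)

lemma subst_0 [simp]: "subst a b 0 = 0"
  by (simp add: fps_eq_iff subst_def)

lemma subst_1 [simp]: "subst a b 1 = 1"
proof -
  have "(\<Sum>r\<le>n. ((inv_lin a b ^ r) $ n) *\<^sub>C ((1 :: 'a fps) $ r)) = (1 :: 'a fps) $ n" for n
    by (subst sum.remove[of _ 0]) (auto simp: scaleC_one)
  then show ?thesis by (simp add: fps_eq_iff subst_def)
qed

lemma subst_of_bool [simp]: "subst a b (of_bool P) = of_bool P"
  by simp

lemma subst_sum: "subst a b (\<Sum>i\<in>I. f i) = (\<Sum>i\<in>I. subst a b (f i))"
  by (induction I rule: infinite_finite_induct) (simp_all add: subst_add)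

lemma subst_nth_0: "subst a b f $ 0 = f $ 0"
  by (simp add: subst_def scaleC_one)

text \<open>Both sides are sums of f_r g_s weighted by the n-th coefficient of (au+b)^(-(r+s)). The
  weight vanishes for r + s > n, so the square of indices shrinks to a triangle.\<close>

lemma subst_mult:
  fixes f g :: "'a::complex_algebra_1 fps"
  assumes a: "a \<noteq> 0"
  shows "subst a b (f * g) = subst a b f * subst a b g"
proof (rule fps_ext)
  fix n
  let ?x = "inv_lin a b"
  have "(subst a b f * subst a b g) $ n
      = (\<Sum>k\<le>n. (\<Sum>r\<le>n. ((?x ^ r) $ k) *\<^sub>C f $ r) * (\<Sum>s\<le>n. (((?x ^ s) $ (n - k))) *\<^sub>C g $ s))"
    unfolding fps_mult_nth atLeast0AtMost
    by (intro sum.cong refl) (simp add: subst_nth[OF a, where N = n])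
  also have "\<dots> = (\<Sum>k\<le>n. \<Sum>r\<le>n. \<Sum>s\<le>n. (((?x ^ r) $ k) * ((?x ^ s) $ (n - k))) *\<^sub>C ((f $ r) * (g $ s)))"
    by (simp add: sum_product mult_scaleC_left mult_scaleC_right scaleC_scaleC mult.commute)
  also have "\<dots> = (\<Sum>r\<le>n. \<Sum>k\<le>n. \<Sum>s\<le>n. (((?x ^ r) $ k) * ((?x ^ s) $ (n - k))) *\<^sub>C ((f $ r) * (g $ s)))"
    by (rule sum.swap)
  also have "\<dots> = (\<Sum>r\<le>n. \<Sum>s\<le>n. \<Sum>k\<le>n. (((?x ^ r) $ k) * ((?x ^ s) $ (n - k))) *\<^sub>C ((f $ r) * (g $ s)))"
    by (intro sum.cong refl sum.swap)
  also have "\<dots> = (\<Sum>r\<le>n. \<Sum>s\<le>n. ((?x ^ (r + s)) $ n) *\<^sub>C ((f $ r) * (g $ s)))"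
    by (simp add: power_add fps_mult_nth scaleC_sum_left atLeast0AtMost)
  also have "\<dots> = (\<Sum>(r, s)\<in>{..n} \<times> {..n}. ((?x ^ (r + s)) $ n) *\<^sub>C ((f $ r) * (g $ s)))"
    by (rule sum.cartesian_product)
  also have "\<dots> = (\<Sum>(r, s)\<in>{(r, s). r + s \<le> n}. ((?x ^ (r + s)) $ n) *\<^sub>C ((f $ r) * (g $ s)))"
    by (rule sum.mono_neutral_right, simp, force, auto, metis inv_lin_power_nth[OF a] not_le scaleC_zero_left)
  also have "\<dots> = (\<Sum>m\<le>n. \<Sum>r\<le>m. ((?x ^ (r + (m - r))) $ n) *\<^sub>C ((f $ r) * (g $ (m - r))))"
    by (rule sum.triangle_reindex_eq)
  also have "\<dots> = subst a b (f * g) $ n"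
    by (simp add: subst_def fps_mult_nth scaleC_sum_right atLeast0AtMost)
  finally show "subst a b (f * g) $ n = (subst a b f * subst a b g) $ n" by simp
qed

lemma subst_cfps: "subst a b (cfps f) = cfps (subst a b f)"
  by (simp add: fps_eq_iff subst_def cfps_nth scaleC_scaleC scaleC_sum_left scaleC_complex_def)

lemma subst_compose: "subst a b f = fps_compose f (inv_lin a b)"
  by (simp add: fps_eq_iff subst_def fps_compose_def scaleC_complex_def mult.commute atLeast0AtMost)

lemma subst_const [simp]: "subst a b (fps_const c) = fps_const (c :: complex)"
  by (simp add: subst_compose)

lemma subst_power: "a \<noteq> 0 \<Longrightarrow> subst a b (f ^ n) = subst a b f ^ n"
  by (induction n) (simp_all add: subst_mult)

lemma subst_inv_lin:
  assumes "a \<noteq> 0" "c \<noteq> 0"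
  shows "subst a b (inv_lin c d) = inv_lin (c * a) (c * b + d)"
proof -
  let ?f = "subst a b (inv_lin c d)" and ?x = "inv_lin a b"
  have x: "subst a b fps_X = ?x"
    by (simp add: subst_compose inv_lin_nth_0 assms)
  have *: "?x * fps_const a + ?x * (fps_const b * fps_X) = fps_X"
    using inv_lin_mult[OF assms(1), of b] by (simp add: distrib_left)
  have "subst a b (inv_lin c d * (fps_const c + fps_const d * fps_X)) = subst a b fps_X"
    by (simp add: inv_lin_mult assms)
  then have "?f * (fps_const c + fps_const d * ?x) = ?x"
    using assms(1) by (simp add: subst_mult subst_add x)
  then have f: "?f * (fps_const c + fps_const d * ?x) * (fps_const a + fps_const b * fps_X) = fps_X"
    by (simp add: inv_lin_mult assms)
  have "(fps_const c + fps_const d * ?x) * (fps_const a + fps_const b * fps_X)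
      = fps_const c * (fps_const a + fps_const b * fps_X)
        + fps_const d * (?x * (fps_const a + fps_const b * fps_X))"
    by (simp add: algebra_simps)
  also have "\<dots> = fps_const (c * a) + fps_const (c * b + d) * fps_X"
    unfolding inv_lin_mult[OF assms(1)]
    by (simp add: algebra_simps flip: fps_const_add fps_const_mult)
  finally show ?thesis
    using assms f by (intro inv_lin_eqI[symmetric]) (simp_all add: mult.assoc)
qed

lemma subst_subst:
  fixes f :: "'a::complex_algebra_1 fps"
  assumes a: "a \<noteq> 0" and c: "c \<noteq> 0"
  shows "subst a b (subst c d f) = subst (c * a) (c * b + d) f"
proof (rule fps_ext)
  fix n
  have "subst a b (subst c d f) $ n
      = (\<Sum>r\<le>n. ((inv_lin a b ^ r) $ n) *\<^sub>C (\<Sum>s\<le>n. (((inv_lin c d ^ s) $ r)) *\<^sub>C f $ s))"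
    unfolding subst_nth[OF a order_refl]
    by (intro sum.cong refl) (simp add: subst_nth[OF c, where N = n])
  also have "\<dots> = (\<Sum>r\<le>n. \<Sum>s\<le>n. (((inv_lin a b ^ r) $ n) * ((inv_lin c d ^ s) $ r)) *\<^sub>C f $ s)"
    by (simp add: scaleC_sum_right scaleC_scaleC)
  also have "\<dots> = (\<Sum>s\<le>n. \<Sum>r\<le>n. (((inv_lin a b ^ r) $ n) * ((inv_lin c d ^ s) $ r)) *\<^sub>C f $ s)"
    by (rule sum.swap)
  also have "\<dots> = (\<Sum>s\<le>n. (subst a b (inv_lin c d ^ s) $ n) *\<^sub>C f $ s)"
    unfolding subst_nth[OF a order_refl] by (simp add: scaleC_sum_left scaleC_complex_def)
  also have "\<dots> = subst (c * a) (c * b + d) f $ n"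
    using a c by (simp add: subst_power subst_inv_lin subst_nth[OF _ order_refl])
  finally show "subst a b (subst c d f) $ n = subst (c * a) (c * b + d) f $ n" .
qed

lemma subst_id [simp]: "subst 1 0 f = f"
  by (simp add: fps_eq_iff subst_def inv_lin_1_0 fps_X_power_nth if_distrib[of "\<lambda>c. c *\<^sub>C _"]
      scaleC_one sum.delta cong: if_cong)

section \<open>Subalgebras, series over them, and algebra maps\<close>

lemma subalgebra_UNIV: "subalgebra UNIV"
  by (simp add: subalgebra_def)

lemma subalgebraD:
  assumes "subalgebra A"
  shows "1 \<in> A" "x \<in> A \<Longrightarrow> y \<in> A \<Longrightarrow> x + y \<in> A" "x \<in> A \<Longrightarrow> y \<in> A \<Longrightarrow> x * y \<in> A"
    "x \<in> A \<Longrightarrow> c *\<^sub>C x \<in> A" "0 \<in> A" "x \<in> A \<Longrightarrow> - x \<in> A" "x \<in> A \<Longrightarrow> y \<in> A \<Longrightarrow> x - y \<in> A"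
proof -
  show *: "1 \<in> A" "x \<in> A \<Longrightarrow> y \<in> A \<Longrightarrow> x + y \<in> A" "x \<in> A \<Longrightarrow> y \<in> A \<Longrightarrow> x * y \<in> A"
    "x \<in> A \<Longrightarrow> c *\<^sub>C x \<in> A" for x y c
    using assms by (auto simp: subalgebra_def)
  show "0 \<in> A" using *(4)[OF *(1), of 0] by simp
  show m: "x \<in> A \<Longrightarrow> - x \<in> A" for x
    using *(4)[of x "- 1"] by (simp add: scaleC_minus_left scaleC_one)
  show "x \<in> A \<Longrightarrow> y \<in> A \<Longrightarrow> x - y \<in> A"
    using *(2)[of x "- y"] m[of y] by simp
qed

lemma subalgebra_sum: "subalgebra A \<Longrightarrow> (\<And>i. i \<in> I \<Longrightarrow> f i \<in> A) \<Longrightarrow> sum f I \<in> A"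
  by (induction I rule: infinite_finite_induct) (auto simp: subalgebraD)

lemma subalgebra_subalg_gen: "subalgebra (subalg_gen G)"
  unfolding subalg_gen_def by (rule hull_in) (auto simp: subalgebra_def)

lemma subalg_gen_superset: "G \<subseteq> subalg_gen G"
  unfolding subalg_gen_def by (rule hull_subset)

lemma subalg_gen_minimal: "G \<subseteq> A \<Longrightarrow> subalgebra A \<Longrightarrow> subalg_gen G \<subseteq> A"
  unfolding subalg_gen_def by (rule hull_minimal)

definition coeffs_in :: "'a set \<Rightarrow> 'a fps \<Rightarrow> bool"
  where "coeffs_in A f \<longleftrightarrow> (\<forall>n. f $ n \<in> A)"

lemma coeffs_in_nth: "coeffs_in A f \<Longrightarrow> f $ n \<in> A"
  by (simp add: coeffs_in_def)

lemma coeffs_in_UNIV [simp]: "coeffs_in UNIV f"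
  by (simp add: coeffs_in_def)

context
  fixes A :: "'a::complex_algebra_1 set"
  assumes A: "subalgebra A"
begin

lemma coeffs_in_add: "coeffs_in A f \<Longrightarrow> coeffs_in A g \<Longrightarrow> coeffs_in A (f + g)"
  by (simp add: coeffs_in_def subalgebraD[OF A])

lemma coeffs_in_diff: "coeffs_in A f \<Longrightarrow> coeffs_in A g \<Longrightarrow> coeffs_in A (f - g)"
  by (simp add: coeffs_in_def subalgebraD[OF A])

lemma coeffs_in_mult: "coeffs_in A f \<Longrightarrow> coeffs_in A g \<Longrightarrow> coeffs_in A (f * g)"
  by (auto simp: coeffs_in_def fps_mult_nth subalgebraD[OF A] intro!: subalgebra_sum[OF A])

lemma coeffs_in_cfps: "coeffs_in A (cfps c)"
  by (simp add: coeffs_in_def cfps_nth subalgebraD[OF A])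

lemma coeffs_in_0: "coeffs_in A 0"
  by (simp add: coeffs_in_def subalgebraD[OF A])

lemma coeffs_in_1: "coeffs_in A 1"
  using coeffs_in_cfps[of 1] by simp

lemma coeffs_in_of_bool: "coeffs_in A (of_bool P)"
  by (cases P) (simp_all add: coeffs_in_0 coeffs_in_1)

lemma coeffs_in_sum: "(\<And>i. i \<in> I \<Longrightarrow> coeffs_in A (f i)) \<Longrightarrow> coeffs_in A (sum f I)"
  by (induction I rule: infinite_finite_induct) (auto simp: coeffs_in_add coeffs_in_0)

lemma coeffs_in_subst: "coeffs_in A f \<Longrightarrow> coeffs_in A (subst a b f)"
  by (auto simp: coeffs_in_def subst_def subalgebraD[OF A] intro!: subalgebra_sum[OF A])

end

text \<open>The laws are required only on the carrier: isomorphisms of the record algebras, such as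
  the automorphisms in \<open>scaling_invariants\<close>, are unconstrained functions
  elsewhere.\<close>

locale algebra_hom_on =
  fixes A :: "'a::complex_algebra_1 set" and h :: "'a \<Rightarrow> 'b::complex_algebra_1"
  assumes A: "subalgebra A"
    and add: "x \<in> A \<Longrightarrow> y \<in> A \<Longrightarrow> h (x + y) = h x + h y"
    and mult: "x \<in> A \<Longrightarrow> y \<in> A \<Longrightarrow> h (x * y) = h x * h y"
    and scaleC: "x \<in> A \<Longrightarrow> h (c *\<^sub>C x) = c *\<^sub>C h x"
    and one: "h 1 = 1"
begin

lemma zero: "h 0 = 0"
  using scaleC[of 1 0] subalgebraD(1)[OF A] by simp

lemma diff: "x \<in> A \<Longrightarrow> y \<in> A \<Longrightarrow> h (x - y) = h x - h y"
  using add[of "x - y" y] subalgebraD(7)[OF A] by (simp add: eq_diff_eq)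

lemma sum: "(\<And>i. i \<in> I \<Longrightarrow> f i \<in> A) \<Longrightarrow> h (sum f I) = (\<Sum>i\<in>I. h (f i))"
  by (induction I rule: infinite_finite_induct) (auto simp: zero add subalgebra_sum[OF A])

lemma fps_map_nth [simp]: "fps_map h f $ n = h (f $ n)"
  by (simp add: fps_map_def)

lemma fps_map_add: "coeffs_in A f \<Longrightarrow> coeffs_in A g \<Longrightarrow> fps_map h (f + g) = fps_map h f + fps_map h g"
  by (simp add: fps_eq_iff coeffs_in_def add)

lemma fps_map_diff: "coeffs_in A f \<Longrightarrow> coeffs_in A g \<Longrightarrow> fps_map h (f - g) = fps_map h f - fps_map h g"
  by (simp add: fps_eq_iff coeffs_in_def diff)

lemma fps_map_mult: "coeffs_in A f \<Longrightarrow> coeffs_in A g \<Longrightarrow> fps_map h (f * g) = fps_map h f * fps_map h g"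
  by (simp add: fps_eq_iff coeffs_in_def fps_mult_nth sum mult subalgebraD[OF A])

lemma fps_map_cfps: "fps_map h (cfps c) = cfps c"
  by (simp add: fps_eq_iff cfps_nth scaleC one subalgebraD[OF A])

lemma fps_map_0: "fps_map h 0 = 0"
  using fps_map_cfps[of 0] by simp

lemma fps_map_1: "fps_map h 1 = 1"
  using fps_map_cfps[of 1] by simp

lemma fps_map_sum:
  "(\<And>i. i \<in> I \<Longrightarrow> coeffs_in A (f i)) \<Longrightarrow> fps_map h (sum f I) = (\<Sum>i\<in>I. fps_map h (f i))"
  by (induction I rule: infinite_finite_induct)
     (auto simp: fps_map_add fps_map_0 coeffs_in_sum[OF A])

lemma fps_map_subst: "coeffs_in A f \<Longrightarrow> fps_map h (subst a b f) = subst a b (fps_map h f)"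
  by (simp add: fps_eq_iff coeffs_in_def subst_def sum scaleC subalgebraD[OF A])

end

text \<open>Specialises 1/u to x and 1/v to y. For x and y without constant term x^m y^n =
  O(u^(-m-n)), so the finite bounds lose nothing.\<close>

definition eval_uv ::
    "complex fps \<Rightarrow> complex fps \<Rightarrow> 'a::complex_algebra_1 fps fps \<Rightarrow> 'a fps"
  where "eval_uv x y F =
    Abs_fps (\<lambda>N. \<Sum>n\<le>N. \<Sum>m\<le>N. ((x ^ m * y ^ n) $ N) *\<^sub>C (F $ n $ m))"

context
  fixes x y :: "complex fps"
  assumes x0: "x $ 0 = 0" and y0: "y $ 0 = 0"
begin

lemma power_mult_power_nth:
  assumes "N < m + n"
  shows "(x ^ m * y ^ n) $ N = 0"
  unfolding fps_mult_nth
proof (intro sum.neutral ballI)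
  fix i assume "i \<in> {0..N}"
  with assms have "i < m \<or> N - i < n" by auto
  then show "((x ^ m) $ i) * ((y ^ n) $ (N - i)) = 0"
    using startsby_zero_power_prefix[OF x0, of m] startsby_zero_power_prefix[OF y0, of n] by auto
qed

lemma eval_uv_nth:
  assumes "N \<le> M"
  shows "eval_uv x y F $ N = (\<Sum>n\<le>M. \<Sum>m\<le>M. ((x ^ m * y ^ n) $ N) *\<^sub>C (F $ n $ m))"
proof -
  have "(\<Sum>n\<le>M. \<Sum>m\<le>M. ((x ^ m * y ^ n) $ N) *\<^sub>C (F $ n $ m))
      = (\<Sum>n\<le>N. \<Sum>m\<le>M. ((x ^ m * y ^ n) $ N) *\<^sub>C (F $ n $ m))"
    using assms by (intro sum.mono_neutral_right) (auto simp: power_mult_power_nth)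
  also have "\<dots> = (\<Sum>n\<le>N. \<Sum>m\<le>N. ((x ^ m * y ^ n) $ N) *\<^sub>C (F $ n $ m))"
    using assms by (intro sum.cong refl sum.mono_neutral_right) (auto simp: power_mult_power_nth)
  finally show ?thesis by (simp add: eval_uv_def)
qed

lemma eval_uv_diff: "eval_uv x y (F - G) = eval_uv x y F - eval_uv x y G"
  by (simp add: fps_eq_iff eval_uv_def scaleC_diff_right sum_subtractf)

lemma cfps_mult_eval_uv_nth:
  "(cfps f * eval_uv x y F) $ N
    = (\<Sum>n\<le>N. \<Sum>m\<le>N. ((f * (x ^ m * y ^ n)) $ N) *\<^sub>C (F $ n $ m))"
proof -
  have "(cfps f * eval_uv x y F) $ N
      = (\<Sum>i\<le>N. \<Sum>n\<le>N. \<Sum>m\<le>N. ((f $ i) * ((x ^ m * y ^ n) $ (N - i))) *\<^sub>C (F $ n $ m))"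
    unfolding cfps_mult_nth
    by (intro sum.cong refl) (simp add: eval_uv_nth[where M = N] scaleC_sum_right scaleC_scaleC)
  also have "\<dots> = (\<Sum>n\<le>N. \<Sum>i\<le>N. \<Sum>m\<le>N. ((f $ i) * ((x ^ m * y ^ n) $ (N - i))) *\<^sub>C (F $ n $ m))"
    by (rule sum.swap)
  also have "\<dots> = (\<Sum>n\<le>N. \<Sum>m\<le>N. \<Sum>i\<le>N. ((f $ i) * ((x ^ m * y ^ n) $ (N - i))) *\<^sub>C (F $ n $ m))"
    by (intro sum.cong refl sum.swap)
  also have "\<dots> = (\<Sum>n\<le>N. \<Sum>m\<le>N. ((f * (x ^ m * y ^ n)) $ N) *\<^sub>C (F $ n $ m))"
    by (simp add: fps_mult_nth[of f] scaleC_sum_left atLeast0AtMost)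
  finally show ?thesis .
qed

lemma eval_uv_v_mult: "eval_uv x y (fps_X * F) = cfps y * eval_uv x y F"
proof (rule fps_ext)
  fix N
  let ?g = "\<lambda>n. \<Sum>m\<le>N. ((x ^ m * y ^ Suc n) $ N) *\<^sub>C (F $ n $ m)"
  \<comment> \<open>\<open>fps_X\<close> is 1/v here. The range is enlarged to \<open>Suc N\<close>
    so that its first term, which vanishes, can be split off and the index shifted.\<close>
  have "eval_uv x y (fps_X * F) $ N
      = (\<Sum>n\<le>Suc N. \<Sum>m\<le>Suc N. ((x ^ m * y ^ n) $ N) *\<^sub>C ((fps_X * F) $ n $ m))"
    by (rule eval_uv_nth) simp
  also have "\<dots> = (\<Sum>n\<le>N. \<Sum>m\<le>Suc N. ((x ^ m * y ^ Suc n) $ N) *\<^sub>C (F $ n $ m))"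
    unfolding sum.atMost_Suc_shift[of _ N] by (simp del: sum.atMost_Suc)
  also have "\<dots> = (\<Sum>n\<le>N. ?g n)"
    by (simp add: power_mult_power_nth del: power_Suc)
  also have "\<dots> = (cfps y * eval_uv x y F) $ N"
    unfolding cfps_mult_eval_uv_nth by (simp add: mult.left_commute)
  finally show "eval_uv x y (fps_X * F) $ N = (cfps y * eval_uv x y F) $ N" .
qed

lemma eval_uv_u_mult: "eval_uv x y (fps_const fps_X * F) = cfps x * eval_uv x y F"
proof (rule fps_ext)
  fix N
  let ?g = "\<lambda>n. \<Sum>m\<le>N. ((x ^ Suc m * y ^ n) $ N) *\<^sub>C (F $ n $ m)"
  have "eval_uv x y (fps_const fps_X * F) $ N
      = (\<Sum>n\<le>Suc N. \<Sum>m\<le>Suc N. ((x ^ m * y ^ n) $ N) *\<^sub>C ((fps_X * (F $ n)) $ m))"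
    by (subst eval_uv_nth[of _ "Suc N"]) simp_all
  also have "\<dots> = (\<Sum>n\<le>Suc N. \<Sum>m\<le>N. ((x ^ Suc m * y ^ n) $ N) *\<^sub>C (F $ n $ m))"
    unfolding sum.atMost_Suc_shift[of "\<lambda>m. _ m *\<^sub>C _ m" N] by (simp del: sum.atMost_Suc)
  also have "\<dots> = (\<Sum>n\<le>N. ?g n)"
    by (simp add: power_mult_power_nth del: power_Suc)
  also have "\<dots> = (cfps x * eval_uv x y F) $ N"
    unfolding cfps_mult_eval_uv_nth by (simp add: mult.assoc)
  finally show "eval_uv x y (fps_const fps_X * F) $ N = (cfps x * eval_uv x y F) $ N" .
qed

end

lemma in_u_mult_in_v_nth:
  fixes f g :: "'a::ring_1 fps"
  shows "(in_u f * in_v g) $ n $ m = (f $ m) * (g $ n)" "(in_v g * in_u f) $ n $ m = (g $ n) * (f $ m)"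
  by (simp_all add: in_u_def in_v_def fps_map_def)

context
  fixes a b c d :: complex
  assumes ac: "a \<noteq> 0" "c \<noteq> 0"
begin

lemma subst_mult_subst_nth:
  fixes f g :: "'a::complex_algebra_1 fps"
  shows "(subst a b f * subst c d g) $ N
    = (\<Sum>n\<le>N. \<Sum>m\<le>N. ((inv_lin a b ^ m * inv_lin c d ^ n) $ N) *\<^sub>C ((f $ m) * (g $ n)))"
proof -
  let ?x = "inv_lin a b" and ?y = "inv_lin c d"
  have "(subst a b f * subst c d g) $ N
      = (\<Sum>k\<le>N. \<Sum>m\<le>N. \<Sum>n\<le>N. (((?x ^ m) $ k) * ((?y ^ n) $ (N - k))) *\<^sub>C ((f $ m) * (g $ n)))"
    unfolding fps_mult_nth atLeast0AtMost
    by (intro sum.cong refl)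
       (simp add: subst_nth[OF ac(1), where N = N] subst_nth[OF ac(2), where N = N]
          sum_product mult_scaleC_left mult_scaleC_right scaleC_scaleC mult.commute)
  also have "\<dots> = (\<Sum>m\<le>N. \<Sum>k\<le>N. \<Sum>n\<le>N. (((?x ^ m) $ k) * ((?y ^ n) $ (N - k))) *\<^sub>C ((f $ m) * (g $ n)))"
    by (rule sum.swap)
  also have "\<dots> = (\<Sum>m\<le>N. \<Sum>n\<le>N. \<Sum>k\<le>N. (((?x ^ m) $ k) * ((?y ^ n) $ (N - k))) *\<^sub>C ((f $ m) * (g $ n)))"
    by (intro sum.cong refl sum.swap)
  also have "\<dots> = (\<Sum>m\<le>N. \<Sum>n\<le>N. ((?x ^ m * ?y ^ n) $ N) *\<^sub>C ((f $ m) * (g $ n)))"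
    by (simp add: fps_mult_nth scaleC_sum_left atLeast0AtMost)
  also have "\<dots> = (\<Sum>n\<le>N. \<Sum>m\<le>N. ((?x ^ m * ?y ^ n) $ N) *\<^sub>C ((f $ m) * (g $ n)))"
    by (rule sum.swap)
  finally show ?thesis .
qed

lemma eval_uv_in_u_in_v: "eval_uv (inv_lin a b) (inv_lin c d) (in_u f * in_v g) = subst a b f * subst c d g"
  by (simp add: fps_eq_iff eval_uv_def subst_mult_subst_nth in_u_mult_in_v_nth)

end

lemma eval_uv_in_v_in_u:
  assumes "a \<noteq> 0" "c \<noteq> 0"
  shows "eval_uv (inv_lin a b) (inv_lin c d) (in_v g * in_u f) = subst c d g * subst a b f"
proof (rule fps_ext)
  fix N
  have "eval_uv (inv_lin a b) (inv_lin c d) (in_v g * in_u f) $ N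
    = (\<Sum>n\<le>N. \<Sum>m\<le>N. ((inv_lin a b ^ m * inv_lin c d ^ n) $ N) *\<^sub>C ((g $ n) * (f $ m)))"
    by (simp add: eval_uv_def in_u_mult_in_v_nth)
  also have "\<dots> = (\<Sum>m\<le>N. \<Sum>n\<le>N. ((inv_lin a b ^ m * inv_lin c d ^ n) $ N) *\<^sub>C ((g $ n) * (f $ m)))"
    by (rule sum.swap)
  also have "\<dots> = (subst c d g * subst a b f) $ N"
    unfolding subst_mult_subst_nth[OF assms(2,1)] by (intro sum.cong refl) (simp only: mult.commute)
  finally show "eval_uv (inv_lin a b) (inv_lin c d) (in_v g * in_u f) $ N
    = (subst c d g * subst a b f) $ N" .
qed

section \<open>Matrices and the RTT relation\<close>

unbundle no fps_syntax
unbundle vec_syntax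

section \<open>Entries of matrix products and of tensor factors\<close>

lemma map_mat_nth [simp]: "map_mat h A $ i $ j = h (A $ i $ j)"
  by (simp add: map_mat_def)

lemma mscale_nth [simp]: "(c *\<^sub>m A) $ i $ j = c * A $ i $ j"
  by (simp add: mscale_def)

lemma tens1_nth: "tens1 A $ p $ q = A $ fst p $ fst q * of_bool (snd p = snd q)"
  by (simp add: tens1_def kron_def mat_def)

lemma tens2_nth: "tens2 A $ p $ q = of_bool (fst p = fst q) * A $ snd p $ snd q"
  by (simp add: tens2_def kron_def mat_def)

lemma matrix_mult_nth: "(A ** B) $ i $ j = (\<Sum>k\<in>UNIV. A $ i $ k * B $ k $ j)"
  by (simp add: matrix_matrix_mult_def)

lemma matrix_diff_left_distrib: "(A - B) ** C = A ** C - B ** (C :: 'a::ring_1^'n^'k::finite)"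
  by (simp add: vec_eq_iff matrix_mult_nth left_diff_distrib sum_subtractf)

lemma matrix_diff_right_distrib: "C ** (A - B) = C ** A - C ** (B :: 'a::ring_1^'n^'k::finite)"
  by (simp add: vec_eq_iff matrix_mult_nth right_diff_distrib sum_subtractf)

lemma matrix_add_left_distrib: "(A + B) ** C = A ** C + B ** (C :: 'a::ring_1^'n^'k::finite)"
  by (simp add: vec_eq_iff matrix_mult_nth distrib_right sum.distrib)

lemma mscale_matrix_mult: "(c *\<^sub>m A) ** B = c *\<^sub>m (A ** (B :: 'a::semiring_1^'n^'k::finite))"
  by (simp add: vec_eq_iff matrix_mult_nth sum_distrib_left mult.assoc)

lemma matrix_mult_mscale:
  fixes A :: "'a::semiring_1^'k::finite^'m"
  assumes "\<And>x. c * x = x * c"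
  shows "A ** (c *\<^sub>m B) = c *\<^sub>m (A ** B)"
proof -
  have "a * (c * b) = c * (a * b)" for a b by (metis assms mult.assoc)
  then show ?thesis by (simp add: vec_eq_iff matrix_mult_nth sum_distrib_left)
qed

lemma mat_1_nth: "(mat 1 :: 'a::semiring_1^'n^'n) $ i $ j = of_bool (i = j)"
  by (simp add: mat_def)

lemma munit_nth: "munit i j $ k $ l = of_bool (k = i \<and> l = j)"
  by (simp add: munit_def)

lemma tens1_tens2_nth:
  fixes A B :: "'a::semiring_1^'n::finite^'n"
  shows "(tens1 A ** tens2 B) $ p $ q = A $ fst p $ fst q * B $ snd p $ snd q"
proof -
  have "(tens1 A ** tens2 B) $ p $ q
      = (\<Sum>r\<in>UNIV. if r = (fst q, snd p) then A $ fst p $ fst q * B $ snd p $ snd q else 0)"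
    unfolding matrix_mult_nth by (intro sum.cong refl) (auto simp: tens1_nth tens2_nth)
  then show ?thesis by simp
qed

lemma tens2_tens1_nth:
  fixes A B :: "'a::semiring_1^'n::finite^'n"
  shows "(tens2 B ** tens1 A) $ p $ q = B $ snd p $ snd q * A $ fst p $ fst q"
proof -
  have "(tens2 B ** tens1 A) $ p $ q
      = (\<Sum>r\<in>UNIV. if r = (fst p, snd q) then B $ snd p $ snd q * A $ fst p $ fst q else 0)"
    unfolding matrix_mult_nth by (intro sum.cong refl) (auto simp: tens1_nth tens2_nth)
  then show ?thesis by simp
qed

lemma tens1_mult: "tens1 (A ** B) = tens1 A ** tens1 (B :: 'a::semiring_1^'n::finite^'n)"
proof -
  have "tens1 (A ** B) $ p $ q = (tens1 A ** tens1 B) $ p $ q" for p q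
  proof -
    have "(tens1 A ** tens1 B) $ p $ q
      = (\<Sum>(i, k)\<in>UNIV \<times> UNIV. A $ fst p $ i * of_bool (snd p = k) * (B $ i $ fst q * of_bool (k = snd q)))"
      unfolding matrix_mult_nth UNIV_Times_UNIV
      by (intro sum.cong refl) (simp add: tens1_nth case_prod_beta)
    also have "\<dots> = (\<Sum>i\<in>UNIV. \<Sum>k\<in>UNIV. if k = snd p then A $ fst p $ i * (B $ i $ fst q * of_bool (k = snd q)) else 0)"
      unfolding sum.cartesian_product[symmetric] by (intro sum.cong refl) auto
    also have "\<dots> = tens1 (A ** B) $ p $ q"
      by (simp add: tens1_nth matrix_mult_nth sum_distrib_right mult.assoc)
    finally show ?thesis by simp
  qed
  then show ?thesis by (simp add: vec_eq_iff)
qed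

lemma tens2_mult: "tens2 (A ** B) = tens2 A ** tens2 (B :: 'a::semiring_1^'n::finite^'n)"
proof -
  have "tens2 (A ** B) $ p $ q = (tens2 A ** tens2 B) $ p $ q" for p q
  proof -
    have "(tens2 A ** tens2 B) $ p $ q
      = (\<Sum>(k, i)\<in>UNIV \<times> UNIV. of_bool (fst p = k) * A $ snd p $ i * (of_bool (k = fst q) * B $ i $ snd q))"
      unfolding matrix_mult_nth UNIV_Times_UNIV
      by (intro sum.cong refl) (simp add: tens2_nth case_prod_beta)
    also have "\<dots> = (\<Sum>k\<in>UNIV. if k = fst p then \<Sum>i\<in>UNIV. A $ snd p $ i * (of_bool (k = fst q) * B $ i $ snd q) else 0)"
      unfolding sum.cartesian_product[symmetric] by (intro sum.cong refl) auto
    also have "\<dots> = tens2 (A ** B) $ p $ q"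
      by (simp add: tens2_nth matrix_mult_nth sum_distrib_left)
    finally show ?thesis by simp
  qed
  then show ?thesis by (simp add: vec_eq_iff)
qed

lemma Pmat_nth: "(Pmat :: 'a::semiring_1^('n::finite \<times> 'n)^('n \<times> 'n)) $ p $ q = of_bool (q = prod.swap p)"
proof -
  have "(Pmat :: 'a^('n \<times> 'n)^('n \<times> 'n)) $ p $ q
    = (\<Sum>i\<in>UNIV. \<Sum>j\<in>UNIV. if j = fst q then if i = fst p then of_bool (q = prod.swap p) else 0 else 0)"
    unfolding Pmat_def sum_component
    by (intro sum.cong refl) (auto simp: kron_def munit_nth prod_eq_iff)
  then show ?thesis by simp
qed

lemma Pmat_mult_nth:
  fixes A :: "'a::semiring_1^'m^('n::finite \<times> 'n)"
  shows "(Pmat ** A) $ p $ q = A $ prod.swap p $ q"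
proof -
  have "(Pmat ** A) $ p $ q = (\<Sum>r\<in>UNIV. if r = prod.swap p then A $ r $ q else 0)"
    unfolding matrix_mult_nth by (intro sum.cong refl) (simp add: Pmat_nth)
  then show ?thesis by simp
qed

lemma mult_Pmat_nth:
  fixes A :: "'a::semiring_1^('n::finite \<times> 'n)^'m"
  shows "(A ** Pmat) $ p $ q = A $ p $ prod.swap q"
proof -
  have "(A ** Pmat) $ p $ q = (\<Sum>r\<in>UNIV. if r = prod.swap q then A $ p $ r else 0)"
    unfolding matrix_mult_nth by (intro sum.cong refl) (auto simp: Pmat_nth)
  then show ?thesis by simp
qed

lemma Pmat_Pmat: "Pmat ** Pmat = (mat 1 :: 'a::semiring_1^('n::finite \<times> 'n)^('n \<times> 'n))"
  by (simp add: vec_eq_iff Pmat_mult_nth Pmat_nth mat_1_nth)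

lemma series_hom_abs_rtt: "series_hom (abs_rtt :: 'i::rtt_index rtt_free \<Rightarrow> 'i rtt)"
  by unfold_locales (simp_all add: plus_rtt.abs_eq times_rtt.abs_eq one_rtt_def)

lemma abs_rtt_eq_0: "x \<in> rtt_ideal \<Longrightarrow> abs_rtt x = 0"
  unfolding zero_rtt_def by (simp add: rtt.abs_eq_iff)

lemma fps_map_nth: "fps_nth (fps_map h f) n = h (fps_nth f n)"
  by (simp add: fps_map_def)

text \<open>Every coefficient of the defect is a relator, so projecting coefficientwise kills the
  defect; the projection is multiplicative on matrices of double series and carries the scalar
  R-matrix to itself.\<close>

lemma rtt_relation:
  fixes R :: "'i::rtt_index rtt fps fps^('i \<times> 'i)^('i \<times> 'i)"
  assumes R: "R = map_mat (fps_map cfps) cleared_R"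
  shows "R ** tens1 (map_mat in_u rtt_T) ** tens2 (map_mat in_v rtt_T)
    = tens2 (map_mat in_v rtt_T) ** tens1 (map_mat in_u rtt_T) ** R"
proof -
  interpret h: series_hom "abs_rtt :: 'i rtt_free \<Rightarrow> 'i rtt" by (rule series_hom_abs_rtt)
  interpret h1: series_hom "fps_map (abs_rtt :: 'i rtt_free \<Rightarrow> 'i rtt)" by (rule h.fps_map)
  interpret h2: series_hom "fps_map (fps_map (abs_rtt :: 'i rtt_free \<Rightarrow> 'i rtt))" by (rule h1.fps_map)
  interpret A: Ring.ring "alg_of (UNIV :: 'i rtt_free set)" by (rule ring_alg_of_UNIV)
  let ?h = "map_mat (fps_map (fps_map (abs_rtt :: 'i rtt_free \<Rightarrow> 'i rtt)))"
  let ?R = "map_mat (fps_map cfps) cleared_R :: 'i rtt_free fps fps^('i \<times> 'i)^('i \<times> 'i)"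
  have scale: "abs_rtt (c *\<^sub>C 1) = c *\<^sub>C (1 :: 'i rtt)" for c
    by (simp add: scaleC_rtt.abs_eq one_rtt_def)
  have hR: "?h ?R = R"
    unfolding R by (simp add: vec_eq_iff fps_eq_iff fps_map_nth cfps_nth scale)
  have h1: "?h (tens1 (map_mat in_u free_T)) = tens1 (map_mat in_u rtt_T)"
    by (simp add: vec_eq_iff tens1_nth rtt_T_def h2.mult h2.of_bool)
       (simp add: fps_eq_iff in_u_def fps_map_nth)
  have h2: "?h (tens2 (map_mat in_v free_T)) = tens2 (map_mat in_v rtt_T)"
    by (simp add: vec_eq_iff tens2_nth rtt_T_def h2.mult h2.of_bool)
       (simp add: fps_eq_iff in_v_def fps_map_nth)
  have "rtt_relators \<subseteq> (rtt_ideal :: 'i rtt_free set)"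
    unfolding rtt_ideal_def by (rule A.genideal_self) (simp add: alg_of_def)
  then have "fps_nth (fps_nth (rtt_defect $ p $ q) n) m \<in> (rtt_ideal :: 'i rtt_free set)" for p q n m
    by (rule subsetD) (unfold rtt_relators_def, blast)
  then have "?h rtt_defect = 0"
    by (simp add: vec_eq_iff fps_eq_iff fps_map_nth abs_rtt_eq_0)
  moreover have "?h (A - B) = ?h A - ?h B" for A B :: "'i rtt_free fps fps^('i \<times> 'i)^('i \<times> 'i)"
    by (simp add: vec_eq_iff h2.diff)
  ultimately show ?thesis
    unfolding rtt_defect_def Let_def by (simp add: h2.map_mat_mult hR h1 h2)
qed

section \<open>The relation of Y(2) in entries\<close>

lemma ix2_exhaust_simps: "UNIV = {Neg2, Pos2}"
  by (auto intro: ix2.exhaust)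

lemma sum_ix2: "(\<Sum>i\<in>UNIV. f i) = f Neg2 + f Pos2"
  by (simp add: ix2_exhaust_simps)

lemma sum_ix2_pair: "(\<Sum>p\<in>UNIV. f p) = f (Neg2, Neg2) + f (Neg2, Pos2) + f (Pos2, Neg2) + f (Pos2, Pos2)"
proof -
  have "(\<Sum>p\<in>UNIV. f p) = (\<Sum>i\<in>UNIV. \<Sum>j\<in>UNIV. f (i, j))"
    by (simp add: sum.cartesian_product)
  then show ?thesis by (simp add: sum_ix2 add.assoc)
qed

lemma fps_const_fps_X_commute: "fps_const fps_X * f = f * fps_const (fps_X :: 'a::ring_1 fps)"
  by (simp add: fps_eq_iff fps_mult_fps_X_commute)

text \<open>The familiar relation (u-v) [t_ij(u), t_kl(v)] = t_kj(u) t_il(v) - t_kj(v) t_il(u),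
  multiplied by 1/(uv), so that u - v becomes V - U.\<close>

lemma Yangian_relation_uv:
  fixes i j k l :: ix2
  defines "U \<equiv> fps_const fps_X :: Y2 fps fps" and "V \<equiv> fps_X :: Y2 fps fps"
    and "t \<equiv> \<lambda>i j. in_u (T_Y $ i $ j)" and "t' \<equiv> \<lambda>i j. in_v (T_Y $ i $ j)"
  shows "V * (t i j * t' k l - t' k l * t i j) - U * (t i j * t' k l - t' k l * t i j)
    = V * (U * (t k j * t' i l - t' k j * t i l))"
proof -
  have U: "U * f = f * U" and V: "V * f = f * V" for f
    unfolding U_def V_def by (simp_all add: fps_const_fps_X_commute fps_mult_fps_X_commute)
  let ?R = "map_mat (fps_map cfps) cleared_R :: Y2 fps fps^(ix2 \<times> ix2)^(ix2 \<times> ix2)"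
  interpret c: series_hom "cfps :: complex fps \<Rightarrow> Y2 fps"
    by unfold_locales (simp_all add: cfps_add cfps_mult)
  interpret c1: series_hom "fps_map (cfps :: complex fps \<Rightarrow> Y2 fps)"
    by (rule c.fps_map)
  have u: "fps_map cfps inv_u = U" and v: "fps_map cfps inv_v = V"
    unfolding U_def V_def by (auto simp: fps_eq_iff in_u_def in_v_def fps_map_nth cfps_nth fps_X_def scaleC_one)
  have R: "?R = (V - U) *\<^sub>m mat 1 - (U * V) *\<^sub>m Pmat"
    by (simp add: vec_eq_iff cleared_R_ix2_def c1.diff c1.mult c1.of_bool u v Pmat_nth mat_1_nth)
  have RM: "(?R ** M) $ p $ q = (V - U) * M $ p $ q - (U * V) * M $ prod.swap p $ q"
    for M :: "Y2 fps fps^(ix2 \<times> ix2)^(ix2 \<times> ix2)" and p q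
    by (simp add: R matrix_diff_left_distrib mscale_matrix_mult Pmat_mult_nth)
  have VU: "(V - U) * M = M * (V - U)" "U * V * M = M * (U * V)" for M
  proof -
    show "(V - U) * M = M * (V - U)"
      unfolding left_diff_distrib right_diff_distrib U[of M] V[of M] ..
    show "U * V * M = M * (U * V)"
      unfolding mult.assoc V[of M] unfolding mult.assoc[symmetric] U[of M] ..
  qed
  have MR: "(M ** ?R) $ p $ q = (V - U) * M $ p $ q - (U * V) * M $ p $ prod.swap q"
    for M :: "Y2 fps fps^(ix2 \<times> ix2)^(ix2 \<times> ix2)" and p q
    by (simp add: R matrix_diff_right_distrib matrix_mult_mscale[OF VU(1)] matrix_mult_mscale[OF VU(2)]
        mult_Pmat_nth)
  have "(?R ** (tens1 (map_mat in_u T_Y) ** tens2 (map_mat in_v T_Y))) $ (i, k) $ (j, l)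
    = (tens2 (map_mat in_v T_Y) ** tens1 (map_mat in_u T_Y) ** ?R) $ (i, k) $ (j, l)"
    unfolding T_Y_def using rtt_relation[where 'i = ix2, OF refl] by (simp add: matrix_mul_assoc)
  then have "(V - U) * (t i j * t' k l) - (U * V) * (t k j * t' i l)
      = (V - U) * (t' k l * t i j) - (U * V) * (t' k j * t i l)"
    unfolding RM MR by (simp add: tens1_tens2_nth tens2_tens1_nth t_def t'_def)
  moreover have "U * V * M = V * (U * M)" for M
    unfolding U[of V] by (rule mult.assoc)
  ultimately have *: "V * (t i j * t' k l) - U * (t i j * t' k l) - V * (U * (t k j * t' i l))
      = V * (t' k l * t i j) - U * (t' k l * t i j) - V * (U * (t' k j * t i l))"
    by (simp only: left_diff_distrib)
  have arith: "a - b - (c - d) = e - f" if "a - c - e = b - d - f" for a b c d e f :: "Y2 fps fps"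
  proof -
    have "a - b - (c - d) = (a - c - e) - (b - d - f) + (e - f)" by simp
    then show ?thesis using that by simp
  qed
  show ?thesis
    unfolding right_diff_distrib by (rule arith[OF *])
qed

text \<open>Below, \<open>x = a u + b\<close> and \<open>y = c u + d\<close>, and the hypothesis says \<open>\<alpha> = \<beta> (x - y)\<close>; as \<open>x - y\<close> may be
  constant, possibly zero, or linear in \<open>u\<close>, neither \<open>x - y\<close> nor its inverse need be a series in \<open>u\<^sup>-\<^sup>1\<close>.\<close>

lemma Yangian_relation:
  fixes a b c d :: complex and \<alpha> \<beta> :: "complex fps"
  defines "t \<equiv> \<lambda>i j. subst a b (T_Y $ i $ j)" and "t' \<equiv> \<lambda>i j. subst c d (T_Y $ i $ j)"
  assumes ac: "a \<noteq> 0" "c \<noteq> 0"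
    and \<alpha>\<beta>: "\<alpha> * (inv_lin a b * inv_lin c d) = \<beta> * (inv_lin c d - inv_lin a b)"
  shows "cfps \<alpha> * (t i j * t' k l - t' k l * t i j) = cfps \<beta> * (t k j * t' i l - t' k j * t i l)"
proof -
  let ?x = "inv_lin a b" and ?y = "inv_lin c d"
  note e = eval_uv_diff[of ?x ?y] eval_uv_u_mult[of ?x ?y] eval_uv_v_mult[of ?x ?y]
    eval_uv_in_u_in_v[OF ac] eval_uv_in_v_in_u[OF ac] inv_lin_nth_0[OF ac(1)] inv_lin_nth_0[OF ac(2)]
  let ?c = "t i j * t' k l - t' k l * t i j" and ?d = "t k j * t' i l - t' k j * t i l"
  have "cfps ?y * ?c - cfps ?x * ?c = cfps ?y * (cfps ?x * ?d)"
    using arg_cong[OF Yangian_relation_uv, of "eval_uv ?x ?y" i j k l]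
    by (simp add: e t_def t'_def)
  then have *: "cfps (?y - ?x) * ?c = cfps (?y * ?x) * ?d"
    by (simp only: cfps_diff cfps_mult left_diff_distrib mult.assoc)
  \<comment> \<open>The hypothesis concerns \<alpha> times the product of the reciprocals, so the
    claim is first multiplied by this product, a nonzero scalar series that cancels at the
    end.\<close>
  have "cfps (?y * ?x) * (cfps \<alpha> * ?c) = cfps (\<alpha> * (?x * ?y)) * ?c"
    by (simp only: cfps_mult[symmetric] mult.assoc[symmetric]) (simp only: mult.commute mult.left_commute)
  also have "\<dots> = cfps \<beta> * (cfps (?y - ?x) * ?c)"
    by (simp only: \<alpha>\<beta> cfps_mult mult.assoc)
  also have "\<dots> = cfps (?y * ?x) * (cfps \<beta> * ?d)"
    by (simp only: * cfps_left_commute[of "cfps \<beta>"])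
  finally show ?thesis
    by (rule cfps_cancel[rotated]) (simp add: inv_lin_neq_0 ac)
qed

section \<open>The quantum determinant\<close>

text \<open>This is 1/y - 1/x = (x-y)/(xy) for x = au+b and y = cu+d, multiplied by 1/u because x -
  y need not be a series in 1/u.\<close>

lemma inv_lin_diff_mult:
  assumes "a \<noteq> 0" "c \<noteq> 0"
  shows "(inv_lin c d - inv_lin a b) * fps_X
    = inv_lin a b * inv_lin c d * (fps_const (a - c) + fps_const (b - d) * fps_X)"
proof -
  let ?x = "inv_lin a b" and ?y = "inv_lin c d"
  have "(?y - ?x) * fps_X = ?y * (?x * (fps_const a + fps_const b * fps_X))
      - ?x * (?y * (fps_const c + fps_const d * fps_X))"
    by (simp only: inv_lin_mult[OF assms(1)] inv_lin_mult[OF assms(2)] left_diff_distrib)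
  then show ?thesis
    by (simp add: algebra_simps flip: fps_const_sub)
qed

text \<open>Makes \<alpha> = b - d, \<beta> = 1 admissible in \<open>Yangian_relation\<close> for
  equal slopes; the next lemma does so with \<alpha> = 1, \<beta> = 1/(x-y) for distinct
  slopes.\<close>

lemma inv_lin_diff_same:
  assumes "a \<noteq> 0"
  shows "inv_lin a d - inv_lin a b = fps_const (b - d) * (inv_lin a b * inv_lin a d)"
proof -
  have "(inv_lin a d - inv_lin a b) * fps_X = (fps_const (b - d) * (inv_lin a b * inv_lin a d)) * fps_X"
    by (subst inv_lin_diff_mult) (simp_all add: assms ac_simps)
  then show ?thesis
    by (metis fps_X_neq_zero mult_right_cancel)
qed

lemma inv_lin_diff:
  assumes "a \<noteq> 0" "c \<noteq> 0" "a \<noteq> c"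
  shows "inv_lin a b * inv_lin c d = inv_lin (a - c) (b - d) * (inv_lin c d - inv_lin a b)"
proof -
  have "inv_lin (a - c) (b - d) * ((inv_lin c d - inv_lin a b) * fps_X)
      = (inv_lin a b * inv_lin c d) * (inv_lin (a - c) (b - d) * (fps_const (a - c) + fps_const (b - d) * fps_X))"
    by (subst inv_lin_diff_mult) (simp_all add: assms ac_simps)
  also have "\<dots> = (inv_lin a b * inv_lin c d) * fps_X"
    using assms by (subst inv_lin_mult) simp_all
  finally show ?thesis
    by (metis fps_X_neq_zero mult_right_cancel mult.assoc)
qed

abbreviation (input) T_at :: "complex \<Rightarrow> complex \<Rightarrow> Y2 fps^ix2^ix2"
  where "T_at a b \<equiv> map_mat (subst a b) T_Y"

definition tsign :: "pm \<Rightarrow> ix2 \<Rightarrow> ix2 \<Rightarrow> 'a::ring_1"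
  where "tsign s i j = (case s of Plus \<Rightarrow> 1 | Minus \<Rightarrow> sign2 i * sign2 j)"

lemma transp2_nth: "transp2 s A $ i $ j = tsign s i j * A $ (- j) $ (- i)"
  by (simp add: transp2_def tsign_def)

lemma Qmat2_nth:
  "(Qmat2 s :: 'a::ring_1^(ix2 \<times> ix2)^(ix2 \<times> ix2)) $ p $ q
    = of_bool (snd p = - fst p \<and> snd q = - fst q) * tsign s (fst p) (fst q)"
  by (cases p; cases q; rename_tac i j k l, case_tac i; case_tac j; case_tac k; case_tac l; cases s)
     (simp_all add: Qmat2_def sum_ix2 kron_def munit_nth transp2_nth tsign_def)

lemma tens1_scalar_tens2:
  fixes C B :: "'a::complex_algebra_1 fps^ix2^ix2"
  shows "(tens1 C ** (cfps \<alpha> *\<^sub>m mat 1 - cfps \<beta> *\<^sub>m Qmat2 s) ** tens2 B) $ (i, k) $ (j, l)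
    = cfps \<alpha> * (C $ i $ j * B $ k $ l)
      - cfps \<beta> * (tsign s (- k) j * (C $ i $ (- k) * B $ (- j) $ l))"
  by (cases i; cases j; cases k; cases l; cases s)
     (simp_all add: matrix_diff_right_distrib matrix_diff_left_distrib mscale_matrix_mult
        matrix_mult_mscale[OF cfps_commute] tens1_tens2_nth,
      simp_all add: matrix_mult_nth sum_ix2_pair tens1_nth tens2_nth Qmat2_nth tsign_def)

lemma tens2_scalar_tens1:
  fixes C B :: "'a::complex_algebra_1 fps^ix2^ix2"
  shows "(tens2 B ** (cfps \<alpha> *\<^sub>m mat 1 - cfps \<beta> *\<^sub>m Qmat2 s) ** tens1 C) $ (i, k) $ (j, l)
    = cfps \<alpha> * (B $ k $ l * C $ i $ j)
      - cfps \<beta> * (tsign s i (- l) * (B $ k $ (- i) * C $ (- l) $ j))"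
  by (cases i; cases j; cases k; cases l; cases s)
     (simp_all add: matrix_diff_right_distrib matrix_diff_left_distrib mscale_matrix_mult
        matrix_mult_mscale[OF cfps_commute] tens2_tens1_nth,
      simp_all add: matrix_mult_nth sum_ix2_pair tens1_nth tens2_nth Qmat2_nth tsign_def)

section \<open>RTT relations with specialised arguments\<close>

context
  fixes a b c d :: complex and \<alpha> \<beta> :: "complex fps"
  assumes ac: "a \<noteq> 0" "c \<noteq> 0"
    and \<alpha>\<beta>: "\<alpha> * (inv_lin a b * inv_lin c d) = \<beta> * (inv_lin c d - inv_lin a b)"
begin

lemma Yangian_relation_entry:
  defines "t \<equiv> \<lambda>i j. subst a b (T_Y $ i $ j)" and "t' \<equiv> \<lambda>i j. subst c d (T_Y $ i $ j)"
  shows "cfps \<alpha> * (t i j * t' k l) - cfps \<beta> * (t k j * t' i l)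
    = cfps \<alpha> * (t' k l * t i j) - cfps \<beta> * (t' k j * t i l)"
  using Yangian_relation[OF ac \<alpha>\<beta>, of i j k l] unfolding t_def t'_def right_diff_distrib
  by (simp add: algebra_simps)

lemma RTT:
  "(cfps \<alpha> *\<^sub>m mat 1 - cfps \<beta> *\<^sub>m Pmat) ** tens1 (T_at a b) ** tens2 (T_at c d)
    = tens2 (T_at c d) ** tens1 (T_at a b) ** (cfps \<alpha> *\<^sub>m mat 1 - cfps \<beta> *\<^sub>m Pmat)"
proof -
  have "((cfps \<alpha> *\<^sub>m mat 1 - cfps \<beta> *\<^sub>m Pmat) ** (tens1 (T_at a b) ** tens2 (T_at c d))) $ (i, k) $ (j, l)
    = (tens2 (T_at c d) ** tens1 (T_at a b) ** (cfps \<alpha> *\<^sub>m mat 1 - cfps \<beta> *\<^sub>m Pmat)) $ (i, k) $ (j, l)"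
    for i j k l
    using Yangian_relation_entry[of i j k l]
    by (simp add: matrix_diff_right_distrib matrix_diff_left_distrib mscale_matrix_mult
        matrix_mult_mscale[OF cfps_commute] tens1_tens2_nth tens2_tens1_nth Pmat_mult_nth mult_Pmat_nth)
  then show ?thesis by (simp add: vec_eq_iff matrix_mul_assoc)
qed

text \<open>Transposition reverses products of matrices while the order of the algebra entries
  stays. Applied to both factors it fixes P, so the R-matrix changes sides.\<close>

lemma RTT_transp:
  "tens1 (transp2 s (T_at a b)) ** tens2 (transp2 s (T_at c d)) ** (cfps \<alpha> *\<^sub>m mat 1 - cfps \<beta> *\<^sub>m Pmat)
    = (cfps \<alpha> *\<^sub>m mat 1 - cfps \<beta> *\<^sub>m Pmat) ** tens2 (transp2 s (T_at c d)) ** tens1 (transp2 s (T_at a b))"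
proof -
  have "(tens1 (transp2 s (T_at a b)) ** tens2 (transp2 s (T_at c d)) ** (cfps \<alpha> *\<^sub>m mat 1 - cfps \<beta> *\<^sub>m Pmat)) $ (i, k) $ (j, l)
    = ((cfps \<alpha> *\<^sub>m mat 1 - cfps \<beta> *\<^sub>m Pmat) ** (tens2 (transp2 s (T_at c d)) ** tens1 (transp2 s (T_at a b)))) $ (i, k) $ (j, l)"
    for i j k l
    using Yangian_relation_entry[of "- j" "- i" "- l" "- k"]
    by (cases s; cases i; cases j; cases k; cases l)
       (simp_all add: matrix_diff_right_distrib matrix_diff_left_distrib mscale_matrix_mult
        matrix_mult_mscale[OF cfps_commute] tens1_tens2_nth tens2_tens1_nth Pmat_mult_nth mult_Pmat_nth
        transp2_nth tsign_def algebra_simps)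
  then show ?thesis by (simp add: vec_eq_iff matrix_mul_assoc)
qed

text \<open>Transposing only the first factor turns P into Q and, as products in that factor are
  reversed, puts the R-matrix between the two T's.\<close>

lemma RTT_crossed:
  "tens1 (transp2 s (T_at a b)) ** (cfps \<alpha> *\<^sub>m mat 1 - cfps \<beta> *\<^sub>m Qmat2 s) ** tens2 (T_at c d)
    = tens2 (T_at c d) ** (cfps \<alpha> *\<^sub>m mat 1 - cfps \<beta> *\<^sub>m Qmat2 s) ** tens1 (transp2 s (T_at a b))"
proof -
  have "(tens1 (transp2 s (T_at a b)) ** (cfps \<alpha> *\<^sub>m mat 1 - cfps \<beta> *\<^sub>m Qmat2 s) ** tens2 (T_at c d)) $ (i, k) $ (j, l)
    = (tens2 (T_at c d) ** (cfps \<alpha> *\<^sub>m mat 1 - cfps \<beta> *\<^sub>m Qmat2 s) ** tens1 (transp2 s (T_at a b))) $ (i, k) $ (j, l)"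
    for i j k l
    using Yangian_relation_entry[of "- j" "- i" k l]
    unfolding tens1_scalar_tens2 tens2_scalar_tens1
    by (cases s; cases i; cases j; cases k; cases l) (simp_all add: transp2_nth tsign_def algebra_simps)
  then show ?thesis by (simp add: vec_eq_iff)
qed

end

text \<open>\<open>transp2 Minus\<close> of a 2 by 2 matrix is its adjugate. The relations at
  arguments differing by 1, where the R-matrix degenerates, make the off-diagonal entries of both
  products vanish and identify the four diagonal ones.\<close>

lemma qdet_adjugate:
  assumes a: "a \<noteq> 0"
  shows "T_at a (b - 1) ** transp2 Minus (T_at a b) = mat (subst a b qdet)"
    and "transp2 Minus (T_at a b) ** T_at a (b - 1) = mat (subst a b qdet)"
proof -
  let ?x = "inv_lin a b" and ?y = "inv_lin a (b - 1)"
  have "1 * (?x * ?y) = 1 * (?y - ?x)"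
    using inv_lin_diff_same[OF a, of "b - 1" b] by simp
  note rel = Yangian_relation_entry[OF a a this, simplified]
  have q: "subst a b qdet = subst a (b - 1) (T_Y $ Neg2 $ Neg2) * subst a b (T_Y $ Pos2 $ Pos2)
      - subst a (b - 1) (T_Y $ Neg2 $ Pos2) * subst a b (T_Y $ Pos2 $ Neg2)"
    using a by (simp add: qdet_def subst_diff subst_mult subst_subst)
  define t where "t = (\<lambda>i j. subst a b (T_Y $ i $ j))"
  define t' where "t' = (\<lambda>i j. subst a (b - 1) (T_Y $ i $ j))"
  have rel': "t i j * t' k l - t k j * t' i l - (t' k l * t i j - t' k j * t i l) = 0" for i j k l
    using rel[of i j k l] by (simp add: t_def t'_def)
  have comb: "x = y" if "x - y = z" "z = 0" for x y z :: "Y2 fps" using that by simp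
  have c: "subst a b (T_Y $ i $ j) = t i j" "subst a (b - 1) (T_Y $ i $ j) = t' i j" for i j
    by (simp_all add: t_def t'_def)
  have q: "subst a b qdet = t' Neg2 Neg2 * t Pos2 Pos2 - t' Neg2 Pos2 * t Pos2 Neg2"
    unfolding q by (simp add: t_def t'_def)
  \<comment> \<open>The difference of the two sides is the sum of the relations for
    (\<open>Neg2\<close>, \<open>Pos2\<close>, \<open>Pos2\<close>, \<open>Neg2\<close>) and
    (\<open>Pos2\<close>, \<open>Pos2\<close>, \<open>Neg2\<close>, \<open>Neg2\<close>), in which
    the products with \<open>t\<close> on the left cancel.\<close>
  have 1: "t' Pos2 Pos2 * t Neg2 Neg2 - t' Pos2 Neg2 * t Neg2 Pos2 = subst a b qdet"
    unfolding q
    by (rule comb[of _ _ "(t Neg2 Pos2 * t' Pos2 Neg2 - t Pos2 Pos2 * t' Neg2 Neg2 - (t' Pos2 Neg2 * t Neg2 Pos2 - t' Pos2 Pos2 * t Neg2 Neg2))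
        + (t Pos2 Pos2 * t' Neg2 Neg2 - t Neg2 Pos2 * t' Pos2 Neg2 - (t' Neg2 Neg2 * t Pos2 Pos2 - t' Neg2 Pos2 * t Pos2 Neg2))"])
      (simp add: algebra_simps, simp add: rel')
  have 2: "t Pos2 Pos2 * t' Neg2 Neg2 - t Neg2 Pos2 * t' Pos2 Neg2 = subst a b qdet"
    using rel'[of Pos2 Pos2 Neg2 Neg2] unfolding q by simp
  have 3: "t Neg2 Neg2 * t' Pos2 Pos2 - t Pos2 Neg2 * t' Neg2 Pos2 = subst a b qdet"
    using rel'[of Neg2 Neg2 Pos2 Pos2] unfolding 1 by simp
  have 4: "t' i Neg2 * t i Pos2 = t' i Pos2 * t i Neg2" for i
    using rel'[of i Pos2 i Neg2] rel'[of i Neg2 i Pos2] by simp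
  have 5: "t Neg2 j * t' Pos2 j = t Pos2 j * t' Neg2 j" for j
  proof -
    have "cfps (1 + 1) = (cfps 1 + cfps 1 :: Y2 fps)" by (rule cfps_add)
    then have 2: "cfps 2 * x = x + x" for x :: "Y2 fps"
      by (simp add: mult_2)
    have "cfps 2 * (t Neg2 j * t' Pos2 j) = cfps 2 * (t Pos2 j * t' Neg2 j)"
      unfolding 2 using rel'[of Neg2 j Pos2 j] rel'[of Pos2 j Neg2 j] by (simp add: algebra_simps)
    then show ?thesis by (rule cfps_cancel[rotated]) simp
  qed
  show "T_at a (b - 1) ** transp2 Minus (T_at a b) = mat (subst a b qdet)"
    unfolding vec_eq_iff
  proof (intro allI)
    fix i j
    show "(T_at a (b - 1) ** transp2 Minus (T_at a b)) $ i $ j = mat (subst a b qdet) $ i $ j"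
      using 1 q 4[of Neg2] 4[of Pos2]
      by (cases i; cases j) (simp_all add: matrix_mult_nth sum_ix2 transp2_nth tsign_def mat_def c)
  qed
  show "transp2 Minus (T_at a b) ** T_at a (b - 1) = mat (subst a b qdet)"
    unfolding vec_eq_iff
  proof (intro allI)
    fix i j
    show "(transp2 Minus (T_at a b) ** T_at a (b - 1)) $ i $ j = mat (subst a b qdet) $ i $ j"
      using 2 3 5[of Neg2] 5[of Pos2]
      by (cases i; cases j) (simp_all add: matrix_mult_nth sum_ix2 transp2_nth tsign_def mat_def c)
  qed
qed

lemma mat_mult_nth:
  fixes A :: "'a::semiring_1^'n^'m::finite"
  shows "(mat x ** A) $ i $ j = x * A $ i $ j"
proof -
  have "(mat x ** A) $ i $ j = (\<Sum>k\<in>UNIV. if k = i then x * A $ k $ j else 0)"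
    unfolding matrix_mult_nth by (intro sum.cong refl) (auto simp: mat_def)
  then show ?thesis by simp
qed

lemma mult_mat_nth:
  fixes A :: "'a::semiring_1^'n::finite^'m"
  shows "(A ** mat x) $ i $ j = A $ i $ j * x"
proof -
  have "(A ** mat x) $ i $ j = (\<Sum>k\<in>UNIV. if k = j then A $ i $ k * x else 0)"
    unfolding matrix_mult_nth by (intro sum.cong refl) (auto simp: mat_def)
  then show ?thesis by simp
qed

lemma tens1_mat: "tens1 (mat x :: 'a::semiring_1^'n::finite^'n) = mat x"
  by (auto simp: vec_eq_iff tens1_nth mat_def)

lemma Qmat2_Minus: "Qmat2 Minus = mat 1 - (Pmat :: 'a::ring_1^(ix2 \<times> ix2)^(ix2 \<times> ix2))"
proof -
  have "(Qmat2 Minus :: 'a^(ix2 \<times> ix2)^(ix2 \<times> ix2)) $ (i, k) $ (j, l) = (mat 1 - Pmat) $ (i, k) $ (j, l)" for i j k l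
    by (cases i; cases j; cases k; cases l) (simp_all add: Qmat2_nth Pmat_nth mat_1_nth tsign_def)
  then show ?thesis by (simp add: vec_eq_iff)
qed

text \<open>Crossing symmetry: \<open>R(u)\<close> transposed by \<open>t\<^sub>-\<close> in one factor is proportional to \<open>R(1 - u)\<close>. So
  \<open>T\<^sub>2(y)\<close> can be moved through \<open>T\<^sub>1(x)\<close> transposed and through \<open>T\<^sub>1(x - 1)\<close>, whose product is \<open>qdet T(x)\<close>.\<close>

lemma qdet_commute_generic:
  fixes \<alpha> \<beta> :: "complex fps"
  assumes ac: "a \<noteq> 0" "c \<noteq> 0"
    and \<alpha>\<beta>: "\<alpha> * (inv_lin a (b - 1) * inv_lin c d) = \<beta> * (inv_lin c d - inv_lin a (b - 1))"
    and nz: "\<alpha>\<^sup>2 \<noteq> \<beta>\<^sup>2"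
  shows "subst a b qdet * subst c d (T_Y $ i $ j) = subst c d (T_Y $ i $ j) * subst a b qdet"
proof -
  define x where "x = inv_lin a b"
  define x' where "x' = inv_lin a (b - 1)"
  define y where "y = inv_lin c d"
  have xx: "x' - x = x * x'"
    using inv_lin_diff_same[OF ac(1), of "b - 1" b] by (simp add: x_def x'_def)
  \<comment> \<open>Raising the first argument by 1 replaces \<alpha> by \<alpha> + \<beta>, because
    \<alpha> stands for \<beta> times the difference of the arguments; the common factor
    \<open>x'\<close> cancels.\<close>
  have "(\<alpha> + \<beta>) * (x * y) * x' = x * (\<alpha> * (x' * y)) + \<beta> * (x * x') * y"
    by (simp add: algebra_simps)
  also have "\<dots> = x * (\<beta> * (y - x')) + \<beta> * (x' - x) * y"
    using \<alpha>\<beta>[folded x_def x'_def y_def] by (simp only: xx)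
  also have "\<dots> = \<beta> * (y - x) * x'"
    by (simp add: algebra_simps)
  finally have \<alpha>\<beta>': "(\<alpha> + \<beta>) * (inv_lin a b * inv_lin c d) = \<beta> * (inv_lin c d - inv_lin a b)"
    using inv_lin_neq_0[OF ac(1)] by (simp add: x_def x'_def y_def)
  let ?A = "tens1 (T_at a (b - 1))" and ?E = "tens1 (transp2 Minus (T_at a b))"
  let ?B = "tens2 (T_at c d)" and ?q = "mat (subst a b qdet) :: Y2 fps^(ix2 \<times> ix2)^(ix2 \<times> ix2)"
  let ?R = "cfps \<alpha> *\<^sub>m mat 1 - cfps \<beta> *\<^sub>m Pmat :: Y2 fps^(ix2 \<times> ix2)^(ix2 \<times> ix2)"
  let ?R' = "cfps (\<alpha> + \<beta>) *\<^sub>m mat 1 - cfps \<beta> *\<^sub>m Qmat2 Minus :: Y2 fps^(ix2 \<times> ix2)^(ix2 \<times> ix2)"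
  let ?n = "cfps (\<alpha>\<^sup>2 - \<beta>\<^sup>2) :: Y2 fps"
  have "?R' $ p $ q = (cfps \<alpha> *\<^sub>m mat 1 + cfps \<beta> *\<^sub>m Pmat) $ p $ q" for p q
    by (simp add: Qmat2_Minus mat_1_nth Pmat_nth cfps_add algebra_simps)
  then have R': "?R' = cfps \<alpha> *\<^sub>m mat 1 + cfps \<beta> *\<^sub>m Pmat"
    unfolding vec_eq_iff by blast
  have scal: "cfps f * (cfps g * h) = cfps (f * g) * h" for f g and h :: "Y2 fps"
    by (simp add: cfps_mult mult.assoc)
  \<comment> \<open>(\<alpha> + \<beta>P)(\<alpha> - \<beta>P) = \<alpha>^2 - \<beta>^2 as P^2 = 1.
    The product is inserted between the adjugate and T so that both exchange relations apply;
    \<open>nz\<close> lets the scalar be cancelled.\<close>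
  have RR: "?R' ** ?R = ?n *\<^sub>m mat 1"
    unfolding R'
    by (simp_all add: matrix_add_left_distrib matrix_diff_left_distrib matrix_diff_right_distrib
        matrix_add_ldistrib mscale_matrix_mult matrix_mult_mscale[OF cfps_commute] Pmat_Pmat)
       (simp_all add: vec_eq_iff scal cfps_diff power2_eq_square algebra_simps)
  have "x * of_bool P = of_bool P * x" for x :: "Y2 fps" and P by (cases P) simp_all
  then have "?q ** Pmat = Pmat ** ?q"
    by (simp add: vec_eq_iff mat_mult_nth mult_mat_nth Pmat_nth)
  then have qR: "?q ** ?R = ?R ** ?q"
    by (simp add: matrix_diff_left_distrib matrix_diff_right_distrib mscale_matrix_mult
        matrix_mult_mscale[OF cfps_commute])
  have 1: "?R ** ?A ** ?B = ?B ** ?A ** ?R"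
    using RTT[OF ac \<alpha>\<beta>] by simp
  have 2: "?E ** ?R' ** ?B = ?B ** ?R' ** ?E"
    by (rule RTT_crossed[OF ac \<alpha>\<beta>'])
  have 3: "?E ** ?A = ?q"
    unfolding tens1_mult[symmetric] qdet_adjugate(2)[OF ac(1)] tens1_mat ..
  have "?n *\<^sub>m (?q ** ?B) = ?E ** (?R' ** ?R) ** ?A ** ?B"
    unfolding RR by (simp add: matrix_mult_mscale[OF cfps_commute] mscale_matrix_mult 3)
  also have "\<dots> = ?E ** ?R' ** (?R ** ?A ** ?B)"
    by (simp only: matrix_mul_assoc)
  also have "\<dots> = (?E ** ?R' ** ?B) ** ?A ** ?R"
    unfolding 1 by (simp only: matrix_mul_assoc)
  also have "\<dots> = ?B ** ?R' ** (?E ** ?A) ** ?R"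
    unfolding 2 by (simp only: matrix_mul_assoc)
  also have "\<dots> = ?B ** ?R' ** (?q ** ?R)"
    unfolding 3 by (simp only: matrix_mul_assoc)
  also have "\<dots> = ?B ** (?R' ** ?R) ** ?q"
    unfolding qR by (simp only: matrix_mul_assoc)
  also have "\<dots> = ?n *\<^sub>m (?B ** ?q)"
    unfolding RR by (simp add: matrix_mult_mscale[OF cfps_commute] mscale_matrix_mult)
  finally have "(?n *\<^sub>m (?q ** ?B)) $ (i, i) $ (i, j) = (?n *\<^sub>m (?B ** ?q)) $ (i, i) $ (i, j)"
    by simp
  then have "?n * (subst a b qdet * subst c d (T_Y $ i $ j)) = ?n * (subst c d (T_Y $ i $ j) * subst a b qdet)"
    by (simp add: mat_mult_nth mult_mat_nth tens2_nth)
  then show ?thesis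
    by (rule cfps_cancel[rotated]) (use nz in simp)
qed

text \<open>Equal arguments, where \<alpha>^2 = \<beta>^2 in the generic argument. With E the
  adjugate and A the matrix T one step lower, EA = AE = q, so qE = EAE = Eq, and the entries of E
  are those of T up to sign.\<close>

lemma qdet_commute_same:
  assumes a: "a \<noteq> 0"
  shows "subst a b qdet * subst a b (T_Y $ i $ j) = subst a b (T_Y $ i $ j) * subst a b qdet"
proof -
  let ?A = "T_at a (b - 1)" and ?E = "transp2 Minus (T_at a b)"
  have "mat (subst a b qdet) ** ?E = ?E ** mat (subst a b qdet)"
    using qdet_adjugate[OF a, of b] by (metis matrix_mul_assoc)
  then have "(mat (subst a b qdet) ** ?E) $ (- j) $ (- i) = (?E ** mat (subst a b qdet)) $ (- j) $ (- i)"
    by simp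
  then show ?thesis
    by (cases i; cases j) (simp_all add: mat_mult_nth mult_mat_nth transp2_nth tsign_def)
qed

text \<open>For equal slopes the generic argument has \<alpha> = b-1-d and \<beta> = 1; it fails at
  b = d, settled separately, and at b - d = 2, excluded by assumption. For distinct slopes \<alpha>
  = 1, while \<beta> has no constant term.\<close>

lemma qdet_commute:
  assumes ac: "a \<noteq> 0" "c \<noteq> 0" and "a \<noteq> c \<or> b - d \<noteq> 2"
  shows "subst a b qdet * subst c d (T_Y $ i $ j) = subst c d (T_Y $ i $ j) * subst a b qdet"
proof (cases "a = c")
  case True
  show ?thesis
  proof (cases "b = d")
    case True
    then show ?thesis using \<open>a = c\<close> ac by (simp add: qdet_commute_same)
  next
    case False
    have "(b - 1 - d)\<^sup>2 \<noteq> 1"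
      using False assms(3) True by (auto simp: power2_eq_1_iff algebra_simps)
    then have nz: "(fps_const (b - 1 - d))\<^sup>2 \<noteq> (1 :: complex fps)\<^sup>2"
      by (auto simp: fps_const_power fps_eq_iff dest: spec[of _ 0])
    show ?thesis
      using True ac by (intro qdet_commute_generic[OF ac _ nz]) (simp add: inv_lin_diff_same)
  qed
next
  case False
  have "1 * (inv_lin a (b - 1) * inv_lin c d) =
      inv_lin (a - c) (b - 1 - d) * (inv_lin c d - inv_lin a (b - 1))"
    using inv_lin_diff[OF ac False] by simp
  moreover have "(1 :: complex fps)\<^sup>2 \<noteq> (inv_lin (a - c) (b - 1 - d))\<^sup>2"
  proof
    assume "(1 :: complex fps)\<^sup>2 = (inv_lin (a - c) (b - 1 - d))\<^sup>2"
    from arg_cong[OF this, of "\<lambda>f. fps_nth f 0"] show False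
      using False by (simp add: power2_eq_square inv_lin_nth_0)
  qed
  ultimately show ?thesis by (rule qdet_commute_generic[OF ac])
qed

text \<open>The second determinant involves entries of T at d and at d - 1, so for equal slopes the
  excluded difference 2 brings the exclusion of 1 with it.\<close>

lemma qdet_commute_qdet:
  assumes ac: "a \<noteq> 0" "c \<noteq> 0" and "a \<noteq> c \<or> (b - d \<noteq> 1 \<and> b - d \<noteq> 2)"
  shows "subst a b qdet * subst c d qdet = subst c d qdet * subst a b qdet"
proof -
  let ?q = "subst a b qdet"
  have 1: "?q * subst c d (T_Y $ i $ j) = subst c d (T_Y $ i $ j) * ?q" for i j
    using assms by (intro qdet_commute) auto
  have 2: "?q * subst c (d - 1) (T_Y $ i $ j) = subst c (d - 1) (T_Y $ i $ j) * ?q" for i j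
    using assms by (intro qdet_commute) (auto simp: algebra_simps)
  have "?q * (f * g) = (f * g) * ?q" if "?q * f = f * ?q" "?q * g = g * ?q" for f g
    using that by (metis mult.assoc)
  from this[OF 2 1] show ?thesis
    using ac by (simp add: qdet_def subst_diff subst_mult subst_subst left_diff_distrib right_diff_distrib)
qed

section \<open>Compression to the symmetric square and fusion\<close>

lemma UNIV_ix3: "UNIV = {Neg3, Zero3, Pos3}"
  by (auto intro: ix3.exhaust)

lemma sum_ix3: "(\<Sum>i\<in>UNIV. f i) = f Neg3 + f Zero3 + f Pos3"
  by (simp add: UNIV_ix3 add.assoc)

definition sym_incl :: "'a::complex_algebra_1 fps^ix3^(ix2 \<times> ix2)"
  where "sym_incl = (\<chi> p i. cfps (fps_const (vbasis i $ p)))"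

definition sym_proj :: "'a::complex_algebra_1 fps^(ix2 \<times> ix2)^ix3"
  where "sym_proj = (\<chi> i p. cfps (fps_const (vbasis i $ p)))"

lemma sym_incl_nth: "sym_incl $ p $ i = cfps (fps_const (vbasis i $ p))"
  by (simp add: sym_incl_def)

lemma sym_proj_nth: "sym_proj $ i $ p = cfps (fps_const (vbasis i $ p))"
  by (simp add: sym_proj_def)

lemma compress_conv: "compress A = sym_proj ** A ** sym_incl"
proof -
  have "(sym_proj ** A ** sym_incl) $ i $ j = compress A $ i $ j" for i j
  proof -
    have "cfps (fps_const x) * A $ a $ b * cfps (fps_const y) = cfps (fps_const (x * y)) * A $ a $ b"
      for x y a b
      unfolding cfps_commute[symmetric, of _ "fps_const y"]
      by (simp add: mult.assoc[symmetric] mult.commute[of x] flip: cfps_mult)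
    then have "(sym_proj ** A ** sym_incl) $ i $ j
      = (\<Sum>b\<in>UNIV. \<Sum>a\<in>UNIV. cfps (fps_const (vbasis i $ a * vbasis j $ b)) * A $ a $ b)"
      by (simp only: matrix_mult_nth sum_distrib_right sym_incl_nth sym_proj_nth)
    then show ?thesis by (simp add: compress_def) (rule sum.swap)
  qed
  then show ?thesis by (simp add: vec_eq_iff)
qed

lemma vbasis_nth:
  "vbasis Neg3 $ p = of_bool (p = (Neg2, Neg2))"
  "vbasis Zero3 $ p = complex_of_real (1 / sqrt 2) * of_bool (fst p \<noteq> snd p)"
  "vbasis Pos3 $ p = - of_bool (p = (Pos2, Pos2))"
  by (cases p; rename_tac i j; case_tac i; case_tac j; simp add: axis_def)+

lemma inverse_sqrt2: "complex_of_real (1 / sqrt 2) * complex_of_real (1 / sqrt 2) = 1 / 2"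
  by (simp flip: of_real_mult)

lemma proj_V_nth: "proj_V $ p $ q = cfps (fps_const ((of_bool (p = q) + of_bool (q = prod.swap p)) / 2))"
proof -
  have ob: "(of_bool b :: complex fps) = fps_const (of_bool b)" for b by simp
  have "proj_V $ p $ q = cfps (fps_const (1 / 2) * (of_bool (p = q) + of_bool (q = prod.swap p)))"
    by (simp only: cfps_mult cfps_add cfps_of_bool) (simp add: proj_V_def R2_def mat_1_nth Pmat_nth)
  also have "fps_const (1 / 2) * (of_bool (p = q) + of_bool (q = prod.swap p))
      = fps_const ((of_bool (p = q) + of_bool (q = prod.swap p)) / 2 :: complex)"
    by (simp only: ob fps_const_add fps_const_mult) simp
  finally show ?thesis .
qed

lemma cfps_const_sum: "(\<Sum>i\<in>I. cfps (fps_const (f i))) = cfps (fps_const (\<Sum>i\<in>I. f i))"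
  by (induction I rule: infinite_finite_induct) (simp_all add: cfps_add flip: fps_const_add)

lemma cfps_const_mult: "cfps (fps_const x) * cfps (fps_const y) = cfps (fps_const (x * y))"
  by (simp add: cfps_mult flip: fps_const_mult)

lemma cfps_const_of_bool: "cfps (fps_const (of_bool b)) = of_bool b"
  by (cases b) simp_all

lemma sym_incl_sym_proj:
  "sym_incl ** sym_proj = (proj_V :: 'a::complex_algebra_1 fps^(ix2 \<times> ix2)^(ix2 \<times> ix2))"
proof -
  have "(\<Sum>k\<in>UNIV. vbasis k $ (a, b) * vbasis k $ (c, d))
      = (of_bool ((a, b) = (c, d)) + of_bool ((c, d) = prod.swap (a, b))) / 2" for a b c d
    using inverse_sqrt2
    by (cases a; cases b; cases c; cases d) (simp_all add: sum_ix3 vbasis_nth del: vbasis.simps)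
  then have "(sym_incl ** sym_proj) $ p $ q = (proj_V :: 'a fps^(ix2 \<times> ix2)^(ix2 \<times> ix2)) $ p $ q" for p q
    unfolding proj_V_nth matrix_mult_nth sym_incl_nth sym_proj_nth cfps_const_mult cfps_const_sum
    by (cases p; cases q) (simp only:)
  then show ?thesis by (simp add: vec_eq_iff)
qed

lemma sym_proj_sym_incl: "sym_proj ** sym_incl = (mat 1 :: 'a::complex_algebra_1 fps^ix3^ix3)"
proof -
  have "(\<Sum>p\<in>UNIV. vbasis i $ p * vbasis j $ p) = of_bool (i = j)" for i j
    using inverse_sqrt2
    by (cases i; cases j) (simp_all add: sum_ix2_pair vbasis_nth del: vbasis.simps)
  then have "(sym_proj ** sym_incl) $ i $ j = (mat 1 :: 'a fps^ix3^ix3) $ i $ j" for i j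
    by (simp add: mat_1_nth matrix_mult_nth sym_incl_nth sym_proj_nth cfps_const_mult
        cfps_const_sum cfps_const_of_bool)
  then show ?thesis by (simp add: vec_eq_iff)
qed

lemma sym_proj_proj_V: "sym_proj ** proj_V = sym_proj"
  by (simp add: sym_proj_sym_incl matrix_mul_assoc flip: sym_incl_sym_proj)

lemma proj_V_sym_incl: "proj_V ** sym_incl = sym_incl"
  by (simp add: sym_proj_sym_incl flip: sym_incl_sym_proj matrix_mul_assoc)

lemma proj_V_idem: "proj_V ** proj_V = proj_V"
  by (metis sym_incl_sym_proj sym_proj_proj_V matrix_mul_assoc)

lemma compress_proj_V_left: "compress (proj_V ** A) = compress A"
  by (simp add: compress_conv matrix_mul_assoc sym_proj_proj_V)

lemma compress_proj_V_right: "compress (A ** proj_V) = compress A"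
  by (simp add: compress_conv proj_V_sym_incl flip: matrix_mul_assoc)

text \<open>Compression is not multiplicative in general; an intermediate projector, factored
  through V, splits the product. The later manipulations aim at placing one.\<close>

lemma compress_mult: "compress (A ** proj_V ** B) = compress A ** compress B"
  by (simp add: compress_conv matrix_mul_assoc flip: sym_incl_sym_proj)

section \<open>The R-matrix at -1 and fusion\<close>

lemma proj_V_conv: "proj_V = cfps (fps_const (1/2)) *\<^sub>m (mat 1 + Pmat)"
  by (simp add: vec_eq_iff proj_V_def R2_def)

lemma proj_V_Pmat: "proj_V ** Pmat = proj_V" and Pmat_proj_V: "Pmat ** proj_V = proj_V"
  by (simp_all add: proj_V_conv mscale_matrix_mult matrix_mult_mscale[OF cfps_commute]
      matrix_add_left_distrib matrix_add_ldistrib Pmat_Pmat add.commute)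

lemma Pmat_tens1: "Pmat ** tens1 A = tens2 A ** (Pmat :: 'a::ring_1^('n::finite \<times> 'n)^('n \<times> 'n))"
proof -
  have "x * of_bool P = of_bool P * x" for x :: 'a and P by (cases P) simp_all
  then show ?thesis
    by (simp add: vec_eq_iff Pmat_mult_nth mult_Pmat_nth tens1_nth tens2_nth)
qed

lemma Pmat_tens2: "Pmat ** tens2 A = tens1 A ** (Pmat :: 'a::ring_1^('n::finite \<times> 'n)^('n \<times> 'n))"
proof -
  have "x * of_bool P = of_bool P * x" for x :: 'a and P by (cases P) simp_all
  then show ?thesis
    by (simp add: vec_eq_iff Pmat_mult_nth mult_Pmat_nth tens1_nth tens2_nth)
qed

lemma mscale_cancel:
  fixes A B :: "'a::complex_algebra_1 fps^'n^'m"
  shows "f \<noteq> 0 \<Longrightarrow> cfps f *\<^sub>m A = cfps f *\<^sub>m B \<Longrightarrow> A = B"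
  by (simp add: vec_eq_iff) (metis cfps_cancel)

lemma minus_R_matrix:
  "cfps (fps_const (- 1)) *\<^sub>m mat 1 - cfps 1 *\<^sub>m Pmat
    = cfps (fps_const (- 2)) *\<^sub>m (proj_V :: 'a::complex_algebra_1 fps^(ix2 \<times> ix2)^(ix2 \<times> ix2))"
proof -
  have "cfps (fps_const (- 2)) * (cfps (fps_const (1/2)) * x) = - x" for x :: "'a fps"
    by (simp add: cfps_const_mult cfps_minus flip: mult.assoc fps_const_neg)
  then show ?thesis
    by (simp add: vec_eq_iff proj_V_conv cfps_minus flip: fps_const_neg)
qed

text \<open>At x - y = -1 the R-matrix is I + P, twice the projector onto V, so the RTT relation
  carries the projector through the product while reversing the factors.\<close>

lemma fusion:
  assumes a: "a \<noteq> 0"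
  shows "proj_V ** tens1 (T_at a b) ** tens2 (T_at a (b + 1))
    = tens2 (T_at a (b + 1)) ** tens1 (T_at a b) ** proj_V"
proof -
  have "fps_const (- 1) * (inv_lin a b * inv_lin a (b + 1)) = 1 * (inv_lin a (b + 1) - inv_lin a b)"
    using inv_lin_diff_same[OF a, of "b + 1" b] by simp
  from RTT[OF a a this] show ?thesis
    unfolding minus_R_matrix mscale_matrix_mult matrix_mult_mscale[OF cfps_commute]
    by (rule mscale_cancel[rotated]) simp
qed

lemma fusion_transp:
  assumes a: "a \<noteq> 0"
  shows "tens1 (transp2 s (T_at a b)) ** tens2 (transp2 s (T_at a (b + 1))) ** proj_V
    = proj_V ** tens2 (transp2 s (T_at a (b + 1))) ** tens1 (transp2 s (T_at a b))"
proof -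
  have "fps_const (- 1) * (inv_lin a b * inv_lin a (b + 1)) = 1 * (inv_lin a (b + 1) - inv_lin a b)"
    using inv_lin_diff_same[OF a, of "b + 1" b] by simp
  from RTT_transp[OF a a this] show ?thesis
    unfolding minus_R_matrix mscale_matrix_mult matrix_mult_mscale[OF cfps_commute]
    by (rule mscale_cancel[rotated]) simp
qed

text \<open>A factor P is absorbed by the projector; moved through the product it exchanges the
  tensor factors, which brings the arguments into the order of \<open>fusion_transp\<close>.\<close>

lemma fusion_transp_swap:
  assumes a: "a \<noteq> 0"
  shows "proj_V ** tens1 (transp2 s (T_at a (b + 1))) ** tens2 (transp2 s (T_at a b))
    = tens1 (transp2 s (T_at a b)) ** tens2 (transp2 s (T_at a (b + 1))) ** proj_V"
    (is "_ ** tens1 ?C ** tens2 ?D = _")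
proof -
  have "proj_V ** tens1 ?C ** tens2 ?D = proj_V ** (Pmat ** tens1 ?C) ** tens2 ?D"
    by (simp only: matrix_mul_assoc proj_V_Pmat)
  also have "\<dots> = proj_V ** tens2 ?C ** (Pmat ** tens2 ?D)"
    unfolding Pmat_tens1 by (simp only: matrix_mul_assoc)
  also have "\<dots> = (proj_V ** tens2 ?C ** tens1 ?D) ** Pmat"
    unfolding Pmat_tens2 by (simp only: matrix_mul_assoc)
  also have "\<dots> = tens1 ?D ** tens2 ?C ** (proj_V ** Pmat)"
    unfolding fusion_transp[OF a, symmetric] by (simp only: matrix_mul_assoc)
  finally show ?thesis unfolding proj_V_Pmat .
qed

section \<open>Scalar matrices compressed to V\<close>

definition diag3 :: "(ix3 \<Rightarrow> complex fps) \<Rightarrow> 'a::complex_algebra_1 fps^ix3^ix3"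
  where "diag3 f = (\<chi> i j. of_bool (i = j) * cfps (f i))"

lemma diag3_nth: "diag3 f $ i $ j = of_bool (i = j) * cfps (f i)"
  by (simp add: diag3_def)

lemma diag3_mult_nth: "(diag3 f ** A) $ i $ j = cfps (f i) * A $ i $ j"
proof -
  have "(diag3 f ** A) $ i $ j = (\<Sum>k\<in>UNIV. if k = i then cfps (f k) * A $ k $ j else 0)"
    unfolding matrix_mult_nth by (intro sum.cong refl) (auto simp: diag3_nth)
  then show ?thesis by simp
qed

lemma mult_diag3_nth: "(A ** diag3 f) $ i $ j = cfps (f j) * A $ i $ j"
proof -
  have "(A ** diag3 f) $ i $ j = (\<Sum>k\<in>UNIV. if k = j then A $ i $ k * cfps (f k) else 0)"
    unfolding matrix_mult_nth by (intro sum.cong refl) (auto simp: diag3_nth)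
  then show ?thesis by (simp add: cfps_commute[of _ "A $ i $ j"])
qed

lemma diag3_diag3: "diag3 f ** diag3 g = (diag3 (\<lambda>i. f i * g i) :: 'a::complex_algebra_1 fps^ix3^ix3)"
proof -
  have "(diag3 f ** diag3 g) $ i $ j = (diag3 (\<lambda>i. f i * g i) :: 'a fps^ix3^ix3) $ i $ j" for i j
    by (cases "i = j") (simp_all add: diag3_mult_nth diag3_nth cfps_mult)
  then show ?thesis by (simp add: vec_eq_iff)
qed

fun kappa3 :: "pm \<Rightarrow> ix3 \<Rightarrow> complex fps"
  where "kappa3 Plus Zero3 = (fps_X + 4) / (fps_X - 4)" | "kappa3 s i = 1"

text \<open>For t_+ the diagonal of K_1 K_2 on V, with v_0 the eigenvector of eigenvalue -1; for t_-
  the factor K_1 K_2 is absent.\<close>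

fun sgn3 :: "pm \<Rightarrow> ix3 \<Rightarrow> complex fps"
  where "sgn3 Plus Zero3 = - 1" | "sgn3 s i = 1"

definition pm_index :: "pm \<Rightarrow> nat"
  where "pm_index s = (case s of Minus \<Rightarrow> 0 | Plus \<Rightarrow> 1)"

lemma K3_conv: "K3 (pm_index s) = diag3 (kappa3 s)"
proof -
  have "K3 (pm_index s) $ i $ j = diag3 (kappa3 s) $ i $ j" for i j
    by (cases s; cases i; cases j) (simp_all add: K3_def pm_index_def diag3_nth mat_1_nth munit_nth)
  then show ?thesis by (simp add: vec_eq_iff)
qed

definition K_power :: "pm \<Rightarrow> 'a::ring_1^(ix2 \<times> ix2)^(ix2 \<times> ix2)"
  where "K_power s = (((**) (tens1 K2 ** tens2 K2)) ^^ pm_index s) (mat 1)"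

lemma K_power_nth:
  "(K_power s :: 'a::ring_1^(ix2 \<times> ix2)^(ix2 \<times> ix2)) $ p $ q
    = of_bool (p = q) * (case s of Minus \<Rightarrow> 1 | Plus \<Rightarrow> sign2 (fst p) * sign2 (snd p))"
  by (cases s; cases p; cases q; rename_tac i j k l; case_tac i; case_tac j; case_tac k; case_tac l)
     (simp_all add: K_power_def pm_index_def tens1_tens2_nth mat_1_nth K2_def munit_nth)

lemma compress_scalar:
  "compress (\<chi> a b. cfps (\<rho> a b)) $ i $ j
    = cfps (\<Sum>a\<in>UNIV. \<Sum>b\<in>UNIV. fps_const (vbasis i $ a * vbasis j $ b) * \<rho> a b)"
proof -
  have cs: "cfps (sum f I) = (\<Sum>x\<in>I. cfps (f x))" for f and I :: "(ix2 \<times> ix2) set"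
    by (induction I rule: infinite_finite_induct) (simp_all add: cfps_add)
  show ?thesis by (simp add: compress_def cs cfps_mult del: vbasis.simps)
qed

text \<open>Q^- = I - P vanishes on V. Q^+ is the rank one matrix of the vector sqrt(2) v_0, so it
  contributes 2 at v_0 and nothing elsewhere.\<close>

lemma compress_R2_transp:
  "compress (R2_transp s (cfps r)) = (diag3 (\<lambda>i. if s = Plus \<and> i = Zero3 then 1 - 2 * r else 1) :: 'a::complex_algebra_1 fps^ix3^ix3)"
proof -
  define \<rho> :: "ix2 \<times> ix2 \<Rightarrow> ix2 \<times> ix2 \<Rightarrow> complex fps" where
    "\<rho> = (\<lambda>p q. of_bool (p = q) - r * (of_bool (snd p = - fst p \<and> snd q = - fst q) * tsign s (fst p) (fst q)))"
  have ts: "cfps (tsign s i j) = (tsign s i j :: 'a fps)" for i j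
    by (cases s; cases i; cases j) (simp_all add: tsign_def cfps_minus)
  have "R2_transp s (cfps r) = ((\<chi> p q. cfps (\<rho> p q)) :: 'a fps^(ix2 \<times> ix2)^(ix2 \<times> ix2))"
    by (simp only: vec_eq_iff vec_lambda_beta \<rho>_def cfps_diff cfps_mult cfps_of_bool ts)
       (simp only: R2_transp_def Qmat2_nth mat_1_nth vector_minus_component mscale_nth, intro allI refl)
  then have 1: "compress (R2_transp s (cfps r)) $ i $ j
      = (cfps (\<Sum>a\<in>UNIV. \<Sum>b\<in>UNIV. fps_const (vbasis i $ a * vbasis j $ b) * \<rho> a b) :: 'a fps)" for i j
    by (simp only: compress_scalar)
  have half: "fps_const (1 / 2) * x + fps_const (1 / 2) * x = x" for x :: "complex fps"
    by (simp flip: distrib_right)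
  have "(\<Sum>a\<in>UNIV. \<Sum>b\<in>UNIV. fps_const (vbasis i $ a * vbasis j $ b) * \<rho> a b)
      = of_bool (i = j) * (if s = Plus \<and> i = Zero3 then 1 - 2 * r else 1)" for i j
    using inverse_sqrt2 half[of 1] half[of r]
    by (cases i; cases j; cases s)
       (simp_all add: sum_ix2_pair vbasis_nth \<rho>_def tsign_def algebra_simps del: vbasis.simps of_real_divide)
  then have "compress (R2_transp s (cfps r)) $ i $ j = (diag3 (\<lambda>i. if s = Plus \<and> i = Zero3 then 1 - 2 * r else 1) :: 'a fps^ix3^ix3) $ i $ j" for i j
    unfolding 1 diag3_nth by (cases "i = j") simp_all
  then show ?thesis by (simp add: vec_eq_iff)
qed

lemma compress_K_power: "compress (K_power s) = (diag3 (sgn3 s) :: 'a::complex_algebra_1 fps^ix3^ix3)"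
proof -
  define \<rho> :: "ix2 \<times> ix2 \<Rightarrow> ix2 \<times> ix2 \<Rightarrow> complex fps" where
    "\<rho> = (\<lambda>p q. of_bool (p = q) * (case s of Minus \<Rightarrow> 1 | Plus \<Rightarrow> sign2 (fst p) * sign2 (snd p)))"
  have ts: "cfps (case s of Minus \<Rightarrow> 1 | Plus \<Rightarrow> sign2 i * sign2 j)
      = (case s of Minus \<Rightarrow> (1 :: 'a fps) | Plus \<Rightarrow> sign2 i * sign2 j)" for i j
    by (cases s; cases i; cases j) (simp_all add: cfps_minus)
  have "K_power s = ((\<chi> p q. cfps (\<rho> p q)) :: 'a fps^(ix2 \<times> ix2)^(ix2 \<times> ix2))"
    by (simp only: vec_eq_iff vec_lambda_beta \<rho>_def cfps_mult cfps_of_bool ts)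
       (simp only: K_power_nth, intro allI refl)
  then have 1: "compress (K_power s) $ i $ j
      = (cfps (\<Sum>a\<in>UNIV. \<Sum>b\<in>UNIV. fps_const (vbasis i $ a * vbasis j $ b) * \<rho> a b) :: 'a fps)" for i j
    by (simp only: compress_scalar)
  have "(\<Sum>a\<in>UNIV. \<Sum>b\<in>UNIV. fps_const (vbasis i $ a * vbasis j $ b) * \<rho> a b)
      = of_bool (i = j) * sgn3 s i" for i j
    using inverse_sqrt2
    by (cases i; cases j; cases s)
       (simp_all add: sum_ix2_pair vbasis_nth \<rho>_def mult.commute del: vbasis.simps of_real_divide)
  then have "compress (K_power s) $ i $ j = (diag3 (sgn3 s) :: 'a fps^ix3^ix3) $ i $ j" for i j
    unfolding 1 diag3_nth by (cases "i = j") simp_all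
  then show ?thesis by (simp add: vec_eq_iff)
qed

lemma transp3_nth: "transp3 A $ i $ j = A $ (- j) $ (- i)"
  by (simp add: transp3_def)

text \<open>On \<open>V\<close> the map \<open>e\<^sub>a \<mapsto> sign a e\<^sub>-\<^sub>a\<close> (for \<open>t\<^sub>-\<close>) sends \<open>v\<^sub>i\<close> to \<open>- v\<^sub>-\<^sub>i\<close>, whereas
  \<open>e\<^sub>a \<mapsto> e\<^sub>-\<^sub>a\<close> (for \<open>t\<^sub>+\<close>) fixes \<open>v\<^sub>0\<close> and exchanges \<open>v\<^sub>1\<close> and \<open>- v\<^sub>-\<^sub>1\<close>.\<close>

lemma transp3_compress:
  fixes D C :: "'a::complex_algebra_1 fps^ix2^ix2"
  shows "transp3 (compress (tens1 D ** tens2 C))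
    = diag3 (sgn3 s) ** compress (tens1 (transp2 s D) ** tens2 (transp2 s C)) ** diag3 (sgn3 s)"
proof -
  have "transp3 (compress (tens1 D ** tens2 C)) $ i $ j
    = cfps (sgn3 s j) * (cfps (sgn3 s i) * compress (tens1 (transp2 s D) ** tens2 (transp2 s C)) $ i $ j)" for i j
    by (cases s; cases i; cases j)
       (simp_all add: transp3_nth compress_def tens1_tens2_nth transp2_nth tsign_def sum_ix2_pair vbasis_nth
          cfps_minus algebra_simps del: vbasis.simps flip: fps_const_neg)
  then show ?thesis by (simp add: vec_eq_iff diag3_mult_nth mult_diag3_nth)
qed

definition fused_T :: "complex \<Rightarrow> complex \<Rightarrow> Y2 fps^ix3^ix3"
  where "fused_T a b = compress (proj_V ** tens1 (T_at a b) ** tens2 (T_at a (b + 1)))"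

text \<open>The claimed image of S(u) with an arbitrary matrix in place of the S-matrix of Y(2), so
  that truncated and rescaled matrices can be fused too.\<close>

definition fused_S :: "pm \<Rightarrow> 'a::complex_algebra_1 fps^ix2^ix2 \<Rightarrow> 'a fps^ix3^ix3"
  where "fused_S s A = compress (proj_V ** tens1 (map_mat (subst 2 (- 1)) A)
    ** R2_transp s (cfps (inv_lin (- 4) 1)) ** tens2 (map_mat (subst 2 0) A) ** K_power s)"

lemma fused_T_conv: "fused_T a b = compress (tens1 (T_at a b) ** tens2 (T_at a (b + 1)))"
  unfolding fused_T_def by (simp add: compress_proj_V_left flip: matrix_mul_assoc)

lemma map_mat_mult_subst:
  fixes A :: "'a::complex_algebra_1 fps^'n::finite^'m" and B :: "'a fps^'k^'n"
  assumes "a \<noteq> 0"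
  shows "map_mat (subst a b) (A ** B) = map_mat (subst a b) A ** map_mat (subst a b) B"
  by (simp add: vec_eq_iff matrix_mult_nth subst_sum subst_mult[OF assms])

lemma map_mat_subst_transp2:
  fixes A :: "'a::complex_algebra_1 fps^ix2^ix2"
  assumes "a \<noteq> 0"
  shows "map_mat (subst a b) (transp2 s A) = transp2 s (map_mat (subst a b) A)"
proof -
  have "subst a b (tsign s i j) = (tsign s i j :: 'a fps)" for i j
    by (cases s; cases i; cases j) (simp_all add: tsign_def subst_minus)
  then show ?thesis by (simp add: vec_eq_iff transp2_nth subst_mult[OF assms])
qed

lemma map_mat_subst_subst:
  "a \<noteq> 0 \<Longrightarrow> c \<noteq> 0 \<Longrightarrow> map_mat (subst a b) (map_mat (subst c d) A) = map_mat (subst (c * a) (c * b + d)) A"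
  by (simp add: vec_eq_iff subst_subst)

lemma commute_proj_VI:
  fixes A :: "'a::complex_algebra_1 fps^(ix2 \<times> ix2)^(ix2 \<times> ix2)"
  assumes "\<And>p q. A $ prod.swap p $ q = A $ p $ prod.swap q"
  shows "proj_V ** A = A ** proj_V"
proof -
  have "Pmat ** A = A ** Pmat"
    by (simp only: vec_eq_iff Pmat_mult_nth mult_Pmat_nth assms) simp
  then show ?thesis
    by (simp add: proj_V_conv mscale_matrix_mult matrix_mult_mscale[OF cfps_commute]
        matrix_add_left_distrib matrix_add_ldistrib)
qed

lemma proj_V_R2_transp:
  fixes r :: "'a::complex_algebra_1 fps"
  shows "proj_V ** R2_transp s r = R2_transp s r ** proj_V"
proof (rule commute_proj_VI)
  fix p q :: "ix2 \<times> ix2"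
  show "R2_transp s r $ prod.swap p $ q = R2_transp s r $ p $ prod.swap q"
    by (cases p; cases q; rename_tac i j k l; case_tac i; case_tac j; case_tac k; case_tac l; cases s)
       (simp_all add: R2_transp_def Qmat2_nth mat_1_nth tsign_def)
qed

lemma kappa3_sgn3: "kappa3 s i * sgn3 s i = (if s = Plus \<and> i = Zero3 then 1 - 2 * inv_lin (- 4) 1 else 1)"
proof -
  define e :: "complex fps" where "e = inverse (fps_X - 4)"
  have n: "fps_const (- 4) + fps_const 1 * fps_X = (fps_X - 4 :: complex fps)"
    by (simp add: fps_eq_iff numeral_fps_const)
  have nz: "fps_nth (fps_X - 4 :: complex fps) 0 \<noteq> 0"
    by (simp add: numeral_fps_const)
  have e: "e * (fps_X - 4) = 1"
    unfolding e_def by (rule inverse_mult_eq_1[OF nz])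
  have inv: "inv_lin (- 4) 1 = fps_X * e"
    unfolding inv_lin_def n using nz by (simp add: e_def fps_divide_unit)
  have "- ((fps_X + 4) / (fps_X - 4)) = - ((fps_X + 4) * e)"
    using nz by (simp add: e_def fps_divide_unit)
  also have "\<dots> = e * (fps_X - 4) - 2 * (fps_X * e)"
    by (simp add: algebra_simps)
  also have "\<dots> = 1 - 2 * inv_lin (- 4) 1"
    unfolding e inv ..
  finally show ?thesis
    by (cases s; cases i) simp_all
qed

text \<open>The factors T_1(1-2u)^t and T_2(2u) stand on either side of R(1-4u)^t, whose argument is
  their difference, so the crossed relation exchanges them. This brings together the fusable pairs:
  T at 2u-1 and 2u, and transposed T at 1-2u and -2u.\<close>

lemma fused_S_Y: "fused_S s (S_Y s) = fused_T 2 (- 1) ** diag3 (kappa3 s) ** transp3 (fused_T (- 2) 0)"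
proof -
  let ?A = "tens1 (T_at 2 (- 1))" and ?B = "tens2 (T_at 2 0)"
  let ?C1 = "tens1 (transp2 s (T_at (- 2) 1))" and ?C2 = "tens2 (transp2 s (T_at (- 2) 1))"
  let ?D1 = "tens1 (transp2 s (T_at (- 2) 0))" and ?D2 = "tens2 (transp2 s (T_at (- 2) 0))"
  let ?R = "R2_transp s (cfps (inv_lin (- 4) 1)) :: Y2 fps^(ix2 \<times> ix2)^(ix2 \<times> ix2)"
  have A: "tens1 (map_mat (subst 2 (- 1)) (S_Y s)) = ?A ** ?C1"
    by (simp add: S_Y_def map_mat_mult_subst map_mat_subst_transp2 map_mat_subst_subst tens1_mult)
  have B: "tens2 (map_mat (subst 2 0) (S_Y s)) = ?B ** ?D2"
    by (simp add: S_Y_def map_mat_mult_subst map_mat_subst_transp2 map_mat_subst_subst tens2_mult)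
  have "1 * (inv_lin (- 2) 1 * inv_lin 2 0) = inv_lin (- 4) 1 * (inv_lin 2 0 - inv_lin (- 2) 1)"
    using inv_lin_diff[of "- 2" 2 1 0] by simp
  from RTT_crossed[OF _ _ this, of s] have cross: "?C1 ** ?R ** ?B = ?B ** ?R ** ?C1"
    by (simp add: R2_transp_def mscale_def map_mat_def)
  have fus: "proj_V ** ?A ** ?B = ?B ** ?A ** proj_V"
    using fusion[of 2 "- 1"] by simp
  have fus': "proj_V ** ?C1 ** ?D2 = ?D1 ** ?C2 ** proj_V"
    using fusion_transp_swap[of "- 2" s 0] by simp
  have idem: "X ** proj_V ** proj_V = X ** proj_V" for X :: "Y2 fps^(ix2 \<times> ix2)^(ix2 \<times> ix2)"
    by (simp add: proj_V_idem flip: matrix_mul_assoc)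
  \<comment> \<open>Fusion carries the projector to the right end, where a further one is absorbed;
    read backwards, this separates the first fused pair from the rest.\<close>
  have fus2: "proj_V ** ?A ** ?B ** proj_V = proj_V ** ?A ** ?B"
    unfolding fus by (rule idem)
  have "fused_S s (S_Y s) = compress (proj_V ** ?A ** (?C1 ** ?R ** ?B) ** ?D2 ** K_power s)"
    unfolding fused_S_def A B by (simp only: matrix_mul_assoc)
  also have "\<dots> = compress ((proj_V ** ?A ** ?B) ** ?R ** ?C1 ** ?D2 ** K_power s)"
    unfolding cross by (simp only: matrix_mul_assoc)
  also have "\<dots> = compress (proj_V ** ?A ** ?B ** proj_V ** (?R ** ?C1 ** ?D2 ** K_power s))"
    unfolding fus2 by (simp only: matrix_mul_assoc)
  also have "\<dots> = fused_T 2 (- 1) ** compress (?R ** ?C1 ** ?D2 ** K_power s)"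
    unfolding compress_mult fused_T_def by simp
  also have "compress (?R ** ?C1 ** ?D2 ** K_power s) = compress ((proj_V ** ?R) ** ?C1 ** ?D2 ** K_power s)"
    using compress_proj_V_left[of "?R ** ?C1 ** ?D2 ** K_power s"] by (simp only: matrix_mul_assoc)
  also have "\<dots> = compress (?R ** proj_V ** (?C1 ** ?D2 ** K_power s))"
    unfolding proj_V_R2_transp by (simp only: matrix_mul_assoc)
  also have "\<dots> = compress ?R ** compress (proj_V ** (?C1 ** ?D2 ** K_power s))"
    unfolding compress_mult compress_proj_V_left ..
  also have "proj_V ** (?C1 ** ?D2 ** K_power s) = ?D1 ** ?C2 ** proj_V ** K_power s"
    by (simp only: matrix_mul_assoc fus')
  also have "compress \<dots> = compress (?D1 ** ?C2) ** compress (K_power s)"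
    by (rule compress_mult)
  finally have 1: "fused_S s (S_Y s)
      = fused_T 2 (- 1) ** (compress ?R ** (compress (?D1 ** ?C2) ** diag3 (sgn3 s)))"
    unfolding compress_K_power .
  \<comment> \<open>Transposing the second fused matrix conjugates by the sign matrix: the left copy
    turns K(u) into the compressed R-matrix, the right copy is the compressed
    \<open>K_power\<close>.\<close>
  have "diag3 (kappa3 s) ** transp3 (fused_T (- 2) 0)
    = diag3 (kappa3 s) ** diag3 (sgn3 s) ** (compress (?D1 ** ?C2) ** diag3 (sgn3 s))"
    unfolding fused_T_conv transp3_compress[of _ _ s] by (simp add: matrix_mul_assoc)
  also have "diag3 (kappa3 s) ** diag3 (sgn3 s) = compress ?R"
    unfolding compress_R2_transp diag3_diag3 kappa3_sgn3 ..
  finally show ?thesis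
    unfolding 1 by (simp only: matrix_mul_assoc[symmetric])
qed

section \<open>Unitarity\<close>

lemma compress_mat: "compress (mat x) = mat x"
proof -
  have "sym_proj ** mat x = mat x ** sym_proj"
    by (simp add: vec_eq_iff mult_mat_nth mat_mult_nth sym_proj_nth cfps_commute[of _ x])
  then show ?thesis
    unfolding compress_conv by (simp add: sym_proj_sym_incl flip: matrix_mul_assoc)
qed

lemma mat_mult_mat: "mat x ** mat y = (mat (x * y) :: 'a::semiring_1^'n::finite^'n)"
  by (simp add: vec_eq_iff mat_mult_nth) (simp add: mat_def)

lemma tens2_mat: "tens2 (mat x :: 'a::semiring_1^'n::finite^'n) = mat x"
  by (auto simp: vec_eq_iff tens2_nth mat_def)

definition z_Y :: "complex \<Rightarrow> complex \<Rightarrow> Y2 fps"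
  where "z_Y a b = subst a (b + 1) qdet * subst a (b + 2) qdet"

text \<open>For t_- the signs on V are trivial, so the transpose is the fusion of the adjugates one
  step higher. Fusion reorders one product so that the pairs in each tensor factor meet and collapse
  to quantum determinants.\<close>

lemma fused_T_transp:
  assumes a: "a \<noteq> 0"
  shows "transp3 (fused_T a (b + 1)) ** fused_T a b = mat (z_Y a b)"
    and "fused_T a b ** transp3 (fused_T a (b + 1)) = mat (z_Y a b)"
proof -
  let ?A = "T_at a b" and ?B = "T_at a (b + 1)"
  let ?E = "transp2 Minus (T_at a (b + 1))" and ?F = "transp2 Minus (T_at a (b + 2))"
  let ?q1 = "subst a (b + 1) qdet" and ?q2 = "subst a (b + 2) qdet"
  have "diag3 (sgn3 Minus) = (mat 1 :: Y2 fps^ix3^ix3)"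
    by (simp add: vec_eq_iff diag3_nth mat_1_nth)
  then have t: "transp3 (fused_T a (b + 1)) = compress (tens1 ?E ** tens2 ?F)"
    unfolding fused_T_conv transp3_compress[of _ _ Minus] by (simp add: add.assoc)
  have EA: "tens1 ?E ** tens1 ?A = mat ?q1" "tens1 ?A ** tens1 ?E = mat ?q1"
    using qdet_adjugate[OF a, of "b + 1"] by (simp_all add: tens1_mat flip: tens1_mult)
  have FB: "tens2 ?F ** tens2 ?B = mat ?q2" "tens2 ?B ** tens2 ?F = mat ?q2"
    using qdet_adjugate[OF a, of "b + 2"] by (simp_all add: add.commute tens2_mat flip: tens2_mult)
  \<comment> \<open>The determinant at b+1 has to pass entries at b+2 here and at b+1 in the next
    fact; both avoid the excluded difference 2.\<close>
  have F: "tens2 ?F ** mat ?q1 = mat ?q1 ** tens2 ?F"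
  proof -
    have "?F $ i $ j * ?q1 = ?q1 * ?F $ i $ j" for i j
      using qdet_commute[OF a a, of "b + 1" "b + 2"]
      by (cases i; cases j) (simp_all add: transp2_nth tsign_def)
    then show ?thesis
      by (simp add: vec_eq_iff mat_mult_nth mult_mat_nth tens2_nth)
  qed
  have B: "tens2 ?B ** mat ?q1 = mat ?q1 ** tens2 ?B"
  proof -
    have "?B $ i $ j * ?q1 = ?q1 * ?B $ i $ j" for i j
      using qdet_commute[OF a a, of "b + 1" "b + 1"] by simp
    then show ?thesis
      by (simp add: vec_eq_iff mat_mult_nth mult_mat_nth tens2_nth)
  qed
  have fus': "tens1 ?E ** tens2 ?F ** proj_V = proj_V ** tens2 ?F ** tens1 ?E"
    using fusion_transp[OF a, of Minus "b + 1"] by (simp add: add.assoc)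
  note fus = fusion[OF a, of b]
  have "transp3 (fused_T a (b + 1)) ** fused_T a b
      = compress (tens1 ?E ** tens2 ?F ** proj_V ** (tens1 ?A ** tens2 ?B))"
    unfolding t compress_mult fused_T_conv[of a b] ..
  also have "\<dots> = compress (proj_V ** (tens2 ?F ** (tens1 ?E ** tens1 ?A) ** tens2 ?B))"
    unfolding fus' by (simp only: matrix_mul_assoc)
  also have "\<dots> = compress (mat ?q1 ** (tens2 ?F ** tens2 ?B))"
    unfolding EA compress_proj_V_left F by (simp only: matrix_mul_assoc)
  finally show "transp3 (fused_T a (b + 1)) ** fused_T a b = mat (z_Y a b)"
    unfolding FB mat_mult_mat compress_mat z_Y_def .
  have "fused_T a b ** transp3 (fused_T a (b + 1))
      = compress (proj_V ** tens1 ?A ** tens2 ?B ** proj_V ** (tens1 ?E ** tens2 ?F))"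
    unfolding t fused_T_def[of a b] compress_mult ..
  also have "\<dots> = compress (tens2 ?B ** tens1 ?A ** (proj_V ** proj_V) ** (tens1 ?E ** tens2 ?F))"
    unfolding fus by (simp only: matrix_mul_assoc)
  also have "\<dots> = compress (tens2 ?B ** tens1 ?A ** proj_V ** (tens1 ?E ** tens2 ?F ** proj_V))"
    unfolding proj_V_idem using compress_proj_V_right[of "tens2 ?B ** tens1 ?A ** proj_V ** (tens1 ?E ** tens2 ?F)"]
    by (simp only: matrix_mul_assoc)
  also have "\<dots> = compress (tens2 ?B ** tens1 ?A ** (proj_V ** proj_V ** tens2 ?F ** tens1 ?E))"
    unfolding fus' by (simp only: matrix_mul_assoc)
  also have "\<dots> = compress (tens2 ?B ** (tens1 ?A ** tens1 ?E) ** tens2 ?F ** proj_V)"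
    unfolding proj_V_idem fus'[symmetric] by (simp only: matrix_mul_assoc)
  also have "\<dots> = compress (mat ?q1 ** (tens2 ?B ** tens2 ?F))"
    unfolding EA B compress_proj_V_right by (simp only: matrix_mul_assoc)
  finally show "fused_T a b ** transp3 (fused_T a (b + 1)) = mat (z_Y a b)"
    unfolding FB mat_mult_mat compress_mat z_Y_def .
qed

lemma mat_z_Y_commute:
  assumes "a \<noteq> 0" "c \<noteq> 0" "a \<noteq> c"
  shows "mat (z_Y a b) ** fused_T c d = fused_T c d ** mat (z_Y a b)"
proof -
  let ?z = "z_Y a b"
  have comm: "?z * subst c d (T_Y $ i $ j) = subst c d (T_Y $ i $ j) * ?z" for i j d
  proof -
    have *: "x * y * t = t * (x * y)" if "x * t = t * x" "y * t = t * y" for x y t :: "Y2 fps"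
      using that by (metis mult.assoc)
    show ?thesis
      unfolding z_Y_def by (intro * qdet_commute assms disjI1)
  qed
  have ob: "x * of_bool P = of_bool P * x" for x :: "Y2 fps" and P
    by (cases P) simp_all
  have 1: "mat ?z ** tens1 (T_at c d) = tens1 (T_at c d) ** mat ?z"
    and 2: "mat ?z ** tens2 (T_at c (d + 1)) = tens2 (T_at c (d + 1)) ** mat ?z"
    using comm ob
    by (simp_all add: vec_eq_iff mat_mult_nth mult_mat_nth tens1_nth tens2_nth)
  have p: "mat ?z ** sym_proj = sym_proj ** mat ?z"
    by (simp add: vec_eq_iff mult_mat_nth mat_mult_nth sym_proj_nth cfps_commute[of _ ?z])
  have i: "mat ?z ** sym_incl = sym_incl ** mat ?z"
    by (simp add: vec_eq_iff mult_mat_nth mat_mult_nth sym_incl_nth cfps_commute[of _ ?z])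
  have "mat ?z ** fused_T c d
      = mat ?z ** sym_proj ** (tens1 (T_at c d) ** tens2 (T_at c (d + 1))) ** sym_incl"
    unfolding fused_T_conv compress_conv by (simp only: matrix_mul_assoc)
  also have "\<dots> = sym_proj ** (mat ?z ** tens1 (T_at c d)) ** tens2 (T_at c (d + 1)) ** sym_incl"
    unfolding p by (simp only: matrix_mul_assoc)
  also have "\<dots> = sym_proj ** tens1 (T_at c d) ** (mat ?z ** tens2 (T_at c (d + 1))) ** sym_incl"
    unfolding 1 by (simp only: matrix_mul_assoc)
  also have "\<dots> = sym_proj ** tens1 (T_at c d) ** tens2 (T_at c (d + 1)) ** (mat ?z ** sym_incl)"
    unfolding 2 by (simp only: matrix_mul_assoc)
  also have "\<dots> = fused_T c d ** mat ?z"
    unfolding i fused_T_conv compress_conv by (simp only: matrix_mul_assoc)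
  finally show ?thesis .
qed

text \<open>Such matrices lie over every subalgebra and are preserved by every algebra map, which
  handles all constant factors of \<open>fused_S\<close> at once.\<close>

definition scalar_mat :: "complex fps^'n^'m \<Rightarrow> 'a::complex_algebra_1 fps^'n^'m"
  where "scalar_mat = map_mat cfps"

lemma scalar_mat_nth: "scalar_mat C $ i $ j = cfps (C $ i $ j)"
  by (simp add: scalar_mat_def)

lemma sym_proj_scalar: "sym_proj = scalar_mat sym_proj"
  by (simp add: vec_eq_iff scalar_mat_nth sym_proj_nth)

lemma sym_incl_scalar: "sym_incl = scalar_mat sym_incl"
  by (simp add: vec_eq_iff scalar_mat_nth sym_incl_nth)

lemma proj_V_scalar: "proj_V = scalar_mat proj_V"
  by (simp only: vec_eq_iff scalar_mat_nth proj_V_nth cfps_id) simp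

lemma cfps_tsign: "cfps (tsign s i j) = tsign s i j"
  by (cases s; cases i; cases j) (simp_all add: tsign_def cfps_minus)

lemma R2_transp_scalar: "R2_transp s (cfps r) = scalar_mat (R2_transp s r)"
  by (simp only: vec_eq_iff scalar_mat_nth R2_transp_def vector_minus_component mscale_nth Qmat2_nth mat_1_nth
      cfps_diff cfps_mult cfps_of_bool cfps_tsign) simp

lemma K_power_scalar: "K_power s = scalar_mat (K_power s)"
proof -
  have "cfps (case s of Minus \<Rightarrow> 1 | Plus \<Rightarrow> sign2 i * sign2 j)
      = (case s of Minus \<Rightarrow> (1 :: 'a fps) | Plus \<Rightarrow> sign2 i * sign2 j)" for i j
    by (cases s; cases i; cases j) (simp_all add: cfps_minus)
  then show ?thesis
    by (simp only: vec_eq_iff scalar_mat_nth K_power_nth cfps_mult cfps_of_bool) simp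
qed

lemma map_mat_subst_compress:
  fixes A :: "'a::complex_algebra_1 fps^(ix2 \<times> ix2)^(ix2 \<times> ix2)"
  assumes "a \<noteq> 0"
  shows "map_mat (subst a b) (compress A) = compress (map_mat (subst a b) A)"
proof -
  have "map_mat (subst a b) sym_proj = (sym_proj :: 'a fps^(ix2 \<times> ix2)^ix3)"
    "map_mat (subst a b) sym_incl = (sym_incl :: 'a fps^ix3^(ix2 \<times> ix2))"
    by (simp_all add: vec_eq_iff sym_proj_nth sym_incl_nth subst_cfps)
  then show ?thesis by (simp add: compress_conv map_mat_mult_subst[OF assms])
qed

lemma map_mat_subst_tens:
  assumes "a \<noteq> 0"
  shows "map_mat (subst a b) (tens1 A) = tens1 (map_mat (subst a b) A)"
    and "map_mat (subst a b) (tens2 A) = tens2 (map_mat (subst a b) A)"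
  by (simp_all add: vec_eq_iff tens1_nth tens2_nth subst_mult[OF assms])

lemma map_mat_subst_fused_T:
  assumes "a \<noteq> 0" "c \<noteq> 0"
  shows "map_mat (subst c d) (fused_T a b) = fused_T (a * c) (a * d + b)"
  using assms
  by (simp add: fused_T_conv map_mat_subst_compress map_mat_mult_subst map_mat_subst_tens map_mat_subst_subst add.assoc)

lemma map_mat_transp3: "map_mat h (transp3 A) = transp3 (map_mat h A)"
  by (simp add: vec_eq_iff transp3_nth)

lemma kappa3_inverse: "kappa3 s i * subst (- 1) 0 (kappa3 s i) = 1"
proof -
  define k :: "complex fps" where "k = (fps_X + 4) / (fps_X - 4)"
  have nz: "fps_nth (fps_X - 4 :: complex fps) 0 \<noteq> 0" "fps_nth (- fps_X - 4 :: complex fps) 0 \<noteq> 0"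
    by (simp_all add: numeral_fps_const)
  have k: "k * (fps_X - 4) = fps_X + 4"
    unfolding k_def using nz(1) inverse_mult_eq_1[OF nz(1)] by (simp add: fps_divide_unit mult.assoc)
  have "inv_lin (- 1) 0 = - fps_X"
    by (rule inv_lin_eqI) simp_all
  then have X: "subst (- 1) 0 fps_X = - (fps_X :: complex fps)"
    by (simp add: subst_compose)
  have "subst (- 1) 0 (4 :: complex fps) = 4"
    by (simp add: numeral_fps_const)
  then have k': "subst (- 1) 0 k * (- fps_X - 4) = - fps_X + 4"
    using arg_cong[OF k, of "subst (- 1) 0"] by (simp add: subst_mult subst_diff subst_add X)
  have "(k * subst (- 1) 0 k) * ((fps_X - 4) * (- fps_X - 4))
      = (k * (fps_X - 4)) * (subst (- 1) 0 k * (- fps_X - 4))"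
    by (simp only: ac_simps)
  also have "\<dots> = 1 * ((fps_X - 4) * (- fps_X - 4))"
    unfolding k k' by (simp add: algebra_simps)
  finally have "k * subst (- 1) 0 k = 1"
    using nz by (metis fps_zero_nth mult_right_cancel no_zero_divisors)
  then show ?thesis by (cases s; cases i) (simp_all flip: k_def)
qed

lemma map_mat_subst_diag3:
  "map_mat (subst a b) (diag3 f) = (diag3 (\<lambda>i. subst a b (f i)) :: 'a::complex_algebra_1 fps^ix3^ix3)"
proof -
  have "subst a b (diag3 f $ i $ j) = (diag3 (\<lambda>i. subst a b (f i)) :: 'a fps^ix3^ix3) $ i $ j" for i j
    by (cases "i = j") (simp_all add: diag3_nth subst_cfps)
  then show ?thesis by (simp add: vec_eq_iff)
qed

definition w_Y :: "Y2 fps"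
  where "w_Y = z_Y (- 2) (- 1) * z_Y 2 (- 1)"

text \<open>In S(u) S(-u) the inner factors are a transposed fused T and the fused T one step lower,
  whose product is scalar; of slope -2, it commutes with the outer factors of slope 2. Then K(u)
  K(-u) = I, and the outer factors collapse likewise.\<close>

lemma fused_S_Y_unitary:
  "fused_S s (S_Y s) ** map_mat (subst (- 1) 0) (fused_S s (S_Y s)) = mat w_Y"
proof -
  let ?K = "diag3 (kappa3 s) :: Y2 fps^ix3^ix3" and ?K' = "diag3 (\<lambda>i. subst (- 1) 0 (kappa3 s i)) :: Y2 fps^ix3^ix3"
  let ?z = "mat (z_Y (- 2) (- 1)) :: Y2 fps^ix3^ix3"
  have KK': "?K ** ?K' = mat 1"
    unfolding diag3_diag3 kappa3_inverse by (simp add: vec_eq_iff diag3_nth mat_1_nth)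
  have z: "?K ** ?z = ?z ** ?K"
    by (simp add: vec_eq_iff diag3_mult_nth mult_diag3_nth mat_def)
  have "map_mat (subst (- 1) 0) (fused_S s (S_Y s)) = fused_T (- 2) (- 1) ** ?K' ** transp3 (fused_T 2 0)"
    by (simp add: fused_S_Y map_mat_mult_subst map_mat_subst_fused_T map_mat_transp3 map_mat_subst_diag3)
  then have "fused_S s (S_Y s) ** map_mat (subst (- 1) 0) (fused_S s (S_Y s))
      = fused_T 2 (- 1) ** ?K ** (transp3 (fused_T (- 2) 0) ** fused_T (- 2) (- 1)) ** ?K' ** transp3 (fused_T 2 0)"
    by (simp only: fused_S_Y matrix_mul_assoc)
  also have "transp3 (fused_T (- 2) 0) ** fused_T (- 2) (- 1) = ?z"
    using fused_T_transp(1)[of "- 2" "- 1"] by simp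
  also have "fused_T 2 (- 1) ** ?K ** ?z ** ?K' ** transp3 (fused_T 2 0)
      = fused_T 2 (- 1) ** (?K ** ?z) ** ?K' ** transp3 (fused_T 2 0)"
    by (simp only: matrix_mul_assoc)
  also have "\<dots> = (fused_T 2 (- 1) ** ?z) ** (?K ** ?K') ** transp3 (fused_T 2 0)"
    unfolding z by (simp only: matrix_mul_assoc)
  also have "\<dots> = ?z ** (fused_T 2 (- 1) ** transp3 (fused_T 2 0))"
    unfolding KK' using mat_z_Y_commute[of "- 2" 2 "- 1" "- 1"] by (simp add: matrix_mul_assoc)
  also have "fused_T 2 (- 1) ** transp3 (fused_T 2 0) = mat (z_Y 2 (- 1))"
    using fused_T_transp(2)[of 2 "- 1"] by simp
  finally show ?thesis unfolding mat_mult_mat w_Y_def .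
qed

section \<open>Matrices over a subalgebra and under algebra maps\<close>

definition mat_in :: "'a set \<Rightarrow> 'a fps^'n^'m \<Rightarrow> bool"
  where "mat_in A M \<longleftrightarrow> (\<forall>i j. coeffs_in A (M $ i $ j))"

lemma mat_inD: "mat_in A M \<Longrightarrow> coeffs_in A (M $ i $ j)"
  by (simp add: mat_in_def)

lemma mat_in_UNIV [simp]: "mat_in UNIV M"
  by (simp add: mat_in_def)

context
  fixes A :: "'a::complex_algebra_1 set"
  assumes A: "subalgebra A"
begin

lemma mat_in_mult: "mat_in A M \<Longrightarrow> mat_in A N \<Longrightarrow> mat_in A (M ** N)"
  by (auto simp: mat_in_def matrix_mult_nth intro!: coeffs_in_sum[OF A] coeffs_in_mult[OF A])

lemma mat_in_scalar: "mat_in A (scalar_mat C)"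
  by (simp add: mat_in_def scalar_mat_nth coeffs_in_cfps[OF A])

lemma mat_in_subst: "mat_in A M \<Longrightarrow> mat_in A (map_mat (subst a b) M)"
  by (simp add: mat_in_def coeffs_in_subst[OF A])

lemma mat_in_tens: "mat_in A M \<Longrightarrow> mat_in A (tens1 M)" "mat_in A M \<Longrightarrow> mat_in A (tens2 M)"
  by (auto simp: mat_in_def tens1_nth tens2_nth intro!: coeffs_in_mult[OF A] coeffs_in_of_bool[OF A] coeffs_in_0[OF A])

lemmas mat_in_scalars = mat_in_scalar[of sym_proj, folded sym_proj_scalar]
  mat_in_scalar[of sym_incl, folded sym_incl_scalar] mat_in_scalar[of proj_V, folded proj_V_scalar]
  mat_in_scalar[of "R2_transp s r" for s r, folded R2_transp_scalar] mat_in_scalar[of "K_power s" for s, folded K_power_scalar]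

lemma mat_in_compress: "mat_in A M \<Longrightarrow> mat_in A (compress M)"
  unfolding compress_conv by (intro mat_in_mult mat_in_scalars)

lemma mat_in_fused_S: "mat_in A M \<Longrightarrow> mat_in A (fused_S s M)"
  unfolding fused_S_def by (intro mat_in_compress mat_in_mult mat_in_scalars mat_in_tens mat_in_subst)

end

context algebra_hom_on
begin

lemma map_mult:
  "mat_in A M \<Longrightarrow> mat_in A N \<Longrightarrow> map_mat (fps_map h) (M ** N) = map_mat (fps_map h) M ** map_mat (fps_map h) N"
  by (simp add: mat_in_def vec_eq_iff matrix_mult_nth fps_map_sum fps_map_mult coeffs_in_mult[OF A])

lemma map_scalar: "map_mat (fps_map h) (scalar_mat C) = scalar_mat C"
  by (simp add: vec_eq_iff scalar_mat_nth fps_map_cfps)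

lemmas map_scalars = map_scalar[of sym_proj, folded sym_proj_scalar]
  map_scalar[of sym_incl, folded sym_incl_scalar] map_scalar[of proj_V, folded proj_V_scalar]
  map_scalar[of "R2_transp s r" for s r, folded R2_transp_scalar] map_scalar[of "K_power s" for s, folded K_power_scalar]

lemma map_subst: "mat_in A M \<Longrightarrow> map_mat (fps_map h) (map_mat (subst a b) M) = map_mat (subst a b) (map_mat (fps_map h) M)"
  by (simp add: mat_in_def vec_eq_iff fps_map_subst)

lemma map_tens:
  assumes "mat_in A M"
  shows "map_mat (fps_map h) (tens1 M) = tens1 (map_mat (fps_map h) M)"
    and "map_mat (fps_map h) (tens2 M) = tens2 (map_mat (fps_map h) M)"
proof -
  have b: "fps_map h (of_bool P) = of_bool P" for P
    by (cases P) (simp_all add: fps_map_0 fps_map_1)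
  show "map_mat (fps_map h) (tens1 M) = tens1 (map_mat (fps_map h) M)"
    "map_mat (fps_map h) (tens2 M) = tens2 (map_mat (fps_map h) M)"
    using assms
    by (simp_all add: vec_eq_iff tens1_nth tens2_nth mat_in_def fps_map_mult coeffs_in_of_bool[OF A] b)
qed

lemma map_compress: "mat_in A M \<Longrightarrow> map_mat (fps_map h) (compress M) = compress (map_mat (fps_map h) M)"
  by (simp add: compress_conv map_mult map_scalars mat_in_mult[OF A] mat_in_scalars[OF A])

lemma map_fused_S: "mat_in A M \<Longrightarrow> map_mat (fps_map h) (fused_S s M) = fused_S s (map_mat (fps_map h) M)"
  by (simp add: fused_S_def map_compress map_mult map_scalars map_tens map_subst
      mat_in_mult[OF A] mat_in_scalars[OF A] mat_in_tens[OF A] mat_in_subst[OF A])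

end

section \<open>Recovering a matrix from its fusion\<close>

text \<open>Congruence modulo u^(-n): nonlinear expressions in two such series differ in degree n by
  a linear expression in the difference of the n-th coefficients, the basis of the recursions
  below.\<close>

definition agree_below :: "nat \<Rightarrow> 'a fps \<Rightarrow> 'a fps \<Rightarrow> bool"
  where "agree_below n f g \<longleftrightarrow> (\<forall>k<n. fps_nth f k = fps_nth g k)"

lemma agree_belowD: "agree_below n f g \<Longrightarrow> k < n \<Longrightarrow> fps_nth f k = fps_nth g k"
  by (simp add: agree_below_def)

lemma subst_agree_below:
  assumes a: "a \<noteq> 0" and fg: "agree_below n f g"
  shows "agree_below n (subst a b f) (subst a b g)"
    and "fps_nth (subst a b f) n - fps_nth (subst a b g) n = (1 / a) ^ n *\<^sub>C (fps_nth f n - fps_nth g n)"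
proof -
  have "(\<Sum>r\<in>{..n} - {n}. fps_nth (inv_lin a b ^ r) n *\<^sub>C fps_nth f r)
      = (\<Sum>r\<in>{..n} - {n}. fps_nth (inv_lin a b ^ r) n *\<^sub>C fps_nth g r)"
    using fg by (intro sum.cong refl) (auto simp: agree_below_def)
  then show "fps_nth (subst a b f) n - fps_nth (subst a b g) n = (1 / a) ^ n *\<^sub>C (fps_nth f n - fps_nth g n)"
    using a
    by (simp add: subst_def sum.remove[of "{..n}" n] inv_lin_power_nth_same scaleC_diff_right)
  show "agree_below n (subst a b f) (subst a b g)"
    using fg by (auto simp: agree_below_def subst_def intro!: sum.cong)
qed

text \<open>In degree n only the two extreme terms of the product involve n-th coefficients; n > 0
  makes them distinct and the zeroth coefficients equal.\<close>

lemma mult_agree_below: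
  fixes f g :: "'a::ring_1 fps"
  assumes n: "n > 0" and ff': "agree_below n f f'" and gg': "agree_below n g g'"
  shows "agree_below n (f * g) (f' * g')"
    and "fps_nth (f * g) n - fps_nth (f' * g') n
      = (fps_nth f n - fps_nth f' n) * fps_nth g 0 + fps_nth f 0 * (fps_nth g n - fps_nth g' n)"
proof -
  have split: "(\<Sum>i=0..n. F i) = F 0 + F n + (\<Sum>i=1..<n. F i)" for F :: "nat \<Rightarrow> 'a"
    unfolding atLeastLessThanSuc_atLeastAtMost[symmetric]
    using n by (simp add: sum.atLeast_Suc_lessThan[of 0 n] add_ac)
  have "(\<Sum>i=1..<n. fps_nth f i * fps_nth g (n - i)) = (\<Sum>i=1..<n. fps_nth f' i * fps_nth g' (n - i))"
    using ff' gg' by (intro sum.cong refl) (auto simp: agree_below_def)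
  then show "fps_nth (f * g) n - fps_nth (f' * g') n
      = (fps_nth f n - fps_nth f' n) * fps_nth g 0 + fps_nth f 0 * (fps_nth g n - fps_nth g' n)"
    using agree_belowD[OF ff' n] agree_belowD[OF gg' n]
    by (simp add: fps_mult_nth split algebra_simps)
  show "agree_below n (f * g) (f' * g')"
    using ff' gg' by (auto simp: agree_below_def fps_mult_nth intro!: sum.cong)
qed

lemma cfps_mult_agree_below:
  assumes n: "n > 0" and "agree_below n f f'"
  shows "fps_nth (cfps r * f) n - fps_nth (cfps r * f') n = fps_nth r 0 *\<^sub>C (fps_nth f n - fps_nth f' n)"
  using mult_agree_below(2)[OF n _ assms(2), of "cfps r" "cfps r"]
  by (simp add: agree_below_def cfps_nth mult_scaleC_left)

definition truncate :: "nat \<Rightarrow> 'a::zero fps \<Rightarrow> 'a fps"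
  where "truncate n f = Abs_fps (\<lambda>k. if k < n then fps_nth f k else 0)"

lemma truncate_nth: "fps_nth (truncate n f) k = (if k < n then fps_nth f k else 0)"
  by (simp add: truncate_def)

lemma agree_below_truncate: "agree_below n f (truncate n f)"
  by (simp add: agree_below_def truncate_nth)

definition shifted_square :: "'a::complex_algebra_1 fps \<Rightarrow> 'a fps"
  where "shifted_square f = subst 2 (- 1) f * subst 2 0 f"

text \<open>Each factor contributes 2^(-n) times the difference. The resulting factor is nonzero,
  whence the injectivity and surjectivity that follow.\<close>

lemma shifted_square_agree_below:
  assumes n: "n > 0" and fg: "agree_below n f g" and f0: "fps_nth f 0 = 1"
  shows "fps_nth (shifted_square f) n - fps_nth (shifted_square g) n
    = (2 * (1 / 2) ^ n) *\<^sub>C (fps_nth f n - fps_nth g n)"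
proof -
  have "fps_nth (shifted_square f) n - fps_nth (shifted_square g) n
      = (1 / 2) ^ n *\<^sub>C (fps_nth f n - fps_nth g n) + (1 / 2) ^ n *\<^sub>C (fps_nth f n - fps_nth g n)"
    unfolding shifted_square_def
    using mult_agree_below(2)[OF n subst_agree_below(1)[OF _ fg, of 2 "- 1"] subst_agree_below(1)[OF _ fg, of 2 0]]
      subst_agree_below(2)[OF _ fg, of 2]
    by (simp add: subst_nth_0 f0)
  then show ?thesis by (simp flip: scaleC_add_left)
qed

lemma shifted_square_inj:
  assumes eq: "shifted_square f = shifted_square g" and "fps_nth f 0 = 1" "fps_nth g 0 = 1"
  shows "f = g"
proof (rule fps_ext)
  fix n show "fps_nth f n = fps_nth g n"
  proof (induction n rule: less_induct)
    case (less n)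
    show ?case
    proof (cases "n = 0")
      case False
      have "agree_below n f g" using less by (simp add: agree_below_def)
      from shifted_square_agree_below[OF _ this assms(2)] False
      have "(2 * (1 / 2) ^ n) *\<^sub>C (fps_nth f n - fps_nth g n) = (2 * (1 / 2) ^ n) *\<^sub>C 0"
        by (simp add: eq)
      then have "fps_nth f n - fps_nth g n = 0"
        by (subst (asm) scaleC_cancel) simp_all
      then show ?thesis by simp
    qed (simp add: assms)
  qed
qed

lemma shifted_square_surj:
  fixes G :: "complex fps"
  assumes "fps_nth G 0 = 1"
  obtains f where "fps_nth f 0 = 1" "shifted_square f = G"
proof -
  \<comment> \<open>Coefficients of f below n, then r in degree n; the zeros above do not affect
    degree n.\<close>
  define ext where "ext = (\<lambda>n (f :: nat \<Rightarrow> complex) r. Abs_fps (\<lambda>k. if k < n then f k else if k = n then r else 0))"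
  \<comment> \<open>The choice principle asks for a value after any initial segment, so the equation
    is imposed only after segments that begin with 1.\<close>
  define P where "P = (\<lambda>f n r. (n = 0 \<longrightarrow> r = 1) \<and>
    (n > 0 \<longrightarrow> f 0 = (1 :: complex) \<longrightarrow> fps_nth (shifted_square (ext n f r)) n = fps_nth G n))"
  have "\<exists>f. \<forall>n. P f n (f n)"
  proof (rule dependent_wf_choice[OF wf_less_than])
    fix f g :: "nat \<Rightarrow> complex" and n :: nat and r
    assume fg: "\<And>z. (z, n) \<in> less_than \<Longrightarrow> f z = g z"
    then have "ext n f r = ext n g r" by (auto simp: ext_def fps_eq_iff)
    then show "P f n r = P g n r" using fg[of 0] by (cases "n = 0") (auto simp: P_def)
  next
    fix n and f :: "nat \<Rightarrow> complex"
    show "\<exists>r. P f n r"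
    proof (cases "n > 0 \<and> f 0 = 1")
      case True
      \<comment> \<open>Solves the linear equation for the n-th coefficient, starting from the value
        at r = 0.\<close>
      define r where "r = (fps_nth G n - fps_nth (shifted_square (ext n f 0)) n) / (2 * (1 / 2) ^ n)"
      have "agree_below n (ext n f r) (ext n f 0)" "fps_nth (ext n f r) 0 = 1"
        using True by (auto simp: agree_below_def ext_def)
      from shifted_square_agree_below[OF _ this] True
      have "fps_nth (shifted_square (ext n f r)) n - fps_nth (shifted_square (ext n f 0)) n = (2 * (1 / 2) ^ n) * r"
        by (simp add: scaleC_complex_def ext_def)
      then have "fps_nth (shifted_square (ext n f r)) n = fps_nth G n"
        by (simp add: r_def)
      then show ?thesis using True by (auto simp: P_def)
    next
      case False
      then show ?thesis by (auto simp: P_def)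
    qed
  qed
  then obtain f where f: "\<And>n. P f n (f n)" by blast
  have f0: "f 0 = 1" using f[of 0] by (simp add: P_def)
  have "fps_nth (shifted_square (Abs_fps f)) n = fps_nth G n" for n
  proof (cases "n = 0")
    case True
    then show ?thesis using assms by (simp add: shifted_square_def subst_nth_0 f0)
  next
    case False
    have "agree_below n (Abs_fps f) (ext n f (f n))" "fps_nth (Abs_fps f) 0 = 1"
      using f0 by (auto simp: agree_below_def ext_def)
    from shifted_square_agree_below[OF _ this] False
    have "fps_nth (shifted_square (Abs_fps f)) n = fps_nth (shifted_square (ext n f (f n))) n"
      by (simp add: ext_def)
    then show ?thesis using f[of n] False f0 by (simp add: P_def)
  qed
  then show ?thesis using f0 by (intro that[of "Abs_fps f"]) (simp_all add: fps_eq_iff)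
qed

section \<open>Leading differences of fused matrices\<close>

definition unital_mat :: "'a::ring_1 fps^'n^'n \<Rightarrow> bool"
  where "unital_mat S \<longleftrightarrow> (\<forall>i j. fps_nth (S $ i $ j) 0 = of_bool (i = j))"

lemma unital_matD: "unital_mat S \<Longrightarrow> fps_nth (S $ i $ j) 0 = of_bool (i = j)"
  by (simp add: unital_mat_def)

definition sign_K :: "pm \<Rightarrow> ix2 \<times> ix2 \<Rightarrow> complex"
  where "sign_K s p = (case s of Minus \<Rightarrow> 1 | Plus \<Rightarrow> sign2 (fst p) * sign2 (snd p))"

lemma fused_S_nth:
  fixes S :: "'a::complex_algebra_1 fps^ix2^ix2"
  defines "A \<equiv> map_mat (subst 2 (- 1)) S" and "B \<equiv> map_mat (subst 2 0) S"
  shows "fused_S s S $ i $ j = (\<Sum>p\<in>UNIV. \<Sum>q\<in>UNIV.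
    cfps (fps_const (vbasis i $ p * vbasis j $ q * sign_K s q))
      * (A $ fst p $ fst q * B $ snd p $ snd q
         - cfps (inv_lin (- 4) 1) * (tsign s (- snd p) (fst q) * (A $ fst p $ (- snd p) * B $ (- fst q) $ snd q))))"
proof -
  define M where "M = tens1 A ** (cfps 1 *\<^sub>m mat 1 - cfps (inv_lin (- 4) 1) *\<^sub>m Qmat2 s) ** tens2 B"
  have k: "(case s of Minus \<Rightarrow> (1 :: 'a fps) | Plus \<Rightarrow> sign2 (fst q) * sign2 (snd q)) = cfps (fps_const (sign_K s q))"
    for q :: "ix2 \<times> ix2"
    by (cases s; cases q; rename_tac k l, case_tac k; case_tac l) (simp_all add: sign_K_def cfps_minus flip: fps_const_neg)
  have K_power: "(M ** K_power s) $ p $ q = cfps (fps_const (sign_K s q)) * M $ p $ q" for p q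
  proof -
    have "(M ** K_power s) $ p $ q = (\<Sum>r\<in>UNIV. if r = q then M $ p $ r * cfps (fps_const (sign_K s r)) else 0)"
      unfolding matrix_mult_nth[of M] by (intro sum.cong refl) (simp add: K_power_nth k)
    then show ?thesis by simp (rule cfps_commute[symmetric])
  qed
  have "fused_S s S = compress (M ** K_power s)"
    unfolding fused_S_def M_def A_def B_def R2_transp_def
    by (simp add: compress_proj_V_left mscale_def map_mat_def flip: matrix_mul_assoc)
  then have "fused_S s S $ i $ j = (\<Sum>p\<in>UNIV. \<Sum>q\<in>UNIV.
      cfps (fps_const (vbasis i $ p * vbasis j $ q)) * (cfps (fps_const (sign_K s q)) * M $ p $ q))"
    by (simp add: compress_def K_power del: vbasis.simps)
  also have "\<dots> = (\<Sum>p\<in>UNIV. \<Sum>q\<in>UNIV. cfps (fps_const (vbasis i $ p * vbasis j $ q * sign_K s q)) * M $ p $ q)"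
    by (simp only: cfps_const_mult mult.assoc[symmetric])
  finally have F: "fused_S s S $ i $ j = (\<Sum>p\<in>UNIV. \<Sum>q\<in>UNIV. cfps (fps_const (vbasis i $ p * vbasis j $ q * sign_K s q)) * M $ p $ q)" .
  have "M $ p $ q = A $ fst p $ fst q * B $ snd p $ snd q
         - cfps (inv_lin (- 4) 1) * (tsign s (- snd p) (fst q) * (A $ fst p $ (- snd p) * B $ (- fst q) $ snd q))" for p q
    using tens1_scalar_tens2[of A 1 "inv_lin (- 4) 1" s B "fst p" "snd p" "fst q" "snd q"] by (simp add: M_def)
  then show ?thesis unfolding F by (simp del: vbasis.simps)
qed

text \<open>The Q-term carries the factor 1/(1-4u), without constant term, so in degree n it sees
  only lower coefficients. What remains is \<Delta> \<otimes> 1 + 1 \<otimes> \<Delta>, scaled by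
  2^(-n) because of the arguments 2u-1 and 2u, and the sign from K_1 K_2.\<close>

lemma fused_S_agree_below:
  fixes S S' :: "'a::complex_algebra_1 fps^ix2^ix2"
  assumes n: "n > 0" and S: "\<And>i j. agree_below n (S $ i $ j) (S' $ i $ j)" and S0: "unital_mat S"
  defines "\<Delta> \<equiv> \<lambda>i j. fps_nth (S $ i $ j) n - fps_nth (S' $ i $ j) n"
  shows "fps_nth (fused_S s S $ i $ j) n - fps_nth (fused_S s S' $ i $ j) n
    = (\<Sum>p\<in>UNIV. \<Sum>q\<in>UNIV. (vbasis i $ p * vbasis j $ q * sign_K s q * (1 / 2) ^ n) *\<^sub>C
        (\<Delta> (fst p) (fst q) * of_bool (snd p = snd q) + of_bool (fst p = fst q) * \<Delta> (snd p) (snd q)))"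
proof -
  let ?A = "\<lambda>i j. subst 2 (- 1) (S $ i $ j)" and ?B = "\<lambda>i j. subst 2 0 (S $ i $ j)"
  let ?A' = "\<lambda>i j. subst 2 (- 1) (S' $ i $ j)" and ?B' = "\<lambda>i j. subst 2 0 (S' $ i $ j)"
  let ?r = "inv_lin (- 4) 1"
  have A: "agree_below n (?A i j) (?A' i j)" and B: "agree_below n (?B i j) (?B' i j)"
    and dA: "fps_nth (?A i j) n - fps_nth (?A' i j) n = (1 / 2) ^ n *\<^sub>C \<Delta> i j"
    and dB: "fps_nth (?B i j) n - fps_nth (?B' i j) n = (1 / 2) ^ n *\<^sub>C \<Delta> i j" for i j
    using subst_agree_below[OF _ S, of 2] unfolding \<Delta>_def by simp_all
  have AB: "agree_below n (?A i j * ?B k l) (?A' i j * ?B' k l)"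
    and dAB: "fps_nth (?A i j * ?B k l) n - fps_nth (?A' i j * ?B' k l) n
      = (1 / 2) ^ n *\<^sub>C (\<Delta> i j * of_bool (k = l) + of_bool (i = j) * \<Delta> k l)" for i j k l
    using mult_agree_below[OF n A B, of i j k l]
    by (simp_all add: dA dB subst_nth_0 unital_matD[OF S0] scaleC_add_right mult_scaleC_left mult_scaleC_right)
  have ABr: "fps_nth (cfps ?r * (tsign s i j * (?A k l * ?B k' l'))) n
      = fps_nth (cfps ?r * (tsign s i j * (?A' k l * ?B' k' l'))) n" for i j k l k' l'
    using cfps_mult_agree_below[OF n AB, of ?r k l k' l'] inv_lin_nth_0[of "- 4" 1]
    by (cases s; cases i; cases j) (simp_all add: tsign_def)
  have d: "fps_nth (cfps (fps_const c) * (X - Y)) n - fps_nth (cfps (fps_const c) * (X' - Y')) n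
      = c *\<^sub>C (fps_nth X n - fps_nth X' n)" if "fps_nth Y n = fps_nth Y' n"
    for c and X Y X' Y' :: "'a fps"
  proof -
    have c: "fps_nth (cfps (fps_const c) * Z) n = c *\<^sub>C fps_nth Z n" for Z :: "'a fps"
      by (subst cfps_mult_nth, subst sum.remove[of _ 0]) (auto intro!: sum.neutral)
    show ?thesis unfolding c using that by (simp add: scaleC_diff_right)
  qed
  show ?thesis
    unfolding fused_S_nth fps_sum_nth sum_subtractf[symmetric] map_mat_nth d[OF ABr] dAB scaleC_scaleC
    by simp
qed

text \<open>Each entry of \<Delta> occurs alone, up to a nonzero factor, in some entry of the action
  of \<Delta> \<otimes> 1 + 1 \<otimes> \<Delta> on the symmetric square.\<close>

lemma fused_S_separates:
  obtains i j c where "c \<noteq> 0"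
    "\<And>S S' :: 'a::complex_algebra_1 fps^ix2^ix2. (\<And>i j. agree_below n (S $ i $ j) (S' $ i $ j)) \<Longrightarrow> unital_mat S \<Longrightarrow> n > 0 \<Longrightarrow>
      fps_nth (fused_S s S $ i $ j) n - fps_nth (fused_S s S' $ i $ j) n
        = c *\<^sub>C (fps_nth (S $ k $ l) n - fps_nth (S' $ k $ l) n)"
proof -
  define r2 where "r2 = complex_of_real (1 / sqrt 2)"
  have r2: "r2 \<noteq> 0" by (simp add: r2_def)
  \<comment> \<open>Diagonal entries are read off at v_(-1) and v_1, off-diagonal ones between
    v_(-1) and v_0. The latter give the factor 1/sqrt(2) and, for t_+ with v_0 as source, the sign
    of K_1 K_2.\<close>
  define i where "i = (case (k, l) of (Neg2, _) \<Rightarrow> Neg3 | (Pos2, Neg2) \<Rightarrow> Zero3 | (Pos2, Pos2) \<Rightarrow> Pos3)"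
  define j where "j = (case (k, l) of (_, Neg2) \<Rightarrow> Neg3 | (Neg2, Pos2) \<Rightarrow> Zero3 | (Pos2, Pos2) \<Rightarrow> Pos3)"
  define c where "c = (case (k, l) of (Neg2, Pos2) \<Rightarrow> (case s of Plus \<Rightarrow> - r2 | Minus \<Rightarrow> r2) | (Pos2, Neg2) \<Rightarrow> r2 | _ \<Rightarrow> 1)
      * (1 / 2) ^ n * 2"
  have two: "c *\<^sub>C x + c *\<^sub>C x = (c * 2) *\<^sub>C x" for c and x :: 'a
    by (metis mult_2_right scaleC_add_left)
  have two': "c *\<^sub>C (x + x) = (c * 2) *\<^sub>C x" for c and x :: 'a
    by (simp add: scaleC_add_right two)
  have two'': "- (c *\<^sub>C x) - c *\<^sub>C x = - ((c * 2) *\<^sub>C x)" for c and x :: 'a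
    by (simp flip: two)
  show ?thesis
  proof (rule that[of c i j])
    show "c \<noteq> 0" by (cases k; cases l; cases s) (simp_all add: c_def r2)
    fix S S' :: "'a fps^ix2^ix2"
    assume S: "\<And>i j. agree_below n (S $ i $ j) (S' $ i $ j)" "unital_mat S" "n > 0"
    show "fps_nth (fused_S s S $ i $ j) n - fps_nth (fused_S s S' $ i $ j) n
        = c *\<^sub>C (fps_nth (S $ k $ l) n - fps_nth (S' $ k $ l) n)"
      unfolding fused_S_agree_below[OF S(3,1,2)]
      by (cases k; cases l; cases s)
         (simp_all add: i_def j_def c_def vbasis_nth sum_ix2_pair sign_K_def two two' two'' scaleC_minus_left
           del: vbasis.simps of_real_divide flip: r2_def)
  qed
qed

lemma fused_S_inj:
  fixes S S' :: "'a::complex_algebra_1 fps^ix2^ix2"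
  assumes eq: "fused_S s S = fused_S s S'" and S: "unital_mat S" "unital_mat S'"
  shows "S = S'"
proof -
  have "\<forall>k l. fps_nth (S $ k $ l) n = fps_nth (S' $ k $ l) n" for n
  proof (induction n rule: less_induct)
    case (less n)
    show ?case
    proof (cases "n = 0")
      case True
      then show ?thesis using S by (simp add: unital_matD)
    next
      case False
      have ag: "agree_below n (S $ i $ j) (S' $ i $ j)" for i j
        using less by (simp add: agree_below_def)
      show ?thesis
      proof (intro allI)
        fix k l
        obtain i j c where c: "c \<noteq> 0" and
          "fps_nth (fused_S s S $ i $ j) n - fps_nth (fused_S s S' $ i $ j) n
            = c *\<^sub>C (fps_nth (S $ k $ l) n - fps_nth (S' $ k $ l) n)"
          using fused_S_separates[of n s k l] ag S(1) False by (metis gr0I)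
        then have "c *\<^sub>C (fps_nth (S $ k $ l) n - fps_nth (S' $ k $ l) n) = c *\<^sub>C 0"
          by (simp add: eq)
        then show "fps_nth (S $ k $ l) n = fps_nth (S' $ k $ l) n"
          by (subst (asm) scaleC_cancel[OF c]) simp
      qed
    qed
  qed
  then show ?thesis by (simp add: vec_eq_iff fps_eq_iff)
qed

text \<open>Truncating S below degree n gives, by induction, a matrix over A, whose fusion is over A
  as well. Up to nonzero scalars the n-th coefficients of S are differences of coefficients of the
  two fusions.\<close>

lemma mat_in_fused_S_imp:
  assumes A: "subalgebra A" and F: "mat_in A (fused_S s S)" and S: "unital_mat S"
  shows "mat_in A S"
proof -
  have "\<forall>k l. fps_nth (S $ k $ l) n \<in> A" for n
  proof (induction n rule: less_induct)
    case (less n)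
    show ?case
    proof (cases "n = 0")
      case True
      then show ?thesis using S subalgebraD[OF A] by (simp add: unital_matD)
    next
      case False
      define S' where "S' = map_mat (truncate n) S"
      have "mat_in A S'"
        using less subalgebraD[OF A] by (auto simp: mat_in_def coeffs_in_def S'_def truncate_nth)
      then have F': "mat_in A (fused_S s S')" by (rule mat_in_fused_S[OF A])
      have ag: "agree_below n (S $ i $ j) (S' $ i $ j)" for i j
        by (simp add: S'_def agree_below_truncate)
      show ?thesis
      proof (intro allI)
        fix k l
        obtain i j c where c: "c \<noteq> 0" and
          "fps_nth (fused_S s S $ i $ j) n - fps_nth (fused_S s S' $ i $ j) n
            = c *\<^sub>C (fps_nth (S $ k $ l) n - fps_nth (S' $ k $ l) n)"
          using fused_S_separates[of n s k l] ag S False by (metis gr0I)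
        then have "c *\<^sub>C fps_nth (S $ k $ l) n \<in> A"
          using F F' subalgebraD(7)[OF A]
          by (simp add: S'_def truncate_nth mat_in_def coeffs_in_def) (metis (no_types, lifting))
        then have "(1 / c) *\<^sub>C c *\<^sub>C fps_nth (S $ k $ l) n \<in> A"
          by (rule subalgebraD(4)[OF A])
        then show "fps_nth (S $ k $ l) n \<in> A"
          using c by (simp add: scaleC_scaleC scaleC_one)
      qed
    qed
  qed
  then show ?thesis by (simp add: mat_in_def coeffs_in_def)
qed

section \<open>Quotients and generation\<close>

lemma alg_of_simps [simp]:
  "carrier (alg_of A) = A" "x \<otimes>\<^bsub>alg_of A\<^esub> y = x * y" "\<one>\<^bsub>alg_of A\<^esub> = 1" "\<zero>\<^bsub>alg_of A\<^esub> = 0"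
  "x \<oplus>\<^bsub>alg_of A\<^esub> y = x + y" "c \<odot>\<^bsub>alg_of A\<^esub> x = c *\<^sub>C x"
  by (simp_all add: alg_of_def)

lemma alg_iso_alg_of_iff:
  "h \<in> alg_iso (alg_of A) (alg_of B) \<longleftrightarrow>
    bij_betw h A B \<and> h 1 = 1 \<and> (\<forall>x\<in>A. \<forall>y\<in>A. h (x * y) = h x * h y \<and> h (x + y) = h x + h y)
    \<and> (\<forall>c. \<forall>x\<in>A. h (c *\<^sub>C x) = c *\<^sub>C h x)"
  by (auto simp: alg_iso_def ring_iso_def ring_hom_def bij_betw_def)

lemma algebra_hom_onI:
  assumes "subalgebra A" "h \<in> alg_iso (alg_of A) (alg_of B)"
  shows "algebra_hom_on A h"
  using assms by (unfold_locales) (auto simp: alg_iso_alg_of_iff)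

lemma ring_alg_of:
  assumes A: "subalgebra A"
  shows "Ring.ring (alg_of A)"
proof (rule ringI)
  show "abelian_group (alg_of A)"
    by (rule abelian_groupI) (auto simp: subalgebraD[OF A] add.assoc add.commute intro!: bexI[of _ "- x" for x])
  show "Group.monoid (alg_of A)"
    by (rule monoidI) (auto simp: subalgebraD[OF A] mult.assoc)
qed (auto simp: distrib_left distrib_right)

lemma ideal_alg_of_iff:
  assumes A: "subalgebra A"
  shows "ideal I (alg_of A) \<longleftrightarrow> I \<subseteq> A \<and> 0 \<in> I \<and> (\<forall>x\<in>I. \<forall>y\<in>I. x + y \<in> I) \<and> (\<forall>x\<in>I. \<forall>a\<in>A. a * x \<in> I \<and> x * a \<in> I)"
    (is "?L \<longleftrightarrow> ?R")
proof
  assume ?L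
  then interpret ideal I "alg_of A" .
  show ?R
    using additive_subgroup.zero_closed[OF is_additive_subgroup] a_subset
      additive_subgroup.a_closed[OF is_additive_subgroup] I_l_closed I_r_closed
    by auto
next
  assume R: ?R
  interpret Ring.ring "alg_of A" by (rule ring_alg_of[OF A])
  have neg: "a_inv (alg_of A) x = - x" if "x \<in> A" for x
    using that by (intro minus_equality) (auto simp: subalgebraD[OF A])
  have "- x \<in> I" if "x \<in> I" for x
    using R that subalgebraD(6)[OF A subalgebraD(1)[OF A]] by (metis mult_minus1)
  with R neg[unfolded a_inv_def, simplified] show ?L
    by (intro idealI ring_alg_of A Group.subgroup.intro) (auto simp: subset_iff)
qed

lemma genideal_cong:
  assumes "\<And>I. ideal I R \<Longrightarrow> S \<subseteq> I \<longleftrightarrow> S' \<subseteq> I"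
  shows "genideal R S = genideal R S'"
  unfolding genideal_def using assms by (intro arg_cong[of _ _ Inter]) blast

text \<open>Both inclusions come from minimality: preimages of ideals are ideals, and so are images,
  as h is onto B.\<close>

lemma image_genideal:
  assumes A: "subalgebra A" and B: "subalgebra B" and h: "h \<in> alg_iso (alg_of A) (alg_of B)" and S: "S \<subseteq> A"
  shows "h ` genideal (alg_of A) S = genideal (alg_of B) (h ` S)"
proof
  interpret h: algebra_hom_on A h by (rule algebra_hom_onI[OF A h])
  interpret RA: Ring.ring "alg_of A" by (rule ring_alg_of[OF A])
  interpret RB: Ring.ring "alg_of B" by (rule ring_alg_of[OF B])
  have bij: "bij_betw h A B" using h by (simp add: alg_iso_alg_of_iff)
  then have hS: "h ` S \<subseteq> B" using S by (auto simp: bij_betw_def)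
  have IA: "ideal (genideal (alg_of A) S) (alg_of A)" by (rule RA.genideal_ideal) (simp add: S)
  have IB: "ideal (genideal (alg_of B) (h ` S)) (alg_of B)" by (rule RB.genideal_ideal) (simp add: hS)
  note IA' = IA[unfolded ideal_alg_of_iff[OF A]] and IB' = IB[unfolded ideal_alg_of_iff[OF B]]
  have "ideal {x \<in> A. h x \<in> genideal (alg_of B) (h ` S)} (alg_of A)"
    unfolding ideal_alg_of_iff[OF A] using IB' bij
    by (auto simp: subalgebraD[OF A] h.add h.mult h.zero bij_betw_def)
  then have "genideal (alg_of A) S \<subseteq> {x \<in> A. h x \<in> genideal (alg_of B) (h ` S)}"
    by (rule RA.genideal_minimal) (use S RB.genideal_self[of "h ` S"] hS in auto)
  then show "h ` genideal (alg_of A) S \<subseteq> genideal (alg_of B) (h ` S)" by auto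
  have "ideal (h ` genideal (alg_of A) S) (alg_of B)"
    unfolding ideal_alg_of_iff[OF B]
  proof (intro conjI ballI)
    show "h ` genideal (alg_of A) S \<subseteq> B" using IA' bij by (auto simp: bij_betw_def)
    show "0 \<in> h ` genideal (alg_of A) S" using IA' h.zero by (metis imageI)
  next
    fix x y assume "x \<in> h ` genideal (alg_of A) S" "y \<in> h ` genideal (alg_of A) S"
    then obtain x' y' where "x = h x'" "y = h y'" "x' \<in> genideal (alg_of A) S" "y' \<in> genideal (alg_of A) S" by auto
    moreover from this have "x' \<in> A" "y' \<in> A" using IA' by auto
    ultimately show "x + y \<in> h ` genideal (alg_of A) S"
      using IA' h.add[of x' y'] by (intro image_eqI[of _ _ "x' + y'"]) auto
  next
    fix x b assume "x \<in> h ` genideal (alg_of A) S" "b \<in> B"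
    then obtain x' a where x: "x = h x'" "b = h a" "x' \<in> genideal (alg_of A) S" "a \<in> A"
      using bij by (auto simp: bij_betw_def)
    then have "x' \<in> A" using IA' by auto
    with x show "b * x \<in> h ` genideal (alg_of A) S" "x * b \<in> h ` genideal (alg_of A) S"
      using IA' h.mult[of a x'] h.mult[of x' a]
      by (auto intro: image_eqI[of _ _ "a * x'"] image_eqI[of _ _ "x' * a"])
  qed
  then show "genideal (alg_of B) (h ` S) \<subseteq> h ` genideal (alg_of A) S"
    by (rule RB.genideal_minimal) (use S RA.genideal_self[of S] in auto)
qed

lemma a_r_coset_alg_of: "I +>\<^bsub>alg_of A\<^esub> x = (\<lambda>i. i + x) ` I"
  by (auto simp: a_r_coset_def')

text \<open>The induced map is the direct image of cosets, which avoids choosing representatives; it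
  is injective because cosets are subsets of A.\<close>

lemma quot_alg_iso:
  assumes A: "subalgebra A" and B: "subalgebra B" and h: "h \<in> alg_iso (alg_of A) (alg_of B)"
    and I: "I \<subseteq> A" and J: "h ` I = J"
  shows "\<exists>\<phi> \<in> alg_iso (quot_alg (alg_of A) I) (quot_alg (alg_of B) J).
    \<forall>x\<in>A. \<phi> (I +>\<^bsub>alg_of A\<^esub> x) = J +>\<^bsub>alg_of B\<^esub> h x"
proof (intro bexI[of _ "(`) h"] ballI)
  interpret h: algebra_hom_on A h by (rule algebra_hom_onI[OF A h])
  have bij: "bij_betw h A B" using h by (simp add: alg_iso_alg_of_iff)
  have coset: "h ` (I +>\<^bsub>alg_of A\<^esub> x) = J +>\<^bsub>alg_of B\<^esub> h x" if "x \<in> A" for x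
    using that I J by (force simp: a_r_coset_alg_of h.add image_iff subset_iff)
  show "h ` (I +>\<^bsub>alg_of A\<^esub> x) = J +>\<^bsub>alg_of B\<^esub> h x" if "x \<in> A" for x
    using that by (rule coset)
  have carr: "carrier (quot_alg (alg_of A) I) = (\<lambda>x. I +>\<^bsub>alg_of A\<^esub> x) ` A" for A :: "'c::complex_algebra_1 set" and I
    by (auto simp: quot_alg_def FactRing_def A_RCOSETS_def')
  have sub: "C \<subseteq> A" if "C \<in> carrier (quot_alg (alg_of A) I)" for C
    using that I by (auto simp: carr a_r_coset_alg_of subalgebraD[OF A] subset_iff)
  show "(`) h \<in> alg_iso (quot_alg (alg_of A) I) (quot_alg (alg_of B) J)"
    unfolding alg_iso_def ring_iso_def mem_Collect_eq
  proof (intro conjI ballI allI)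
    have "(`) h ` ((\<lambda>x. I +>\<^bsub>alg_of A\<^esub> x) ` A) = (\<lambda>x. J +>\<^bsub>alg_of B\<^esub> x) ` (h ` A)"
      by (auto simp: coset image_image)
    then have im: "(`) h ` carrier (quot_alg (alg_of A) I) = carrier (quot_alg (alg_of B) J)"
      using bij by (simp add: carr bij_betw_def)
    have "inj_on ((`) h) (carrier (quot_alg (alg_of A) I))"
    proof (rule inj_onI)
      fix C D assume "C \<in> carrier (quot_alg (alg_of A) I)" "D \<in> carrier (quot_alg (alg_of A) I)" "h ` C = h ` D"
      then show "C = D" using sub bij by (metis bij_betw_def inj_on_image_eq_iff)
    qed
    then show "bij_betw ((`) h) (carrier (quot_alg (alg_of A) I)) (carrier (quot_alg (alg_of B) J))"
      using im by (simp add: bij_betw_def)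
    show "(`) h \<in> ring_hom (quot_alg (alg_of A) I) (quot_alg (alg_of B) J)"
    proof (rule ring_hom_memI)
      fix C assume "C \<in> carrier (quot_alg (alg_of A) I)"
      then show "h ` C \<in> carrier (quot_alg (alg_of B) J)" using im by blast
    next
      fix C D assume "C \<in> carrier (quot_alg (alg_of A) I)" "D \<in> carrier (quot_alg (alg_of A) I)"
      then have CD: "C \<subseteq> A" "D \<subseteq> A" by (simp_all add: sub)
      have "h ` (\<Union>a\<in>C. \<Union>b\<in>D. I +>\<^bsub>alg_of A\<^esub> (a * b)) = (\<Union>a\<in>C. \<Union>b\<in>D. J +>\<^bsub>alg_of B\<^esub> (h a * h b))"
        using CD by (simp add: image_UN coset subalgebraD[OF A] subset_iff h.mult)
      then show "h ` (C \<otimes>\<^bsub>quot_alg (alg_of A) I\<^esub> D) = h ` C \<otimes>\<^bsub>quot_alg (alg_of B) J\<^esub> h ` D"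
        by (simp add: quot_alg_def FactRing_def rcoset_mult_def)
      have "h ` (\<Union>a\<in>C. \<Union>b\<in>D. {a + b}) = (\<Union>a\<in>C. \<Union>b\<in>D. {h a + h b})"
        using CD by (simp add: image_UN subset_iff h.add)
      then show "h ` (C \<oplus>\<^bsub>quot_alg (alg_of A) I\<^esub> D) = h ` C \<oplus>\<^bsub>quot_alg (alg_of B) J\<^esub> h ` D"
        by (simp add: quot_alg_def FactRing_def set_add_def')
    next
      show "h ` \<one>\<^bsub>quot_alg (alg_of A) I\<^esub> = \<one>\<^bsub>quot_alg (alg_of B) J\<^esub>"
        using coset[OF subalgebraD(1)[OF A]] by (simp add: quot_alg_def FactRing_def h.one)
    qed
    fix c C assume "C \<in> carrier (quot_alg (alg_of A) I)"
    then have C: "C \<subseteq> A" by (rule sub)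
    then have "h ` (\<Union>x\<in>C. I +>\<^bsub>alg_of A\<^esub> (c *\<^sub>C x)) = (\<Union>x\<in>C. J +>\<^bsub>alg_of B\<^esub> (c *\<^sub>C h x))"
      by (simp add: image_UN coset subalgebraD[OF A] subset_iff h.scaleC)
    then show "h ` (c \<odot>\<^bsub>quot_alg (alg_of A) I\<^esub> C) = c \<odot>\<^bsub>quot_alg (alg_of B) J\<^esub> h ` C"
      by (simp add: quot_alg_def)
  qed
qed

lemma mat_in_iff_entry_coeffs: "mat_in A M \<longleftrightarrow> entry_coeffs M \<subseteq> A"
  by (auto simp: mat_in_def coeffs_in_def entry_coeffs_def)

lemma mat_in_subalg_gen: "mat_in (subalg_gen (entry_coeffs M)) M"
  unfolding mat_in_iff_entry_coeffs by (rule subalg_gen_superset)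

lemma entry_coeffs_map: "entry_coeffs (map_mat (fps_map h) M) = h ` entry_coeffs M"
  by (auto simp: entry_coeffs_def fps_map_nth)

lemma image_subalg_gen:
  assumes "algebra_hom_on UNIV h"
  shows "h ` subalg_gen G = subalg_gen (h ` G)"
proof
  interpret algebra_hom_on UNIV h by fact
  have "subalgebra {x. h x \<in> subalg_gen (h ` G)}"
    using subalgebraD[OF subalgebra_subalg_gen[of "h ` G"]]
    by (auto simp: subalgebra_def one add mult scaleC)
  then have "subalg_gen G \<subseteq> {x. h x \<in> subalg_gen (h ` G)}"
    by (intro subalg_gen_minimal) (use subalg_gen_superset[of "h ` G"] in blast)
  then show "h ` subalg_gen G \<subseteq> subalg_gen (h ` G)" by auto
  have "subalgebra (h ` subalg_gen G)"
    unfolding subalgebra_def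
  proof (intro conjI ballI allI)
    show "1 \<in> h ` subalg_gen G"
      using subalgebraD(1)[OF subalgebra_subalg_gen[of G]] one by (metis imageI)
  next
    fix x y assume "x \<in> h ` subalg_gen G" "y \<in> h ` subalg_gen G"
    then obtain x' y' where *: "x' \<in> subalg_gen G" "y' \<in> subalg_gen G" "x = h x'" "y = h y'" by blast
    then have "h (x' + y') \<in> h ` subalg_gen G" "h (x' * y') \<in> h ` subalg_gen G"
      by (intro imageI subalgebraD subalgebra_subalg_gen; simp)+
    with * show "x + y \<in> h ` subalg_gen G" "x * y \<in> h ` subalg_gen G"
      by (simp_all add: add mult)
  next
    fix c x assume "x \<in> h ` subalg_gen G"
    then obtain x' where *: "x' \<in> subalg_gen G" "x = h x'" by blast
    then have "h (c *\<^sub>C x') \<in> h ` subalg_gen G"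
      by (intro imageI subalgebraD subalgebra_subalg_gen)
    with * show "c *\<^sub>C x \<in> h ` subalg_gen G" by (simp add: scaleC)
  qed
  then show "subalg_gen (h ` G) \<subseteq> h ` subalg_gen G"
    by (rule subalg_gen_minimal[rotated]) (use subalg_gen_superset in auto)
qed

lemma unital_T_Y: "unital_mat T_Y"
proof -
  have "abs_rtt (of_bool b) = (of_bool b :: Y2)" for b
    by (cases b) (simp_all add: one_rtt_def zero_rtt_def)
  then show ?thesis
    by (simp add: unital_mat_def T_Y_def rtt_T_def fps_map_nth free_T_def)
qed

lemma unital_S_Y: "unital_mat (S_Y s)"
proof -
  have "fps_nth (S_Y s $ i $ j) 0 = of_bool (i = j)" for i j
    by (cases i; cases j; cases s)
       (simp_all add: S_Y_def matrix_mult_nth sum_ix2 transp2_nth tsign_def subst_nth_0 unital_matD[OF unital_T_Y])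
  then show ?thesis by (simp add: unital_mat_def)
qed

lemma entry_coeffs_fused_S_Y: "subalg_gen (entry_coeffs (fused_S s (S_Y s))) = Ytw2 s"
proof
  have sub: "subalgebra (Ytw2 s)" unfolding Ytw2_def by (rule subalgebra_subalg_gen)
  have "mat_in (Ytw2 s) (fused_S s (S_Y s))"
    by (intro mat_in_fused_S sub) (simp add: Ytw2_def mat_in_subalg_gen)
  then show "subalg_gen (entry_coeffs (fused_S s (S_Y s))) \<subseteq> Ytw2 s"
    unfolding mat_in_iff_entry_coeffs by (rule subalg_gen_minimal[OF _ sub])
  have "mat_in (subalg_gen (entry_coeffs (fused_S s (S_Y s)))) (S_Y s)"
    by (rule mat_in_fused_S_imp[OF subalgebra_subalg_gen mat_in_subalg_gen unital_S_Y])
  then show "Ytw2 s \<subseteq> subalg_gen (entry_coeffs (fused_S s (S_Y s)))"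
    unfolding mat_in_iff_entry_coeffs Ytw2_def by (rule subalg_gen_minimal[OF _ subalgebra_subalg_gen])
qed

section \<open>Scaling automorphisms and the isomorphism\<close>

lemma subst_uminus_nth: "fps_nth (subst (- 1) 0 f) n = (- 1) ^ n *\<^sub>C fps_nth f n"
proof -
  have x: "inv_lin (- 1) 0 = fps_const (- 1) * fps_X"
    by (rule inv_lin_eqI) (simp_all flip: fps_const_neg)
  have "fps_nth (inv_lin (- 1) 0 ^ r) n = (if n = r then (- 1) ^ n else 0)" for r
    unfolding x power_mult_distrib fps_const_power by (simp add: fps_X_power_nth)
  then show ?thesis
    by (simp add: subst_def if_distrib[of "\<lambda>c. c *\<^sub>C _"] cong: if_cong)
qed

lemma even_series_iff:
  fixes f :: "complex fps"
  shows "(\<forall>r. odd r \<longrightarrow> fps_nth f r = 0) \<longleftrightarrow> subst (- 1) 0 f = f"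
proof -
  have "((- 1) ^ n *\<^sub>C fps_nth f n = fps_nth f n) = (odd n \<longrightarrow> fps_nth f n = 0)" for n
    by (cases "even n") (auto simp: scaleC_complex_def)
  then show ?thesis by (auto simp: fps_eq_iff subst_uminus_nth)
qed

text \<open>For even g the series h(-u) solves the same equation as h(u), so uniqueness of the
  solution makes h even.\<close>

lemma subst_shifted_square:
  assumes "fps_nth g 0 = 1"
  obtains h where "fps_nth h 0 = 1" "shifted_square h = subst 1 (- (1/4)) g"
    "(\<forall>r. odd r \<longrightarrow> fps_nth g r = 0) \<Longrightarrow> (\<forall>r. odd r \<longrightarrow> fps_nth h r = (0 :: complex))"
proof -
  have g0: "fps_nth (subst 1 (- (1/4)) g) 0 = 1"
    using assms by (simp add: subst_nth_0)
  from shifted_square_surj[OF g0] obtain h where h: "fps_nth h 0 = 1" "shifted_square h = subst 1 (- (1/4)) g"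
    by blast
  moreover have "\<forall>r. odd r \<longrightarrow> fps_nth h r = 0" if even: "\<forall>r. odd r \<longrightarrow> fps_nth g r = 0"
  proof -
    \<comment> \<open>Reflecting h gives h(1-2u) h(-2u), the original product at 1/2 - u; on the
      other side g is evaluated at 1/4 - u.\<close>
    have "shifted_square (subst (- 1) 0 h) = subst (- 1) (1/2) (shifted_square h)"
      unfolding shifted_square_def by (simp add: subst_subst subst_mult mult.commute)
    also have "\<dots> = subst 1 (- (1/4)) (subst (- 1) 0 g)"
      unfolding h(2) by (simp add: subst_subst)
    also have "\<dots> = shifted_square h"
      using even h(2) unfolding even_series_iff by simp
    finally have "subst (- 1) 0 h = h"
      by (rule shifted_square_inj) (simp_all add: h subst_nth_0)
    then show ?thesis unfolding even_series_iff .
  qed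
  ultimately show ?thesis by (rule that)
qed

text \<open>Moved by 1/4, the product h(2u-1) h(2u) becomes h(2u-1/2) h(2u+1/2), which is symmetric
  under u to -u for even h. Hence the witness g and the shift of its argument.\<close>

lemma shifted_square_even:
  fixes h :: "complex fps"
  assumes "fps_nth h 0 = 1" "\<forall>r. odd r \<longrightarrow> fps_nth h r = 0"
  obtains g where "fps_nth g 0 = 1" "\<forall>r. odd r \<longrightarrow> fps_nth g r = 0" "shifted_square h = subst 1 (- (1/4)) g"
proof
  let ?g = "subst 2 (- (1/2)) h * subst 2 (1/2) h"
  show "fps_nth ?g 0 = 1" by (simp add: subst_nth_0 assms)
  have "subst 2 c (subst (- 1) 0 h) = subst (- 2) (- c) h" for c
    by (simp add: subst_subst)
  then have "subst 2 c h = subst (- 2) (- c) h" for c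
    using assms(2) unfolding even_series_iff by simp
  then have e: "subst (- 2) c h = subst 2 (- c) h" for c by simp
  show "\<forall>r. odd r \<longrightarrow> fps_nth ?g r = 0"
    unfolding even_series_iff by (simp add: subst_mult subst_subst e mult.commute)
  show "shifted_square h = subst 1 (- (1/4)) ?g"
    by (simp add: shifted_square_def subst_mult subst_subst)
qed

lemma mscale_mscale_cfps: "cfps f *\<^sub>m cfps g *\<^sub>m A = cfps (f * g) *\<^sub>m A"
  by (simp add: vec_eq_iff cfps_mult mult.assoc)

lemma fused_S_mscale: "fused_S s (cfps h *\<^sub>m S) = cfps (shifted_square h) *\<^sub>m fused_S s S"
proof -
  have 1: "map_mat (subst a b) (cfps h *\<^sub>m S) = cfps (subst a b h) *\<^sub>m map_mat (subst a b) S" if "a \<noteq> 0" for a b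
    using that by (simp add: vec_eq_iff subst_mult subst_cfps)
  have 2: "tens1 (cfps f *\<^sub>m A) = cfps f *\<^sub>m tens1 A" for f and A :: "'a fps^ix2^ix2"
    by (simp add: vec_eq_iff tens1_nth mult.assoc)
  have 3: "tens2 (cfps f *\<^sub>m A) = cfps f *\<^sub>m tens2 A" for f and A :: "'a fps^ix2^ix2"
    by (simp only: vec_eq_iff tens2_nth mscale_nth cfps_left_commute) simp
  have 4: "compress (cfps f *\<^sub>m A) = cfps f *\<^sub>m compress A" for f and A :: "'a fps^(ix2 \<times> ix2)^(ix2 \<times> ix2)"
    by (simp add: compress_conv mscale_matrix_mult matrix_mult_mscale[OF cfps_commute])
  show ?thesis
    by (simp add: fused_S_def 1 2 3 4 mscale_matrix_mult matrix_mult_mscale[OF cfps_commute]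
        mscale_mscale_cfps shifted_square_def mult.commute)
qed

definition D_Y :: "Y2 fps"
  where "D_Y = qdet * subst (- 1) 1 qdet"

text \<open>Both sides are products of the determinants at 2u, 2u+1, -2u and 1-2u. Only determinants
  of opposite slopes, or those at -2u and 1-2u, are exchanged, all within
  \<open>qdet_commute_qdet\<close>.\<close>

lemma w_Y_conv: "w_Y = subst 2 0 (D_Y * subst 1 1 D_Y)"
proof -
  let ?a = "subst 2 0 qdet" and ?b = "subst (- 2) 1 qdet" and ?c = "subst 2 1 qdet" and ?d = "subst (- 2) 0 qdet"
  have "w_Y = ?d * ?b * (?a * ?c)"
    by (simp add: w_Y_def z_Y_def)
  also have "\<dots> = ?b * (?d * ?a * ?c)"
    using qdet_commute_qdet[of "- 2" "- 2" 0 1] by (simp add: mult.assoc[symmetric])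
  also have "?d * ?a * ?c = ?a * ?d * ?c"
    using qdet_commute_qdet[of "- 2" 2 0 0] by simp
  also have "\<dots> = ?a * (?d * ?c)" by (rule mult.assoc)
  also have "?d * ?c = ?c * ?d"
    using qdet_commute_qdet[of "- 2" 2 0 1] by simp
  also have "?b * (?a * (?c * ?d)) = (?b * ?a) * (?c * ?d)" by (rule mult.assoc[symmetric])
  also have "?b * ?a = ?a * ?b"
    using qdet_commute_qdet[of "- 2" 2 1 0] by simp
  also have "?a * ?b * (?c * ?d) = subst 2 0 (D_Y * subst 1 1 D_Y)"
    by (simp add: D_Y_def subst_mult subst_subst mult.assoc)
  finally show ?thesis .
qed

lemma fps_nth_qdet_0: "fps_nth qdet 0 = 1"
  by (simp add: qdet_def subst_nth_0 unital_matD[OF unital_T_Y])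

section \<open>Series over non-unital subalgebras, applied to ideals\<close>

context
  fixes I :: "'a::complex_algebra_1 set"
  assumes I: "0 \<in> I" "\<And>x y. x \<in> I \<Longrightarrow> y \<in> I \<Longrightarrow> x + y \<in> I" "\<And>x y. x \<in> I \<Longrightarrow> y \<in> I \<Longrightarrow> x * y \<in> I"
    "\<And>c x. x \<in> I \<Longrightarrow> c *\<^sub>C x \<in> I"
begin

lemma nonunital_sum: "(\<And>i. i \<in> X \<Longrightarrow> f i \<in> I) \<Longrightarrow> sum f X \<in> I"
  by (induction X rule: infinite_finite_induct) (auto simp: I)

lemma nonunital_coeffs_in:
  assumes "coeffs_in I f"
  shows "coeffs_in I (subst a b f)" "coeffs_in I (cfps c * f)"
  using assms by (auto simp: coeffs_in_def subst_def cfps_mult_nth intro!: nonunital_sum I)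

lemma nonunital_shift_product:
  assumes "coeffs_in I F"
  shows "coeffs_in I ((1 + F) * subst 1 1 (1 + F) - 1)"
proof -
  have "(1 + F) * subst 1 1 (1 + F) - 1 = F + subst 1 1 F + F * subst 1 1 F"
    by (simp add: subst_add algebra_simps)
  then show ?thesis
    using assms nonunital_coeffs_in(1)[OF assms, of 1 1]
    by (auto simp: coeffs_in_def fps_mult_nth intro!: nonunital_sum I)
qed

text \<open>The coefficients of \<open>D(u) D(u+1) - 1\<close> are twice those of \<open>D(u) - 1\<close>, up to polynomials
  without constant term in lower coefficients.\<close>

lemma coeffs_in_shift_product_iff:
  assumes D0: "fps_nth D 0 = 1"
  shows "coeffs_in I (D * subst 1 1 D - 1) \<longleftrightarrow> coeffs_in I (D - 1)"
proof
  assume "coeffs_in I (D - 1)"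
  from nonunital_shift_product[OF this] show "coeffs_in I (D * subst 1 1 D - 1)" by simp
next
  assume W: "coeffs_in I (D * subst 1 1 D - 1)"
  have "fps_nth (D - 1) n \<in> I" for n
  proof (induction n rule: less_induct)
    case (less n)
    show ?case
    proof (cases "n = 0")
      case True
      then show ?thesis by (simp add: D0 I)
    next
      case False
      \<comment> \<open>By induction the truncation of D - 1 has coefficients in I, so the shifted
        product of D' minus 1 does too; comparing degree n isolates twice the n-th coefficient of D
        - 1.\<close>
      define D' where "D' = 1 + truncate n (D - 1)"
      have "coeffs_in I (truncate n (D - 1))"
        using less by (auto simp: coeffs_in_def truncate_nth I)
      then have W': "coeffs_in I (D' * subst 1 1 D' - 1)"
        unfolding D'_def by (rule nonunital_shift_product)
      have ag: "agree_below n D D'"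
        by (simp add: agree_below_def D'_def truncate_nth)
      let ?e = "fps_nth (D - 1) n"
      have e: "fps_nth D n - fps_nth D' n = ?e"
        using False by (simp add: D'_def truncate_nth)
      have "fps_nth (D * subst 1 1 D) n - fps_nth (D' * subst 1 1 D') n = ?e + ?e"
        using mult_agree_below(2)[OF _ ag subst_agree_below(1)[OF _ ag], of 1 1]
          subst_agree_below(2)[OF _ ag, of 1 1] False
        by (simp only: e) (simp add: D0 subst_nth_0 scaleC_one)
      then have "?e + ?e = fps_nth (D * subst 1 1 D - 1) n + (- 1) *\<^sub>C fps_nth (D' * subst 1 1 D' - 1) n"
        by (simp add: scaleC_minus_left scaleC_one)
      also have "\<dots> \<in> I"
        by (intro I coeffs_in_nth W W')
      finally have "(1 / 2) *\<^sub>C (?e + ?e) \<in> I" by (rule I)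
      moreover have "(1 / 2) *\<^sub>C (?e + ?e) = (1 / 2 + 1 / 2) *\<^sub>C ?e"
        unfolding scaleC_add_left by (rule scaleC_add_right)
      ultimately show ?thesis
        by (simp add: scaleC_one)
    qed
  qed
  then show "coeffs_in I (D - 1)" by (simp add: coeffs_in_def)
qed

end

lemma ideal_nonunital:
  assumes A: "subalgebra A" and I: "ideal I (alg_of A)"
  shows "0 \<in> I" "x \<in> I \<Longrightarrow> y \<in> I \<Longrightarrow> x + y \<in> I" "x \<in> I \<Longrightarrow> y \<in> I \<Longrightarrow> x * y \<in> I"
    "x \<in> I \<Longrightarrow> c *\<^sub>C x \<in> I"
proof -
  note * = I[unfolded ideal_alg_of_iff[OF A]]
  show "0 \<in> I" "x \<in> I \<Longrightarrow> y \<in> I \<Longrightarrow> x + y \<in> I" "x \<in> I \<Longrightarrow> y \<in> I \<Longrightarrow> x * y \<in> I"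
    using * by auto
  show "c *\<^sub>C x \<in> I" if "x \<in> I"
  proof -
    have "(c *\<^sub>C 1) * x \<in> I" using * that subalgebraD(4)[OF A subalgebraD(1)[OF A], of c] by blast
    then show ?thesis by (simp add: mult_scaleC_left)
  qed
qed

lemma range_fps_nth_subset: "range (fps_nth f) \<subseteq> I \<longleftrightarrow> coeffs_in I f"
  by (auto simp: coeffs_in_def)

lemma gamma2_inverse: "inverse (gamma2 s) * gamma2 s = 1"
proof (rule inverse_mult_eq_1)
  have "fps_nth (2 - fps_X :: complex fps) 0 \<noteq> 0" by (simp add: numeral_fps_const)
  then show "fps_nth (gamma2 s) 0 \<noteq> 0"
    by (cases s) (simp_all add: gamma2_def fps_divide_unit numeral_fps_const)
qed

lemma subalgebra_Ytw2: "subalgebra (Ytw2 s)"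
  unfolding Ytw2_def by (rule subalgebra_subalg_gen)

lemma subalgebra_Xtw: "subalgebra (Xtw q)"
  unfolding Xtw_def by (rule subalgebra_subalg_gen)

text \<open>The factor \<open>gamma2\<close> is an invertible complex series and the substitution of
  2u for u is invertible; neither changes which ideals contain all coefficients. The rest is
  \<open>coeffs_in_shift_product_iff\<close>.\<close>

lemma sdet_ideal_conv: "sdet_ideal s = genideal (alg_of (Ytw2 s)) (range (fps_nth (w_Y - 1)))"
  unfolding sdet_ideal_def
proof (rule genideal_cong)
  fix I assume "ideal I (alg_of (Ytw2 s))"
  note cl = ideal_nonunital[OF subalgebra_Ytw2 this]
  note c = nonunital_coeffs_in[of I, OF cl]
  have s: "sdet s - cfps (gamma2 s) = cfps (gamma2 s) * (D_Y - 1)"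
    by (simp add: sdet_def D_Y_def right_diff_distrib mult.assoc)
  have "cfps (inverse (gamma2 s)) * (cfps (gamma2 s) * (D_Y - 1)) = cfps (inverse (gamma2 s) * gamma2 s) * (D_Y - 1)"
    by (simp only: cfps_mult mult.assoc)
  then have s': "cfps (inverse (gamma2 s)) * (cfps (gamma2 s) * (D_Y - 1)) = D_Y - 1"
    by (simp add: gamma2_inverse)
  have w: "w_Y - 1 = subst 2 0 (D_Y * subst 1 1 D_Y - 1)"
    by (simp add: w_Y_conv subst_diff)
  have w': "subst (1/2) 0 (w_Y - 1) = D_Y * subst 1 1 D_Y - 1"
    unfolding w by (simp add: subst_subst)
  have "fps_nth D_Y 0 = 1"
    by (simp add: D_Y_def subst_nth_0 fps_nth_qdet_0)
  note D = coeffs_in_shift_product_iff[of I, OF cl this]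
  show "range (fps_nth (sdet s - cfps (gamma2 s))) \<subseteq> I \<longleftrightarrow> range (fps_nth (w_Y - 1)) \<subseteq> I"
    unfolding range_fps_nth_subset s
    using c(2)[of "cfps (gamma2 s) * (D_Y - 1)" "inverse (gamma2 s)", unfolded s'] c(2)[of "D_Y - 1" "gamma2 s"]
      c(1)[of "w_Y - 1" "1/2" 0, unfolded w'] c(1)[of "D_Y * subst 1 1 D_Y - 1" 2 0, folded w] D
    by blast
qed

lemma alg_iso_compose:
  assumes "f \<in> alg_iso (alg_of A) (alg_of B)" "g \<in> alg_iso (alg_of B) (alg_of C)"
  shows "g \<circ> f \<in> alg_iso (alg_of A) (alg_of C)"
proof -
  have "f x \<in> B" if "x \<in> A" for x
    using assms(1) that by (auto simp: alg_iso_alg_of_iff bij_betw_def)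
  with assms show ?thesis
    by (auto simp: alg_iso_alg_of_iff intro: bij_betw_trans)
qed

lemma alg_iso_inverse:
  assumes h: "h \<in> alg_iso (alg_of A) (alg_of B)" and A: "subalgebra A" and g: "\<And>x. x \<in> A \<Longrightarrow> g (h x) = x"
  shows "g \<in> alg_iso (alg_of B) (alg_of A)"
proof -
  interpret h: algebra_hom_on A h by (rule algebra_hom_onI[OF A h])
  have B: "B = h ` A" using h by (auto simp: alg_iso_alg_of_iff bij_betw_def)
  show ?thesis
    unfolding alg_iso_alg_of_iff B
  proof (intro conjI ballI allI)
    show "bij_betw g (h ` A) A"
      by (rule bij_betw_byWitness[where f' = h]) (auto simp: g)
    show "g 1 = 1"
      using g[OF subalgebraD(1)[OF A]] by (simp add: h.one)
  next
    fix x y assume "x \<in> h ` A" "y \<in> h ` A"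
    then show "g (x * y) = g x * g y" "g (x + y) = g x + g y"
      by (auto simp: g subalgebraD[OF A] simp flip: h.mult h.add)
  next
    fix c x assume "x \<in> h ` A"
    then show "g (c *\<^sub>C x) = c *\<^sub>C g x"
      by (auto simp: g subalgebraD[OF A] simp flip: h.scaleC)
  qed
qed

theorem proposition4p3:
  fixes \<psi> :: "X_so3 \<Rightarrow> Y2" and s :: pm and q :: nat
  assumes q: "q = (case s of Minus \<Rightarrow> 0 | Plus \<Rightarrow> 1)"
    and \<psi>_iso: "\<psi> \<in> alg_iso (alg_of UNIV) (alg_of UNIV)"
    and \<psi>_T: "map_mat (fps_map \<psi>) T_X =
      compress (proj_V ** tens1 (map_mat (subst 2 (- (1/2))) T_Y)
                       ** tens2 (map_mat (subst 2 (1/2)) T_Y))"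
  shows
    "(\<psi> \<in> alg_iso (alg_of (Xtw q)) (alg_of (Ytw2 s)) \<and>
      map_mat (fps_map \<psi>) (S_X q) =
        compress (proj_V ** tens1 (map_mat (subst 2 (- 1)) (S_Y s))
                         ** R2_transp s (cfps (inv_lin (- 4) 1))
                         ** tens2 (map_mat (subst 2 0) (S_Y s))
                         ** (((**) (tens1 K2 ** tens2 K2)) ^^ q) (mat 1))) \<and>
     (\<exists>\<phi> \<in> alg_iso (Ytw_quot q) (SY_quot s). \<forall>x \<in> Xtw q.
        \<phi> (unitarity_ideal q +>\<^bsub>alg_of (Xtw q)\<^esub> x) = sdet_ideal s +>\<^bsub>alg_of (Ytw2 s)\<^esub> \<psi> x) \<and>
     \<psi> \<in> alg_iso (alg_of (Ytw_sub q)) (alg_of (SY_sub s))"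
proof -
  interpret \<psi>: algebra_hom_on UNIV \<psi>
    by (rule algebra_hom_onI[OF subalgebra_UNIV \<psi>_iso])
  have bij: "bij \<psi>" using \<psi>_iso by (simp add: alg_iso_alg_of_iff)
  have q': "q = pm_index s" by (simp add: q pm_index_def)
  have T: "map_mat (fps_map \<psi>) T_X = fused_T 2 (- (1/2))"
    by (simp add: \<psi>_T fused_T_def)
  have K: "map_mat (fps_map \<psi>) (diag3 f) = diag3 f" for f
  proof -
    have "fps_map \<psi> (diag3 f $ i $ j) = diag3 f $ i $ j" for i j
      by (cases "i = j") (simp_all add: diag3_nth \<psi>.fps_map_cfps \<psi>.fps_map_0)
    then show ?thesis by (simp add: vec_eq_iff)
  qed
  \<comment> \<open>At u - 1/4 the arguments 2u - 1/2, 2u + 1/2 become 2u - 1, 2u; at 1/4 - u they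
    become -2u, 1 - 2u. These are the fused matrices of \<open>fused_S_Y\<close>.\<close>
  have S: "map_mat (fps_map \<psi>) (S_X q) = fused_S s (S_Y s)"
    unfolding S_X_def q' K3_conv fused_S_Y
    by (simp add: \<psi>.map_mult \<psi>.map_subst K map_mat_transp3 T map_mat_subst_fused_T)
  have im: "\<psi> ` Xtw q = Ytw2 s"
    unfolding Xtw_def image_subalg_gen[OF \<psi>.algebra_hom_on_axioms] entry_coeffs_map[symmetric] S
    by (rule entry_coeffs_fused_S_Y)
  have inj: "inj_on \<psi> A" for A using bij by (metis bij_def inj_on_subset subset_UNIV)
  have iso: "\<psi> \<in> alg_iso (alg_of (Xtw q)) (alg_of (Ytw2 s))"
    using im inj by (simp add: alg_iso_alg_of_iff bij_betw_def \<psi>.one \<psi>.mult \<psi>.add \<psi>.scaleC)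
  have formula: "map_mat (fps_map \<psi>) (S_X q) =
        compress (proj_V ** tens1 (map_mat (subst 2 (- 1)) (S_Y s))
                         ** R2_transp s (cfps (inv_lin (- 4) 1))
                         ** tens2 (map_mat (subst 2 0) (S_Y s))
                         ** (((**) (tens1 K2 ** tens2 K2)) ^^ q) (mat 1))"
    using S unfolding fused_S_def K_power_def q' .
  \<comment> \<open>\<open>w_X\<close> is a definite description; its existence is obtained by
    pulling the scalar of the unitarity identity in Y(2) back along \<psi>.\<close>
  define w where "w = fps_map (inv_into UNIV \<psi>) w_Y"
  have injm: "A = B" if "map_mat (fps_map \<psi>) A = map_mat (fps_map \<psi>) B" for A B :: "X_so3 fps^ix3^ix3"
    using that bij by (simp add: vec_eq_iff fps_eq_iff fps_map_nth bij_def inj_eq)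
  have \<psi>w: "fps_map \<psi> w = w_Y"
    using bij by (simp add: w_def fps_eq_iff fps_map_nth bij_def surj_f_inv_f)
  have "map_mat (fps_map \<psi>) (mat w :: X_so3 fps^ix3^ix3) = mat w_Y"
    by (simp add: vec_eq_iff mat_def \<psi>w \<psi>.fps_map_0)
  then have "S_X q ** map_mat (subst (- 1) 0) (S_X q) = mat w"
    by (intro injm) (simp add: \<psi>.map_mult \<psi>.map_subst S fused_S_Y_unitary)
  \<comment> \<open>A multiple of the identity determines its scalar, which gives
    uniqueness.\<close>
  then have Sw: "S_X q ** map_mat (subst (- 1) 0) (S_X q) = mat w_w \<longleftrightarrow> w_w = w" for w_w
    by (auto simp: vec_eq_iff mat_def split: if_splits)
  have w_X: "w_X q = w"
    unfolding w_X_def Sw by simp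
  \<comment> \<open>The generators of the unitarity ideal must lie in the twisted Yangian: w is a
    diagonal entry of a product of matrices over it.\<close>
  have "mat_in (Xtw q) (S_X q)"
    unfolding Xtw_def by (rule mat_in_subalg_gen)
  then have "mat_in (Xtw q) (S_X q ** map_mat (subst (- 1) 0) (S_X q))"
    by (intro mat_in_mult mat_in_subst subalgebra_Xtw)
  from mat_inD[OF this, of Neg3 Neg3] have "coeffs_in (Xtw q) w"
    using Sw[of w] by (simp add: mat_def)
  then have w_sub: "range (fps_nth (w - 1)) \<subseteq> Xtw q"
    unfolding range_fps_nth_subset by (intro coeffs_in_diff coeffs_in_1 subalgebra_Xtw)
  have "fps_map \<psi> (w - 1) = w_Y - 1"
    by (simp add: \<psi>.fps_map_diff \<psi>w \<psi>.fps_map_1)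
  then have "\<psi> ` range (fps_nth (w - 1)) = range (fps_nth (w_Y - 1))"
    by (simp only: image_image flip: \<psi>.fps_map_nth)
  then have J: "\<psi> ` unitarity_ideal q = sdet_ideal s"
    unfolding unitarity_ideal_def w_X sdet_ideal_conv
    using image_genideal[OF subalgebra_Xtw subalgebra_Ytw2 iso w_sub] by simp
  interpret RX: Ring.ring "alg_of (Xtw q)" by (rule ring_alg_of[OF subalgebra_Xtw])
  have "ideal (unitarity_ideal q) (alg_of (Xtw q))"
    unfolding unitarity_ideal_def w_X by (rule RX.genideal_ideal) (simp only: alg_of_simps w_sub)
  then have I: "unitarity_ideal q \<subseteq> Xtw q"
    unfolding ideal_alg_of_iff[OF subalgebra_Xtw] by (rule conjunct1)
  note quot = quot_alg_iso[OF subalgebra_Xtw subalgebra_Ytw2 iso I J, folded Ytw_quot_def SY_quot_def]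
  define \<psi>' where "\<psi>' = inv_into UNIV \<psi>"
  have \<psi>': "\<psi>' (\<psi> x) = x" "\<psi> (\<psi>' y) = y" for x y
    using bij by (simp_all add: \<psi>'_def bij_def surj_f_inv_f)
  have iso': "\<psi>' \<in> alg_iso (alg_of (Ytw2 s)) (alg_of (Xtw q))"
    by (rule alg_iso_inverse[OF iso subalgebra_Xtw]) (rule \<psi>')
  have S_Y_in: "mat_in (Ytw2 s) (S_Y s)"
    unfolding Ytw2_def by (rule mat_in_subalg_gen)
  \<comment> \<open>\<psi> turns the scaling condition for \<alpha> into an equation between fused
    matrices; injectivity of fusion on unital matrices then removes the fusion.\<close>
  have scaling: "map_mat (fps_map \<alpha>) (S_X q) = cfps (subst 1 (- (1/4)) g) *\<^sub>m S_X q
      \<longleftrightarrow> map_mat (fps_map \<beta>) (S_Y s) = cfps (subst 1 0 h) *\<^sub>m S_Y s"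
    if \<beta>: "\<beta> \<in> alg_iso (alg_of (Ytw2 s)) (alg_of (Ytw2 s))"
      and \<alpha>\<beta>: "\<And>x. x \<in> Xtw q \<Longrightarrow> \<psi> (\<alpha> x) = \<beta> (\<psi> x)"
      and h: "fps_nth h 0 = 1" "shifted_square h = subst 1 (- (1/4)) g" for \<alpha> \<beta> g h
  proof -
    interpret \<beta>: algebra_hom_on "Ytw2 s" \<beta>
      by (rule algebra_hom_onI[OF subalgebra_Ytw2 \<beta>])
    have "map_mat (fps_map \<psi>) (map_mat (fps_map \<alpha>) (S_X q)) = map_mat (fps_map \<beta>) (map_mat (fps_map \<psi>) (S_X q))"
      using \<open>mat_in (Xtw q) (S_X q)\<close>
      by (simp add: vec_eq_iff fps_eq_iff fps_map_nth mat_in_def coeffs_in_def \<alpha>\<beta>)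
    then have l: "map_mat (fps_map \<psi>) (map_mat (fps_map \<alpha>) (S_X q)) = fused_S s (map_mat (fps_map \<beta>) (S_Y s))"
      unfolding S \<beta>.map_fused_S[OF S_Y_in] .
    have "map_mat (fps_map \<psi>) (cfps k *\<^sub>m S_X q) = cfps k *\<^sub>m map_mat (fps_map \<psi>) (S_X q)" for k
      by (simp add: vec_eq_iff \<psi>.fps_map_mult \<psi>.fps_map_cfps)
    then have r: "map_mat (fps_map \<psi>) (cfps (subst 1 (- (1/4)) g) *\<^sub>m S_X q) = fused_S s (cfps h *\<^sub>m S_Y s)"
      unfolding fused_S_mscale h(2) S .
    have u: "unital_mat (map_mat (fps_map \<beta>) (S_Y s))"
    proof -
      have "\<beta> (of_bool b) = of_bool b" for b by (cases b) (simp_all add: \<beta>.zero \<beta>.one)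
      then show ?thesis by (simp add: unital_mat_def fps_map_nth unital_matD[OF unital_S_Y])
    qed
    have u': "unital_mat (cfps h *\<^sub>m S_Y s)"
      by (simp add: unital_mat_def cfps_nth h scaleC_one unital_matD[OF unital_S_Y])
    have "fused_S s (map_mat (fps_map \<beta>) (S_Y s)) = fused_S s (cfps h *\<^sub>m S_Y s)
        \<longleftrightarrow> map_mat (fps_map \<beta>) (S_Y s) = cfps h *\<^sub>m S_Y s"
      by (rule iffI, erule fused_S_inj[OF _ u u'], simp)
    moreover have "map_mat (fps_map \<alpha>) (S_X q) = cfps (subst 1 (- (1/4)) g) *\<^sub>m S_X q
        \<longleftrightarrow> fused_S s (map_mat (fps_map \<beta>) (S_Y s)) = fused_S s (cfps h *\<^sub>m S_Y s)"
      unfolding l[symmetric] r[symmetric] by (rule iffI, simp, rule injm)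
    ultimately show ?thesis by simp
  qed
  have sub_iff: "x \<in> Ytw_sub q \<longleftrightarrow> \<psi> x \<in> SY_sub s" if x: "x \<in> Xtw q" for x
  proof
    assume xs: "x \<in> Ytw_sub q"
    have "\<beta> (\<psi> x) = \<psi> x"
      if h: "fps_nth h 0 = 1" "\<forall>r. odd r \<longrightarrow> fps_nth h r = 0"
        and \<beta>: "\<beta> \<in> alg_iso (alg_of (Ytw2 s)) (alg_of (Ytw2 s))"
        and sc: "map_mat (fps_map \<beta>) (S_Y s) = cfps (subst 1 0 h) *\<^sub>m S_Y s" for h \<beta>
    proof -
      obtain g where g: "fps_nth g 0 = 1" "\<forall>r. odd r \<longrightarrow> fps_nth g r = 0" "shifted_square h = subst 1 (- (1/4)) g"
        using shifted_square_even[OF h] .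
      \<comment> \<open>The conjugate of \<beta> scales S(u) by the even g just obtained, so it
        fixes x.\<close>
      define \<alpha> where "\<alpha> = \<psi>' \<circ> \<beta> \<circ> \<psi>"
      have "\<alpha> \<in> alg_iso (alg_of (Xtw q)) (alg_of (Xtw q))"
        unfolding \<alpha>_def comp_assoc by (intro alg_iso_compose[OF _ iso'] alg_iso_compose[OF iso \<beta>])
      moreover have "map_mat (fps_map \<alpha>) (S_X q) = cfps (subst 1 (- (1/4)) g) *\<^sub>m S_X q"
        by (rule scaling[OF \<beta> _ h(1) g(3), THEN iffD2, OF _ sc]) (simp add: \<alpha>_def \<psi>')
      ultimately have "\<alpha> x = x"
        using xs g unfolding Ytw_sub_def scaling_invariants_def by blast
      then show ?thesis by (metis \<alpha>_def \<psi>'(2) comp_apply)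
    qed
    then show "\<psi> x \<in> SY_sub s"
      using x im unfolding SY_sub_def scaling_invariants_def by blast
  next
    assume xs: "\<psi> x \<in> SY_sub s"
    have "\<alpha> x = x"
      if g: "fps_nth g 0 = 1" "\<forall>r. odd r \<longrightarrow> fps_nth g r = 0"
        and \<alpha>: "\<alpha> \<in> alg_iso (alg_of (Xtw q)) (alg_of (Xtw q))"
        and sc: "map_mat (fps_map \<alpha>) (S_X q) = cfps (subst 1 (- (1/4)) g) *\<^sub>m S_X q" for g \<alpha>
    proof -
      obtain h where h: "fps_nth h 0 = 1" "shifted_square h = subst 1 (- (1/4)) g" "\<forall>r. odd r \<longrightarrow> fps_nth h r = 0"
        using subst_shifted_square[OF g(1)] g(2) by metis
      \<comment> \<open>Evenness of h places this conjugate among the automorphisms that define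
        \<open>SY_sub\<close>.\<close>
      define \<beta> where "\<beta> = \<psi> \<circ> \<alpha> \<circ> \<psi>'"
      have \<beta>: "\<beta> \<in> alg_iso (alg_of (Ytw2 s)) (alg_of (Ytw2 s))"
        unfolding \<beta>_def comp_assoc by (intro alg_iso_compose[OF _ iso] alg_iso_compose[OF iso' \<alpha>])
      moreover have "map_mat (fps_map \<beta>) (S_Y s) = cfps (subst 1 0 h) *\<^sub>m S_Y s"
        by (rule scaling[OF \<beta> _ h(1,2), THEN iffD1, OF _ sc]) (simp add: \<beta>_def \<psi>')
      ultimately have "\<beta> (\<psi> x) = \<psi> x"
        using xs h unfolding SY_sub_def scaling_invariants_def by blast
      then show ?thesis by (metis \<beta>_def \<psi>'(1) comp_apply)
    qed
    then show "x \<in> Ytw_sub q"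
      using x unfolding Ytw_sub_def scaling_invariants_def by blast
  qed
  have "Ytw_sub q \<subseteq> Xtw q" "SY_sub s \<subseteq> \<psi> ` Xtw q"
    unfolding im by (auto simp: Ytw_sub_def SY_sub_def scaling_invariants_def)
  then have "\<psi> ` Ytw_sub q = SY_sub s"
    using sub_iff by blast
  then have "\<psi> \<in> alg_iso (alg_of (Ytw_sub q)) (alg_of (SY_sub s))"
    using inj by (simp add: alg_iso_alg_of_iff bij_betw_def \<psi>.one \<psi>.mult \<psi>.add \<psi>.scaleC)
  with iso formula quot show ?thesis by blast
qed

end
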